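(* Let $x_0\ge 0$ and let $X_1$ be the value at time $t=1$ of the strong solution of $dX_t = 1\,dt + 2\sqrt{X_t}\,dW_t$, $X_0=x_0$. For $n\in\mathbb N$ let $$\widehat X^{(n)}_1=\left(\left(W_1+\sqrt{x_0}\right)+\left(\min_{0\le k\le n}W_{k/n}+\sqrt{x_0}\right)^-\right)^2 .$$ Then for every $1\le p<\infty$, $$e_p\left(\widehat X^{(n)}_1\right)\preccurlyeq n^{-1/2}.$$ In particular, the $n$-th minimal error for equidistant methods satisfies $e_p^{\mathrm{eq}}(n)\preccurlyeq n^{-1/2}$.
   Context: $W=(W_t)_{t\ge0}$ is a standard one-dimensional Brownian motion with respect to a filtration satisfying the usual conditions on a complete probability space. The SDE $dX_t = 1\,dt + 2\sqrt{X_t}\,dW_t$, $X_0=x_0\ge0$, driven by $W$, has a unique non-negative strong solution $X$. Write $x^-=-\min(0,x)$. For a random variable $\widehat X_1$ and $p\in[1,\infty)$ put $e_p(\widehat X_1)=\left(\mathrm{E}\,|X_1-\widehat X_1|^p\right)^{1/p}$. For $n\in\mathbb N=\{1,2,\dots\}$ define $$e_p^{\mathrm{eq}}(n)=\inf\left\{e_p(\widehat X_1):\ \widehat X_1=\Phi(W_{1/n},W_{2/n},\dots,W_1),\ \Phi:\mathbb R^n\to\mathbb R\text{ Borel-measurable}\right\}.$$ For sequences of non-negative reals, $a_n\preccurlyeq b_n$ means there is a constant $c>0$ with $a_n\le c\,b_n$ for all $n\in\mathbb N$ (the constant may depend on $p$ and $x_0$, but not on $n$). *)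

theory Defs
  imports "HOL-Probability.Probability"
begin

section \<open>Filtered probability spaces and Brownian motion\<close>

text \<open>
  Time is indexed by \<^typ>\<open>real\<close> and only indices \<open>t \<ge> 0\<close> matter. A filtration on \<open>[0, \<infinity>)\<close> is
  an instance of the locale \<^locale>\<open>filtration\<close> by extending it with \<open>F t = F 0\<close> for \<open>t < 0\<close>.
  Only the \<open>\<sigma>\<close>-algebra of \<open>F t\<close> is relevant, not its measure.
\<close>

locale usual_filtered_prob_space =
  prob_space M + complete_measure M + filtration "space M" F
  for M :: "'a measure" and F :: "real \<Rightarrow> 'a measure" +
  assumes sets_F_subset: "sets (F t) \<subseteq> sets M"
    and null_sets_F0: "null_sets M \<subseteq> sets (F 0)"
    and right_continuous: "t \<ge> 0 \<Longrightarrow> sets (F t) = (\<Inter>s\<in>{t<..}. sets (F s))"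

definition adapted :: "(real \<Rightarrow> 'a measure) \<Rightarrow> (real \<Rightarrow> 'a \<Rightarrow> real) \<Rightarrow> bool" where
  "adapted F Y \<longleftrightarrow> (\<forall>t\<ge>0. Y t \<in> borel_measurable (F t))"

definition progressively_measurable ::
  "(real \<Rightarrow> 'a measure) \<Rightarrow> (real \<Rightarrow> 'a \<Rightarrow> real) \<Rightarrow> bool" where
  "progressively_measurable F Y \<longleftrightarrow>
     (\<forall>t\<ge>0. (\<lambda>(s, \<omega>). Y s \<omega>) \<in> borel_measurable (restrict_space borel {0..t} \<Otimes>\<^sub>M F t))"

definition brownian_motion ::
  "'a measure \<Rightarrow> (real \<Rightarrow> 'a measure) \<Rightarrow> (real \<Rightarrow> 'a \<Rightarrow> real) \<Rightarrow> bool" where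
  "brownian_motion M F W \<longleftrightarrow>
     adapted F W \<and>
     (AE \<omega> in M. W 0 \<omega> = 0) \<and>
     (AE \<omega> in M. continuous_on {0..} (\<lambda>t. W t \<omega>)) \<and>
     (\<forall>s t. 0 \<le> s \<and> s < t \<longrightarrow>
        distributed M lborel (\<lambda>\<omega>. W t \<omega> - W s \<omega>) (\<lambda>x. ennreal (normal_density 0 (sqrt (t - s)) x)) \<and>
        prob_space.indep_set M (sets (F s))
          (sets (vimage_algebra (space M) (\<lambda>\<omega>. W t \<omega> - W s \<omega>) borel)))"


section \<open>The Ito integral\<close>

text \<open>
  A simple integrand is
  \<open>\<Sum>i<m. \<xi> i \<cdot> 1\<^bsub>(\<tau> i, \<tau> (i + 1)]\<^esub>\<close> with deterministic times \<open>\<tau>\<close>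
  and bounded \<open>F (\<tau> i)\<close>-measurable coefficients \<open>\<xi> i\<close>.
\<close>

definition simple_integrand ::
  "'a measure \<Rightarrow> (real \<Rightarrow> 'a measure) \<Rightarrow> nat \<Rightarrow> (nat \<Rightarrow> real) \<Rightarrow> (nat \<Rightarrow> 'a \<Rightarrow> real) \<Rightarrow> bool" where
  "simple_integrand M F m \<tau> \<xi> \<longleftrightarrow>
     0 \<le> \<tau> 0 \<and> (\<forall>i<m. \<tau> i \<le> \<tau> (Suc i)) \<and>
     (\<forall>i<m. \<xi> i \<in> borel_measurable (F (\<tau> i))) \<and>
     (\<exists>B. \<forall>i<m. \<forall>\<omega>\<in>space M. \<bar>\<xi> i \<omega>\<bar> \<le> B)"

definition simple_process ::
  "nat \<Rightarrow> (nat \<Rightarrow> real) \<Rightarrow> (nat \<Rightarrow> 'a \<Rightarrow> real) \<Rightarrow> real \<Rightarrow> 'a \<Rightarrow> real" where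
  "simple_process m \<tau> \<xi> s \<omega> = (\<Sum>i<m. \<xi> i \<omega> * indicator {\<tau> i<..\<tau> (Suc i)} s)"

definition simple_integral ::
  "(real \<Rightarrow> 'a \<Rightarrow> real) \<Rightarrow> nat \<Rightarrow> (nat \<Rightarrow> real) \<Rightarrow> (nat \<Rightarrow> 'a \<Rightarrow> real) \<Rightarrow> real \<Rightarrow> 'a \<Rightarrow> real" where
  "simple_integral W m \<tau> \<xi> t \<omega> =
     (\<Sum>i<m. \<xi> i \<omega> * (W (min (\<tau> (Suc i)) t) \<omega> - W (min (\<tau> i) t) \<omega>))"

definition tendsto_0_in_prob :: "'a measure \<Rightarrow> (nat \<Rightarrow> 'a \<Rightarrow> ennreal) \<Rightarrow> bool" where
  "tendsto_0_in_prob M Z \<longleftrightarrow>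
     (\<forall>\<epsilon>>0. (\<lambda>n. measure M {\<omega> \<in> space M. ennreal \<epsilon> < Z n \<omega>}) \<longlonglongrightarrow> 0)"

text \<open>
  \<open>has_ito_integral M F W H t J\<close> states that \<open>J\<close> is (a version of) \<open>\<integral>\<^sub>0\<^sup>t H dW\<close>, for \<open>H\<close>
  progressively measurable with \<open>\<integral>\<^sub>0\<^sup>t H\<^sup>2 ds < \<infinity>\<close> almost surely: \<open>J\<close> is the limit in probability
  of integrals of simple integrands \<open>S n\<close> with \<open>\<integral>\<^sub>0\<^sup>t (S n - H)\<^sup>2 ds \<rightarrow> 0\<close> in probability.
  Neither the existence of such a sequence nor the limit's independence of it is assumed; both are
  part of the classical theory.
\<close>

definition has_ito_integral ::
  "'a measure \<Rightarrow> (real \<Rightarrow> 'a measure) \<Rightarrow> (real \<Rightarrow> 'a \<Rightarrow> real) \<Rightarrow> (real \<Rightarrow> 'a \<Rightarrow> real) \<Rightarrow>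
   real \<Rightarrow> ('a \<Rightarrow> real) \<Rightarrow> bool" where
  "has_ito_integral M F W H t J \<longleftrightarrow>
     progressively_measurable F H \<and>
     (AE \<omega> in M. (\<integral>\<^sup>+ s\<in>{0..t}. ennreal ((H s \<omega>)\<^sup>2) \<partial>lborel) < \<infinity>) \<and>
     J \<in> borel_measurable M \<and>
     (\<exists>m \<tau> \<xi>.
        (\<forall>n. simple_integrand M F (m n) (\<tau> n) (\<xi> n)) \<and>
        tendsto_0_in_prob M (\<lambda>n \<omega>.
          \<integral>\<^sup>+ s\<in>{0..t}. ennreal ((simple_process (m n) (\<tau> n) (\<xi> n) s \<omega> - H s \<omega>)\<^sup>2) \<partial>lborel) \<and>
        tendsto_0_in_prob M (\<lambda>n \<omega>. ennreal \<bar>simple_integral W (m n) (\<tau> n) (\<xi> n) t \<omega> - J \<omega>\<bar>))"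


section \<open>Strong solutions\<close>

text \<open>
  Solutions of \<open>dX = b(X) dt + \<sigma>(X) dW\<close>, \<open>X 0 = x0\<close>, driven by the given Brownian motion \<open>W\<close> on the
  given filtered space. Adaptedness is required with respect to \<open>F\<close>; this includes every process
  adapted to the smaller augmented filtration generated by \<open>W\<close>. The case \<open>t = 0\<close> of
  the integral equation yields the initial condition.
\<close>

definition strong_solution ::
  "'a measure \<Rightarrow> (real \<Rightarrow> 'a measure) \<Rightarrow> (real \<Rightarrow> 'a \<Rightarrow> real) \<Rightarrow> (real \<Rightarrow> real) \<Rightarrow> (real \<Rightarrow> real) \<Rightarrow>
   real \<Rightarrow> (real \<Rightarrow> 'a \<Rightarrow> real) \<Rightarrow> bool" where
  "strong_solution M F W b \<sigma> x0 X \<longleftrightarrow>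
     adapted F X \<and>
     (AE \<omega> in M. continuous_on {0..} (\<lambda>t. X t \<omega>)) \<and>
     (\<forall>t\<ge>0.
        (AE \<omega> in M. set_integrable lborel {0..t} (\<lambda>s. b (X s \<omega>))) \<and>
        (\<exists>J. has_ito_integral M F W (\<lambda>s \<omega>. \<sigma> (X s \<omega>)) t J \<and>
             (AE \<omega> in M. X t \<omega> = x0 + (LINT s:{0..t}|lborel. b (X s \<omega>)) + J \<omega>)))"


section \<open>Errors\<close>

text \<open>
  The error \<open>(E |X - Y|^p)^(1/p)\<close> is extended-valued, so that non-integrable differences have
  infinite error (a Bochner integral would give them error \<open>0\<close>).
\<close>

definition Lp_error :: "'a measure \<Rightarrow> real \<Rightarrow> ('a \<Rightarrow> real) \<Rightarrow> ('a \<Rightarrow> real) \<Rightarrow> ennreal" where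
  "Lp_error M p X Y =
     (let m = (\<integral>\<^sup>+ \<omega>. ennreal (\<bar>X \<omega> - Y \<omega>\<bar> powr p) \<partial>M)
      in if m = \<infinity> then \<infinity> else ennreal (enn2real m powr (1 / p)))"

definition min_error_eq ::
  "'a measure \<Rightarrow> (real \<Rightarrow> 'a \<Rightarrow> real) \<Rightarrow> real \<Rightarrow> ('a \<Rightarrow> real) \<Rightarrow> nat \<Rightarrow> ennreal" where
  "min_error_eq M W p X1 n =
     (INF \<Phi> \<in> borel_measurable (PiM {1..n} (\<lambda>_. borel)).
        Lp_error M p X1 (\<lambda>\<omega>. \<Phi> (\<lambda>k\<in>{1..n}. W (real k / real n) \<omega>)))"

definition preccurlyeq :: "(nat \<Rightarrow> ennreal) \<Rightarrow> (nat \<Rightarrow> ennreal) \<Rightarrow> bool" (infix "\<preccurlyeq>" 50) where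
  "a \<preccurlyeq> b \<longleftrightarrow> (\<exists>c::real. c > 0 \<and> (\<forall>n\<ge>1. a n \<le> ennreal c * b n))"

definition neg_part :: "real \<Rightarrow> real" where
  "neg_part x = - min 0 x"

definition X_hat :: "(real \<Rightarrow> 'a \<Rightarrow> real) \<Rightarrow> real \<Rightarrow> nat \<Rightarrow> 'a \<Rightarrow> real" where
  "X_hat W x0 n \<omega> =
     ((W 1 \<omega> + sqrt x0) +
      neg_part ((MIN k\<in>{0..n}. W (real k / real n) \<omega>) + sqrt x0))\<^sup>2"

end

theory Submission
  imports Defs "HOL-Real_Asymp.Real_Asymp"
begin

text \<open>
  On the grid \<open>i / N\<close> the square root of \<open>X_hat\<close> is the terminal value of the Lindley recursion
  \<open>U (i + 1) = max 0 (U i + \<Delta>W i)\<close>, the discrete Skorokhod reflection of \<open>sqrt x0 + W\<close>.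

  Convergence. Both \<open>X\<close> and \<open>U\<^sup>2\<close> equal \<open>x0 + t\<close> plus a sum of \<open>2 * sqrt X * \<Delta>W\<close>, respectively
  \<open>2 * U * \<Delta>W\<close>, up to errors that vanish in probability. The difference is a martingale
  transform with integrand \<open>2 * (sqrt X - U)\<close>, whose square is at most \<open>4 * \<bar>X - U\<^sup>2\<bar>\<close>; a discrete version of
  the Yamada--Watanabe argument, using only expectations of a test function, shows that it vanishes in
  the limit. Hence \<open>X_hat N\<close> converges to \<open>X 1\<close> in probability.

  Rate. It remains to compare \<open>X_hat n\<close> with \<open>X_hat (n * l)\<close> uniformly in large \<open>l\<close>, that is, to bound
  the gap between the minima over the coarse and the fine grid. On the event that the fine minimum
  is attained in the \<open>k\<close>-th coarse interval, the walks before and after that interval stay above a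
  level within the local oscillation \<open>O (n\<^sup>-\<^sup>1\<^sup>/\<^sup>2)\<close>; by the reflection principle this costs
  \<open>1 / sqrt (k + 1)\<close> and \<open>1 / sqrt (n - k)\<close>, and the sum over \<open>k\<close> of the products is bounded.
\<close>

section \<open>Centered normal random variables\<close>

text \<open>Two obstacles shape the proof. The square root is not Lipschitz at 0, so a Gronwall
  argument for X - U^2 fails; a test function with second derivative of order 1/|x| absorbs the
  bound (sqrt X - U)^2 <= |X - U^2|. The integral in the equation for X is only a limit in
  probability, and no moment of X 1 is established beforehand. So the equation is used up to an
  error at one grid point at a time, without a supremum over time, and second moments are taken only
  of transforms with truncated coefficients.

  Convergence in probability carries no rate. Moments are therefore bounded for pairs of grids, with
  a constant that does not depend on the finer one, and reach X 1 by truncation and monotone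
  convergence.

  For the rate, exponential moments of the gap scaled by sqrt n serve every p at once, and an
  exponential of a sum factorises over independent blocks. The reflection principle is needed as a
  lower bound for the maximum, and there a discrete walk pays for overshooting its level; refining
  by a factor l >= n^2 makes this price smaller than the main term.\<close>

abbreviation (in prob_space) centered_normal :: "real \<Rightarrow> ('a \<Rightarrow> real) \<Rightarrow> bool" where
  "centered_normal s Z \<equiv> distributed M lborel Z (\<lambda>x. ennreal (normal_density 0 s x))"

lemma (in prob_space) centered_normal_measurable:
  "centered_normal s Z \<Longrightarrow> random_variable borel Z"
  by (auto dest: distributed_measurable)

lemma (in prob_space) centered_normal_uminus:
  assumes "s > 0" "centered_normal s Z"
  shows "centered_normal s (\<lambda>w. - Z w)"
  using normal_density_affine[OF assms(2,1), of "-1" 0] by simp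

lemma (in prob_space) centered_normal_moment_even:
  assumes "s > 0" "centered_normal s Z"
  shows "integrable M (\<lambda>w. Z w ^ (2 * k))"
    and "expectation (\<lambda>w. Z w ^ (2 * k)) = fact (2 * k) / ((2 / s\<^sup>2)^k * fact k)"
proof -
  note D = assms(2)
  show "integrable M (\<lambda>w. Z w ^ (2 * k))"
    using integrable_normal_moment[OF assms(1), of 0 "2*k"] distributed_integrable[OF D, of "\<lambda>x. x ^ (2*k)"]
    by simp
  show "expectation (\<lambda>w. Z w ^ (2 * k)) = fact (2 * k) / ((2 / s\<^sup>2)^k * fact k)"
    using integral_normal_moment_even[OF assms(1), of 0 "k"] distributed_integral[OF D, of "\<lambda>x. x ^ (2*k)"]
    by simp
qed

lemma (in prob_space) centered_normal_moments:
  assumes "s > 0" "centered_normal s Z"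
  shows "integrable M Z" "expectation Z = 0"
    and "integrable M (\<lambda>w. (Z w)\<^sup>2)" "expectation (\<lambda>w. (Z w)\<^sup>2) = s\<^sup>2"
    and "integrable M (\<lambda>w. Z w ^ 4)" "expectation (\<lambda>w. Z w ^ 4) = 3 * s ^ 4"
proof -
  note D = assms(2)
  show "integrable M Z"
    using integrable_normal_moment_nz_1[OF assms(1), of 0] distributed_integrable[OF D, of "\<lambda>x. x"] by simp
  show "expectation Z = 0"
    using normal_distributed_expectation[OF assms] .
  show "integrable M (\<lambda>w. (Z w)\<^sup>2)" "expectation (\<lambda>w. (Z w)\<^sup>2) = s\<^sup>2"
    using centered_normal_moment_even[OF assms, of 1] by simp_all
  show "integrable M (\<lambda>w. Z w ^ 4)" "expectation (\<lambda>w. Z w ^ 4) = 3 * s ^ 4"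
    using centered_normal_moment_even[OF assms, of 2] assms(1)
    by (simp_all add: fact_numeral power_divide field_simps flip: power_mult)
qed

lemma (in prob_space) centered_normal_symmetric:
  assumes "s > 0" "centered_normal s Z"
  shows "\<P>(w in M. Z w > y) = \<P>(w in M. Z w < - y)"
proof -
  have [measurable]: "random_variable borel Z"
    using assms(2) by (rule centered_normal_measurable)
  have eq: "distr M lborel Z = distr M lborel (\<lambda>w. - Z w)"
    using assms(2) centered_normal_uminus[OF assms] unfolding distributed_def by auto
  have "\<P>(w in M. Z w > y) = measure (distr M lborel Z) {y<..}"
    by (subst measure_distr) (auto intro!: arg_cong[where f=prob])
  also have "\<dots> = \<P>(w in M. Z w < - y)"
    unfolding eq by (subst measure_distr) (auto intro!: arg_cong[where f=prob])
  finally show ?thesis .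
qed

lemma (in prob_space) centered_normal_nonneg_prob:
  assumes "s > 0" "centered_normal s Z"
  shows "\<P>(w in M. Z w > 0) \<le> 1/2" "\<P>(w in M. Z w \<ge> 0) \<ge> 1/2"
proof -
  have [measurable]: "random_variable borel Z"
    using assms(2) by (rule centered_normal_measurable)
  note sym = centered_normal_symmetric[OF assms, of 0, simplified]
  have "\<P>(w in M. Z w > 0) + \<P>(w in M. Z w < 0)
      = prob ({w\<in>space M. Z w > 0} \<union> {w\<in>space M. Z w < 0})"
    by (rule finite_measure_Union[symmetric]) auto
  also have "\<dots> \<le> 1" by (rule prob_le_1)
  finally show *: "\<P>(w in M. Z w > 0) \<le> 1/2" using sym by linarith
  have "\<P>(w in M. Z w \<ge> 0) = prob (space M - {w\<in>space M. Z w < 0})"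
    by (rule arg_cong[where f=prob]) auto
  also have "\<dots> = 1 - \<P>(w in M. Z w < 0)"
    by (rule prob_compl) measurable
  finally show "\<P>(w in M. Z w \<ge> 0) \<ge> 1/2" using * sym by linarith
qed

text \<open>The density is at most 1/(2s) because 2 pi >= 4, and the ball has length 2y.\<close>

lemma (in prob_space) centered_normal_small_ball:
  assumes "s > 0" "centered_normal s Z" "y \<ge> 0"
  shows "\<P>(w in M. \<bar>Z w\<bar> \<le> y) \<le> y / s"
proof -
  have m[measurable]: "random_variable borel Z"
    using assms(2) by (rule centered_normal_measurable)
  have le: "normal_density 0 s x \<le> 1 / (2 * s)" for x
  proof -
    have "sqrt (2 * pi * s\<^sup>2) \<ge> sqrt (2\<^sup>2 * s\<^sup>2)"
      using pi_gt3 by (intro real_sqrt_le_mono mult_right_mono) auto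
    then have "sqrt (2 * pi * s\<^sup>2) \<ge> 2 * s"
      using assms(1) by (simp add: real_sqrt_mult)
    then have "1 / sqrt (2 * pi * s\<^sup>2) \<le> 1 / (2 * s)"
      using assms(1) by (intro divide_left_mono) auto
    moreover have "exp (- (x - 0)\<^sup>2 / (2 * s\<^sup>2)) \<le> 1" by simp
    ultimately have "1 / sqrt (2 * pi * s\<^sup>2) * exp (- (x - 0)\<^sup>2 / (2 * s\<^sup>2)) \<le> 1 / (2 * s) * 1"
      using assms(1) by (intro mult_mono) auto
    then show ?thesis
      by (simp add: normal_density_def)
  qed
  have "emeasure M (Z -` {-y..y} \<inter> space M) = (\<integral>\<^sup>+x. ennreal (normal_density 0 s x) * indicator {-y..y} x \<partial>lborel)"
    using distributed_emeasure[OF assms(2), of "{-y..y}"] by simp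
  also have "\<dots> \<le> (\<integral>\<^sup>+x. ennreal (1 / (2 * s)) * indicator {-y..y} x \<partial>lborel)"
    by (intro nn_integral_mono mult_right_mono ennreal_leI le) auto
  also have "\<dots> = ennreal (y / s)"
    using assms by (simp add: nn_integral_cmult_indicator flip: ennreal_mult')
  finally have "prob (Z -` {-y..y} \<inter> space M) \<le> y / s"
    using assms(1,3) by (simp add: emeasure_eq_measure)
  also have "Z -` {-y..y} \<inter> space M = {w\<in>space M. \<bar>Z w\<bar> \<le> y}" by auto
  finally show ?thesis .
qed

text \<open>The fourth moment is chosen for union bounds: N steps of variance 1/N cost N * 3/N^2 =
  3/N at a fixed level, which vanishes, whereas second moments would leave a constant.\<close>

lemma (in prob_space) centered_normal_fourth_tail:
  assumes "s > 0" "centered_normal s Z" "y > 0"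
  shows "\<P>(w in M. Z w > y) \<le> 3 * s ^ 4 / y ^ 4"
proof -
  have m[measurable]: "random_variable borel Z"
    using assms(2) by (rule centered_normal_measurable)
  have "\<P>(w in M. Z w > y) \<le> \<P>(w in M. y ^ 4 \<le> Z w ^ 4)"
    using assms(3) by (intro finite_measure_mono) (auto intro!: power_mono)
  also have "\<dots> \<le> expectation (\<lambda>w. Z w ^ 4) / y ^ 4"
    using integral_Markov_inequality_measure[OF centered_normal_moments(5)[OF assms(1,2)], of "{}" "y^4"] assms(3)
    by simp
  finally show ?thesis
    by (simp add: centered_normal_moments[OF assms(1,2)])
qed

text \<open>Chernoff bound. Tilting the density by exp(c x / s) shifts its mean to c * s and
  produces the factor exp(c^2 / 2). The parameter c stays free so that the decay can later beat a
  given exponential weight.\<close>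

lemma (in prob_space) centered_normal_exp_tail:
  assumes "s > 0" "centered_normal s Z" "c \<ge> 0"
  shows "\<P>(w in M. Z w > y) \<le> exp (c\<^sup>2 / 2 - c * y / s)"
proof -
  have m[measurable]: "random_variable borel Z"
    using assms(2) by (rule centered_normal_measurable)
  have dens: "normal_density 0 s x * exp (c * x / s) = exp (c\<^sup>2 / 2) * normal_density (c * s) s x" for x
  proof -
    have "- (x\<^sup>2 / (2 * s\<^sup>2)) + c * x / s = c\<^sup>2 / 2 + - ((x - c * s)\<^sup>2 / (2 * s\<^sup>2))"
      using assms(1) by (simp add: power2_eq_square field_simps)
    then show ?thesis
      by (simp add: normal_density_def flip: exp_add)
  qed
  have "(\<integral>\<^sup>+w. ennreal (exp (c * Z w / s)) \<partial>M) = (\<integral>\<^sup>+x. ennreal (normal_density 0 s x) * ennreal (exp (c * x / s)) \<partial>lborel)"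
    using distributed_nn_integral[OF assms(2), of "\<lambda>x. ennreal (exp (c * x / s))"] by simp
  also have "\<dots> = (\<integral>\<^sup>+x. ennreal (exp (c\<^sup>2 / 2)) * ennreal (normal_density (c * s) s x) \<partial>lborel)"
    by (simp add: dens flip: ennreal_mult')
  also have "\<dots> = ennreal (exp (c\<^sup>2 / 2)) * 1"
    using assms(1) by (subst nn_integral_cmult) (auto simp: nn_integral_eq_integral)
  finally have E: "(\<integral>\<^sup>+w. ennreal (exp (c * Z w / s)) \<partial>M) = ennreal (exp (c\<^sup>2 / 2))" by simp
  have "indicator {w\<in>space M. Z w > y} w \<le> ennreal (exp (- (c * y / s))) * ennreal (exp (c * Z w / s))" for w
    using assms(1,3) by (auto simp: indicator_def field_simps mult_left_mono simp flip: ennreal_mult' exp_add)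
  then have "(\<integral>\<^sup>+w. indicator {w\<in>space M. Z w > y} w \<partial>M) \<le> (\<integral>\<^sup>+w. ennreal (exp (- (c * y / s))) * ennreal (exp (c * Z w / s)) \<partial>M)"
    by (intro nn_integral_mono) auto
  also have "\<dots> = ennreal (exp (- (c * y / s))) * ennreal (exp (c\<^sup>2 / 2))"
    by (subst nn_integral_cmult) (auto simp: E)
  finally have "\<P>(w in M. Z w > y) \<le> exp (- (c * y / s)) * exp (c\<^sup>2 / 2)"
    by (simp add: emeasure_eq_measure flip: ennreal_mult')
  then show ?thesis by (simp flip: exp_add)
qed

section \<open>Maxima of Gaussian random walks\<close>

locale gaussian_walk = prob_space +
  fixes \<xi> :: "nat \<Rightarrow> 'a \<Rightarrow> real" and N :: nat and s :: real
  assumes indep: "indep_vars (\<lambda>_. borel) \<xi> {..<N}"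
    and normal: "\<And>j. j < N \<Longrightarrow> centered_normal s (\<xi> j)"
    and s_pos: "s > 0"
begin

definition S :: "nat \<Rightarrow> 'a \<Rightarrow> real" where
  "S k w = (\<Sum>j<k. \<xi> j w)"

lemma S_diff: "b \<le> c \<Longrightarrow> S c w - S b w = (\<Sum>i=b..<c. \<xi> i w)"
  by (simp add: S_def lessThan_atLeast0 sum_diff_nat_ivl)

lemma measurable_xi[measurable (raw)]: "j < N \<Longrightarrow> random_variable borel (\<xi> j)"
  using normal by (rule centered_normal_measurable)

lemma measurable_S[measurable (raw)]: "k \<le> N \<Longrightarrow> random_variable borel (S k)"
  unfolding S_def by measurable

lemma sum_normal:
  assumes "I \<subseteq> {..<N}" "I \<noteq> {}"
  shows "centered_normal (s * sqrt (card I)) (\<lambda>w. \<Sum>j\<in>I. \<xi> j w)"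
proof -
  have "finite I" using assms finite_subset by blast
  have "centered_normal (sqrt (\<Sum>j\<in>I. s\<^sup>2)) (\<lambda>w. \<Sum>j\<in>I. \<xi> j w)"
    using sum_indep_normal[OF \<open>finite I\<close> assms(2) indep_vars_subset[OF indep assms(1)], of "\<lambda>_. s" "\<lambda>_. 0"]
      assms(1) normal s_pos by auto
  then show ?thesis
    using s_pos by (simp add: real_sqrt_mult mult.commute)
qed

section \<open>First passage and the two halves of the reflection principle\<close>

definition first_passage :: "real \<Rightarrow> nat \<Rightarrow> 'a set" where
  "first_passage y j = {w\<in>space M. S j w > y \<and> (\<forall>i<j. S i w \<le> y)}"

lemma first_passage_sets[measurable (raw)]:
  assumes "j \<le> N"
  shows "first_passage y j \<in> events"
proof -
  have "first_passage y j = {w\<in>space M. S j w > y} \<inter> (space M - (\<Union>i<j. {w\<in>space M. S i w > y}))"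
    by (auto simp: first_passage_def not_less)
  also have "\<dots> \<in> events"
    using assms by (intro sets.Int sets.Diff sets.finite_UN) auto
  finally show ?thesis .
qed

lemma disjoint_first_passage: "disjoint_family_on (first_passage y) {..N}"
  by (force simp: disjoint_family_on_def first_passage_def elim: linorder_neqE_nat)

lemma Union_first_passage: "(\<Union>j\<le>N. first_passage y j) = {w\<in>space M. \<exists>k\<le>N. S k w > y}"
proof (intro equalityI subsetI)
  fix w assume "w \<in> {w\<in>space M. \<exists>k\<le>N. S k w > y}"
  then obtain k where k: "w \<in> space M" "k \<le> N" "S k w > y" by auto
  define j where "j = (LEAST j. S j w > y)"
  have "S j w > y" unfolding j_def by (rule LeastI[of _ k]) (rule k)
  moreover have "j \<le> k" unfolding j_def by (rule Least_le) (rule k)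
  moreover have "S i w \<le> y" if "i < j" for i
    using not_less_Least[of i "\<lambda>j. S j w > y"] that unfolding j_def by auto
  ultimately show "w \<in> (\<Union>j\<le>N. first_passage y j)"
    using k by (auto simp: first_passage_def)
qed (auto simp: first_passage_def)

text \<open>Passage at \<open>j\<close> reads only the steps below \<open>j\<close>, the later
  increment only those from \<open>j\<close> on.\<close>

lemma prob_first_passage_indep:
  assumes "j \<le> N" "A \<in> sets borel"
  shows "prob {w\<in>first_passage y j. S N w - S j w \<in> A}
    = prob (first_passage y j) * \<P>(w in M. S N w - S j w \<in> A)"
proof -
  define g where "g f = (\<Sum>i<j. f i) " for f :: "nat \<Rightarrow> real"
  have "indep_var (PiM {..<j} (\<lambda>_. borel)) (\<lambda>w. restrict (\<lambda>i. \<xi> i w) {..<j})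
      (PiM {j..<N} (\<lambda>_. borel)) (\<lambda>w. restrict (\<lambda>i. \<xi> i w) {j..<N})"
    using assms(1) by (intro indep_var_restrict[OF indep]) auto
  from indep_varD[OF this, of "{f\<in>space (PiM {..<j} (\<lambda>_. borel)). (\<Sum>i<j. f i) > y \<and> (\<forall>k<j. (\<Sum>i<k. f i) \<le> y)}"
     "{f\<in>space (PiM {j..<N} (\<lambda>_. borel)). (\<Sum>i=j..<N. f i) \<in> A}"]
  have "prob ((\<lambda>x. (\<lambda>i\<in>{..<j}. \<xi> i x, \<lambda>i\<in>{j..<N}. \<xi> i x)) -`
     ({f \<in> space (Pi\<^sub>M {..<j} (\<lambda>_. borel)). y < sum f {..<j} \<and> (\<forall>k<j. sum f {..<k} \<le> y)} \<times>
      {f \<in> space (Pi\<^sub>M {j..<N} (\<lambda>_. borel)). sum f {j..<N} \<in> A}) \<inter> space M) =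
    prob ((\<lambda>x. \<lambda>i\<in>{..<j}. \<xi> i x) -`
     {f \<in> space (Pi\<^sub>M {..<j} (\<lambda>_. borel)). y < sum f {..<j} \<and> (\<forall>k<j. sum f {..<k} \<le> y)} \<inter> space M) *
    prob ((\<lambda>x. \<lambda>i\<in>{j..<N}. \<xi> i x) -` {f \<in> space (Pi\<^sub>M {j..<N} (\<lambda>_. borel)). sum f {j..<N} \<in> A} \<inter> space M)"
    using assms(2) by (auto simp: space_PiM)
  moreover have "(\<lambda>x. \<lambda>i\<in>{..<j}. \<xi> i x) -`
     {f \<in> space (Pi\<^sub>M {..<j} (\<lambda>_. borel)). y < sum f {..<j} \<and> (\<forall>k<j. sum f {..<k} \<le> y)} \<inter> space M = first_passage y j"
    by (auto simp: first_passage_def S_def space_PiM)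
  moreover note eq = S_diff[OF assms(1)]
  moreover have "(\<lambda>x. \<lambda>i\<in>{j..<N}. \<xi> i x) -` {f \<in> space (Pi\<^sub>M {j..<N} (\<lambda>_. borel)). sum f {j..<N} \<in> A} \<inter> space M
      = {w\<in>space M. S N w - S j w \<in> A}"
    unfolding eq by (auto simp: space_PiM)
  moreover have "(\<lambda>x. (\<lambda>i\<in>{..<j}. \<xi> i x, \<lambda>i\<in>{j..<N}. \<xi> i x)) -`
     ({f \<in> space (Pi\<^sub>M {..<j} (\<lambda>_. borel)). y < sum f {..<j} \<and> (\<forall>k<j. sum f {..<k} \<le> y)} \<times>
      {f \<in> space (Pi\<^sub>M {j..<N} (\<lambda>_. borel)). sum f {j..<N} \<in> A}) \<inter> space M = {w\<in>first_passage y j. S N w - S j w \<in> A}"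
    unfolding eq by (auto simp: first_passage_def S_def space_PiM)
  ultimately show ?thesis by simp
qed

text \<open>The strict and the weak version both cover \<open>j = N\<close>, where the increment is
  identically 0; a passage at the last step can thus be summed together with the others.\<close>

lemma prob_increment_half:
  assumes "j \<le> N"
  shows "\<P>(w in M. S N w - S j w \<in> {0<..}) \<le> 1/2"
    and "\<P>(w in M. S N w - S j w \<in> {0..}) \<ge> 1/2"
proof -
  note eq = S_diff[OF assms]
  have "\<P>(w in M. S N w - S j w \<in> {0<..}) \<le> 1/2 \<and>
    \<P>(w in M. S N w - S j w \<in> {0..}) \<ge> 1/2"
  proof (cases "j = N")
    case True
    then show ?thesis by (simp add: prob_space)
  next
    case False
    with assms have "{j..<N} \<subseteq> {..<N}" "{j..<N} \<noteq> {}" "card {j..<N} > 0" by auto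
    from sum_normal[OF this(1,2)] this(3)
    have "centered_normal (s * sqrt (card {j..<N})) (\<lambda>w. \<Sum>i=j..<N. \<xi> i w)" "card {j..<N} > 0" .
    from centered_normal_nonneg_prob[OF _ this(1)] this(2) s_pos show ?thesis
      unfolding eq by simp
  qed
  then show "\<P>(w in M. S N w - S j w \<in> {0<..}) \<le> 1/2"
    and "\<P>(w in M. S N w - S j w \<in> {0..}) \<ge> 1/2" by auto
qed

lemma Union_passage_increment_sets:
  assumes "A \<in> sets borel" "j \<le> N"
  shows "{w\<in>first_passage y j. S N w - S j w \<in> A} \<in> events"
proof -
  have "{w\<in>first_passage y j. S N w - S j w \<in> A} = first_passage y j \<inter> {w\<in>space M. S N w - S j w \<in> A}"
    by (auto simp: first_passage_def)
  also have "\<dots> \<in> events" using assms by measurable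
  finally show ?thesis .
qed

lemma prob_passage:
  assumes "A \<in> sets borel"
  shows "prob (\<Union>j\<le>N. {w\<in>first_passage y j. S N w - S j w \<in> A})
    = (\<Sum>j\<le>N. prob (first_passage y j) * \<P>(w in M. S N w - S j w \<in> A))"
  using assms disjoint_first_passage[of y]
  by (subst finite_measure_finite_Union)
     (fastforce simp: disjoint_family_on_def prob_first_passage_indep intro: Union_passage_increment_sets)+

lemma prob_max_eq_sum:
  "\<P>(w in M. \<exists>k\<le>N. S k w > y) = (\<Sum>j\<le>N. prob (first_passage y j))"
  using disjoint_first_passage[of y] unfolding Union_first_passage[symmetric]
  by (subst finite_measure_finite_Union) auto

text \<open>Upper half: after the first passage the remaining increment is nonnegative with
  probability at least 1/2, and then the end point still exceeds \<open>y\<close>. An overshoot only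
  helps here.\<close>

lemma prob_max_le:
  "\<P>(w in M. \<exists>k\<le>N. S k w > y) \<le> 2 * \<P>(w in M. S N w > y)"
proof -
  have "1/2 * \<P>(w in M. \<exists>k\<le>N. S k w > y) \<le> prob (\<Union>j\<le>N. {w\<in>first_passage y j. S N w - S j w \<in> {0..}})"
    unfolding prob_max_eq_sum sum_distrib_left
    by (subst prob_passage, simp, intro sum_mono, subst mult.commute, intro mult_left_mono prob_increment_half(2)) auto
  also have "\<dots> \<le> \<P>(w in M. S N w > y)"
    by (intro finite_measure_mono) (auto simp: first_passage_def)
  finally show ?thesis by simp
qed

text \<open>Lower half. If no step exceeds \<open>\<eta>\<close>, the walk is at most
  \<open>y + \<eta>\<close> at its first passage, so an end point above \<open>y + \<eta>\<close>
  needs a strictly positive later increment, which has probability at most 1/2. This bounds the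
  passage probability from below by twice a Gaussian tail. By symmetry the remaining mass is that of
  a ball of radius \<open>y + \<eta>\<close>; the term with \<open>\<eta> ^ 4\<close> pays for large
  steps.\<close>

lemma prob_max_le_small:
  assumes "y \<ge> 0" "\<eta> > 0" "N > 0"
  shows "\<P>(w in M. \<forall>k\<le>N. S k w \<le> y) \<le> (y + \<eta>) / (s * sqrt N) + 6 * real N * s ^ 4 / \<eta> ^ 4"
proof -
  let ?J = "\<Union>j<N. {w\<in>space M. \<xi> j w > \<eta>}"
  let ?P = "\<Union>j\<le>N. {w\<in>first_passage y j. S N w - S j w \<in> {0<..}}"
  have SN: "centered_normal (s * sqrt N) (S N)"
    using sum_normal[of "{..<N}"] assms(3) by (auto simp: S_def[abs_def])
  have sN: "s * sqrt N > 0" using s_pos assms(3) by simp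
  have J: "prob ?J \<le> N * (3 * s ^ 4 / \<eta> ^ 4)"
  proof -
    have "prob ?J \<le> (\<Sum>j<N. \<P>(w in M. \<xi> j w > \<eta>))"
      by (rule finite_measure_subadditive_finite) auto
    also have "\<dots> \<le> (\<Sum>j<N. 3 * s ^ 4 / \<eta> ^ 4)"
      by (intro sum_mono centered_normal_fourth_tail s_pos normal assms) auto
    finally show ?thesis by simp
  qed
  have "{w\<in>space M. S N w > y + \<eta>} \<subseteq> ?J \<union> ?P"
  proof
    fix w assume *: "w \<in> {w\<in>space M. S N w > y + \<eta>}"
    show "w \<in> ?J \<union> ?P"
    proof (cases "w \<in> ?J")
      case False
      from * assms(2) have "w \<in> {w\<in>space M. \<exists>k\<le>N. S k w > y}" by auto
      then obtain j where j: "j \<le> N" "w \<in> first_passage y j"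
        unfolding Union_first_passage[symmetric] by auto
      \<comment> \<open>Since \<open>S 0 = 0\<close> and \<open>y \<ge> 0\<close>, the passage has a
        preceding time, at which the walk is still at most \<open>y\<close>.\<close>
      have "j \<noteq> 0" using j assms(1) by (auto simp: first_passage_def S_def intro!: gr0I)
      then obtain i where i: "j = Suc i" by (cases j) auto
      have "S j w = S i w + \<xi> i w" by (simp add: i S_def)
      moreover have "S i w \<le> y" using j i by (auto simp: first_passage_def)
      moreover have "\<xi> i w \<le> \<eta>" using False * j i by (auto simp: not_less)
      ultimately have "S N w > S j w" using * by auto
      with j show ?thesis by auto
    qed simp
  qed
  then have "\<P>(w in M. S N w > y + \<eta>) \<le> prob (?J \<union> ?P)"
    using Union_passage_increment_sets[of "{0<..}"] by (intro finite_measure_mono sets.Un sets.finite_UN) auto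
  also have "\<dots> \<le> prob ?J + prob ?P"
    using Union_passage_increment_sets[of "{0<..}"] by (intro measure_Un_le sets.finite_UN) auto
  also have "prob ?P \<le> 1/2 * \<P>(w in M. \<exists>k\<le>N. S k w > y)"
    unfolding prob_max_eq_sum sum_distrib_left
    by (subst prob_passage, simp, intro sum_mono, subst mult.commute[of "1/2"], intro mult_left_mono prob_increment_half(1)) auto
  finally have *: "\<P>(w in M. S N w > y + \<eta>) \<le> prob ?J + 1/2 * \<P>(w in M. \<exists>k\<le>N. S k w > y)" by simp
  have lower: "\<P>(w in M. \<exists>k\<le>N. S k w > y) \<ge> 2 * \<P>(w in M. S N w > y + \<eta>) - 6 * real N * s ^ 4 / \<eta> ^ 4"
  proof -
    have "6 * real N * s ^ 4 / \<eta> ^ 4 = 2 * (N * (3 * s ^ 4 / \<eta> ^ 4))" by simp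
    moreover have "prob ?J \<le> N * (3 * s ^ 4 / \<eta> ^ 4)" by (rule J)
    ultimately show ?thesis
      using * by argo
  qed
  have "\<P>(w in M. S N w < - (y + \<eta>)) = \<P>(w in M. S N w > y + \<eta>)"
    by (rule centered_normal_symmetric[OF sN SN, symmetric])
  moreover have "1 = prob ({w\<in>space M. S N w < - (y + \<eta>)} \<union> ({w\<in>space M. S N w > y + \<eta>} \<union> {w\<in>space M. \<bar>S N w\<bar> \<le> y + \<eta>}))"
    by (subst prob_space[symmetric], rule arg_cong[where f=prob]) auto
  moreover have "\<dots> \<le> \<P>(w in M. S N w < - (y + \<eta>)) + (\<P>(w in M. S N w > y + \<eta>) + \<P>(w in M. \<bar>S N w\<bar> \<le> y + \<eta>))"
    by (rule order_trans[OF measure_Un_le]) (auto intro!: measure_Un_le)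
  moreover have "\<P>(w in M. \<bar>S N w\<bar> \<le> y + \<eta>) \<le> (y + \<eta>) / (s * sqrt N)"
    using assms by (intro centered_normal_small_ball[OF sN SN]) auto
  moreover have "\<P>(w in M. \<forall>k\<le>N. S k w \<le> y) = prob (space M - {w\<in>space M. \<exists>k\<le>N. S k w > y})"
    by (rule arg_cong[where f=prob]) (auto simp: not_less not_le)
  moreover have "\<dots> = 1 - \<P>(w in M. \<exists>k\<le>N. S k w > y)"
    by (rule prob_compl) measurable
  ultimately show ?thesis using lower by linarith
qed

end

section \<open>Brownian motion on a grid\<close>

locale bm = usual_filtered_prob_space M F
  for M :: "'a measure" and F :: "real \<Rightarrow> 'a measure" +
  fixes W :: "real \<Rightarrow> 'a \<Rightarrow> real"
  assumes BM: "brownian_motion M F W"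
begin

lemma subalgebra_F: "subalgebra M (F t)"
  using space_F sets_F_subset by (auto simp: subalgebra_def)

lemma measurable_F_imp_M: "f \<in> measurable (F t) L \<Longrightarrow> f \<in> measurable M L"
  by (rule measurable_from_subalg[OF subalgebra_F])

lemma measurable_F_mono: "s \<le> t \<Longrightarrow> f \<in> measurable (F s) L \<Longrightarrow> f \<in> measurable (F t) L"
  by (rule measurable_from_subalg) (auto simp: subalgebra_def space_F sets_F_mono)

lemma W_measurable_F: "0 \<le> s \<Longrightarrow> s \<le> t \<Longrightarrow> W s \<in> borel_measurable (F t)"
  using BM by (auto simp: brownian_motion_def adapted_def intro: measurable_F_mono)

lemma W_measurable[measurable (raw)]: "0 \<le> t \<Longrightarrow> W t \<in> borel_measurable M"
  by (rule measurable_F_imp_M[OF W_measurable_F[OF _ order_refl]])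

lemma W_0: "AE w in M. W 0 w = 0"
  using BM by (auto simp: brownian_motion_def)

lemma increment_normal:
  "0 \<le> s \<Longrightarrow> s < t \<Longrightarrow> centered_normal (sqrt (t - s)) (\<lambda>w. W t w - W s w)"
  using BM by (auto simp: brownian_motion_def)

text \<open>Translates independence of sigma-algebras, as in the definition of Brownian motion, into
  independence from an arbitrary variable known at time \<open>s\<close>.\<close>

lemma increment_indep:
  assumes "0 \<le> s" "s < t" "Y \<in> measurable (F s) L"
  shows "indep_var L Y borel (\<lambda>w. W t w - W s w)"
  unfolding indep_var_eq
proof (intro conjI)
  show "random_variable L Y" using assms(3) by (rule measurable_F_imp_M)
  show rv: "random_variable borel (\<lambda>w. W t w - W s w)"
    using assms by (auto intro!: W_measurable borel_measurable_diff)
  have ind: "indep_set (sets (F s)) (sets (vimage_algebra (space M) (\<lambda>w. W t w - W s w) borel))"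
    using BM assms by (auto simp: brownian_motion_def)
  have 1: "sigma_sets (space M) {Y -` A \<inter> space M |A. A \<in> sets L} \<subseteq> sets (F s)"
    using assms(3) measurable_sets[of Y "F s" L] space_F[of s]
    by (intro sets.sigma_sets_subset[of _ "F s", unfolded space_F]) auto
  have 2: "sigma_sets (space M) {(\<lambda>w. W t w - W s w) -` A \<inter> space M |A. A \<in> sets borel}
    = sets (vimage_algebra (space M) (\<lambda>w. W t w - W s w) borel)"
    unfolding vimage_algebra_def by (subst sets_measure_of) auto
  show "indep_set (sigma_sets (space M) {Y -` A \<inter> space M |A. A \<in> sets L})
     (sigma_sets (space M) {(\<lambda>w. W t w - W s w) -` A \<inter> space M |A. A \<in> sets borel})"
    using ind 1 unfolding 2 indep_sets2_eq by blast
qed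

text \<open>This is how the martingale property enters: with \<open>g\<close> the identity the
  product has mean 0, with the square it yields the variance, with the centered square it makes the
  terms of the quadratic variation orthogonal.\<close>

lemma
  fixes Y :: "'a \<Rightarrow> real" and g :: "real \<Rightarrow> real"
  assumes "0 \<le> s" "s < t" "Y \<in> borel_measurable (F s)" "integrable M Y"
    and "g \<in> borel_measurable borel" "integrable M (\<lambda>w. g (W t w - W s w))"
  shows integrable_mult_increment: "integrable M (\<lambda>w. Y w * g (W t w - W s w))"
    and expectation_mult_increment:
      "expectation (\<lambda>w. Y w * g (W t w - W s w)) = expectation Y * expectation (\<lambda>w. g (W t w - W s w))"
proof -
  have "indep_var borel (id \<circ> Y) borel (g \<circ> (\<lambda>w. W t w - W s w))"
    using indep_var_compose[OF increment_indep[OF assms(1-3)], of id borel g borel] assms(5) by simp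
  then have ind: "indep_var borel Y borel (\<lambda>w. g (W t w - W s w))"
    by (simp add: comp_def)
  show "integrable M (\<lambda>w. Y w * g (W t w - W s w))"
    by (rule indep_var_integrable[OF ind assms(4,6)])
  show "expectation (\<lambda>w. Y w * g (W t w - W s w)) = expectation Y * expectation (\<lambda>w. g (W t w - W s w))"
    by (rule indep_var_lebesgue_integral[OF ind assms(4,6)])
qed

text \<open>Independence of each increment from the past is iterated: an intersection of events
  about the first k increments belongs to \<open>F (\<tau> k)\<close>, hence is independent of the
  next one.\<close>

lemma increments_indep_vars:
  assumes "0 \<le> \<tau> 0" "strict_mono \<tau>"
  shows "indep_vars (\<lambda>_. borel) (\<lambda>j w. W (\<tau> (Suc j)) w - W (\<tau> j) w) {..<N::nat}"
proof (cases "N = 0")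
  case False
  let ?X = "\<lambda>j w. W (\<tau> (Suc j)) w - W (\<tau> j) w"
  have nonneg: "0 \<le> \<tau> j" for j
    using assms strict_mono_leD[OF assms(2), of 0 j] by auto
  have less: "\<tau> j < \<tau> (Suc j)" for j using assms(2) by (simp add: strict_mono_def)
  have rv: "random_variable borel (?X j)" for j
    using nonneg by (intro borel_measurable_diff W_measurable)
  have prod: "prob (space M \<inter> (\<Inter>j<k. ?X j -` A j \<inter> space M)) = (\<Prod>j<k. prob (?X j -` A j \<inter> space M))
      \<and> space M \<inter> (\<Inter>j<k. ?X j -` A j \<inter> space M) \<in> sets (F (\<tau> k))"
    if A: "\<And>j. A j \<in> sets borel" for A :: "nat \<Rightarrow> real set" and k
  proof (induction k)
    case 0
    then show ?case using sets.top[of "F (\<tau> 0)"] by (simp add: prob_space space_F)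
  next
    case (Suc k)
    let ?B = "space M \<inter> (\<Inter>j<k. ?X j -` A j \<inter> space M)"
    have eq: "space M \<inter> (\<Inter>j<Suc k. ?X j -` A j \<inter> space M) = ?B \<inter> (?X k -` A k \<inter> space M)"
      by (auto simp: less_Suc_eq)
    have B: "?B \<in> sets (F (\<tau> k))" using Suc by simp
    have "indep_set (sets (F (\<tau> k))) (sets (vimage_algebra (space M) (?X k) borel))"
      using BM nonneg less by (auto simp: brownian_motion_def)
    then have p: "prob (?B \<inter> (?X k -` A k \<inter> space M)) = prob ?B * prob (?X k -` A k \<inter> space M)"
      using B A[of k] by (intro indep_setD) (auto intro: in_vimage_algebra)
    have "?X k \<in> borel_measurable (F (\<tau> (Suc k)))"
      using nonneg less by (intro borel_measurable_diff W_measurable_F) (auto intro: less_imp_le)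
    then have Xk: "?X k -` A k \<inter> space M \<in> sets (F (\<tau> (Suc k)))"
      using A[of k] measurable_sets[of "?X k" "F (\<tau> (Suc k))" borel] by (simp add: space_F)
    have B': "?B \<in> sets (F (\<tau> (Suc k)))" 
      by (rule subsetD[OF sets_F_mono[OF less_imp_le[OF less]] B])
    show ?case unfolding eq prod.lessThan_Suc
      by (rule conjI[OF p[unfolded Suc[THEN conjunct1]] sets.Int[OF B' Xk]])
  qed
  show ?thesis
    unfolding indep_vars_def2
  proof (intro conjI ballI rv)
    show "indep_sets (\<lambda>i. {?X i -` A \<inter> space M |A. A \<in> sets borel}) {..<N}"
    proof (subst indep_sets_finite)
      show "\<forall>A\<in>Pi {..<N} (\<lambda>i. {?X i -` A \<inter> space M |A. A \<in> sets borel}).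
        prob (\<Inter>j<N. A j) = (\<Prod>j<N. prob (A j))"
      proof
        fix A assume "A \<in> Pi {..<N} (\<lambda>i. {?X i -` A \<inter> space M |A. A \<in> sets borel})"
        then have "\<forall>j\<in>{..<N}. \<exists>B. B \<in> sets borel \<and> A j = ?X j -` B \<inter> space M"
          by (auto dest!: Pi_mem)
        then obtain B where B: "\<forall>j\<in>{..<N}. B j \<in> sets borel \<and> A j = ?X j -` B j \<inter> space M"
          unfolding bchoice_iff by auto
        \<comment> \<open>Filling up with \<open>UNIV\<close> yields a sequence of Borel sets for
          all indices, as \<open>prod\<close> requires.\<close>
        define B' where "B' j = (if j < N then B j else UNIV)" for j
        have B': "B' j \<in> sets borel" "j < N \<Longrightarrow> A j = ?X j -` B' j \<inter> space M" for j
          using B by (auto simp: B'_def)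
        have "(\<Inter>j<N. A j) = space M \<inter> (\<Inter>j<N. ?X j -` B' j \<inter> space M)"
          using B'(2) False by auto
        then show "prob (\<Inter>j<N. A j) = (\<Prod>j<N. prob (A j))"
          using prod[of B' N, OF B'(1)] B'(2) by simp
      qed
    qed (use False rv in \<open>auto intro!: measurable_sets[OF rv] exI[of _ UNIV]\<close>)
  qed
qed (simp add: indep_vars_def indep_sets_def)

lemma gaussian_walk_increments:
  assumes "0 < n"
  shows "gaussian_walk M (\<lambda>j w. W (real (Suc j) / real n) w - W (real j / real n) w) N (sqrt (1 / real n))"
proof
  show "indep_vars (\<lambda>_. borel) (\<lambda>j w. W (real (Suc j) / real n) w - W (real j / real n) w) {..<N}"
    using assms by (intro increments_indep_vars) (auto simp: strict_mono_def divide_strict_right_mono)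
  show "centered_normal (sqrt (1 / real n)) (\<lambda>w. W (real (Suc j) / real n) w - W (real j / real n) w)" for j
    using increment_normal[of "real j / real n" "real (Suc j) / real n"] assms
    by (simp add: divide_strict_right_mono diff_divide_distrib[symmetric])
  show "sqrt (1 / real n) > 0" using assms by simp
qed

end

section \<open>Integrals of simple processes\<close>

context bm
begin

text \<open>The Ito isometry on a deterministic grid. The cross term has mean 0 since
  \<open>A k * \<zeta> k\<close> is known at time \<open>\<rho> k\<close>. Measurability,
  integrability and \<open>0 \<le> \<rho> k\<close> are in the conclusion because the induction step
  uses them. Times may coincide; such a step adds 0 and is split off, as normality is available for
  positive lengths only.\<close>

lemma simple_sum_isometry:
  fixes \<rho> :: "nat \<Rightarrow> real" and \<zeta> :: "nat \<Rightarrow> 'a \<Rightarrow> real"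
  defines "A \<equiv> \<lambda>k w. \<Sum>i<k. \<zeta> i w * (W (\<rho> (Suc i)) w - W (\<rho> i) w)"
  assumes "0 \<le> \<rho> 0" and mono: "\<And>i. i < q \<Longrightarrow> \<rho> i \<le> \<rho> (Suc i)"
    and meas: "\<And>i. i < q \<Longrightarrow> \<zeta> i \<in> borel_measurable (F (\<rho> i))"
    and bnd: "\<And>i w. i < q \<Longrightarrow> w \<in> space M \<Longrightarrow> \<bar>\<zeta> i w\<bar> \<le> B"
    and "k \<le> q"
  shows "A k \<in> borel_measurable (F (\<rho> k)) \<and> integrable M (\<lambda>w. (A k w)\<^sup>2) \<and>
    expectation (\<lambda>w. (A k w)\<^sup>2) = (\<Sum>i<k. expectation (\<lambda>w. (\<zeta> i w)\<^sup>2) * (\<rho> (Suc i) - \<rho> i)) \<and> 0 \<le> \<rho> k"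
  using \<open>k \<le> q\<close>
proof (induction k)
  case 0
  then show ?case using assms(2) by (simp add: A_def)
next
  case (Suc k)
  then have k: "k < q" by simp
  have Am: "A k \<in> borel_measurable (F (\<rho> k))" and Ai: "integrable M (\<lambda>w. (A k w)\<^sup>2)"
    and E: "expectation (\<lambda>w. (A k w)\<^sup>2) = (\<Sum>i<k. expectation (\<lambda>w. (\<zeta> i w)\<^sup>2) * (\<rho> (Suc i) - \<rho> i))"
    and r0: "0 \<le> \<rho> k" using Suc by auto
  note z = meas[OF k]
  have AM[measurable]: "A k \<in> borel_measurable M" and zM[measurable]: "\<zeta> k \<in> borel_measurable M"
    using Am z measurable_F_imp_M by auto
  define D where "D = (\<lambda>w. W (\<rho> (Suc k)) w - W (\<rho> k) w)"
  have AS: "A (Suc k) w = A k w + \<zeta> k w * D w" for w by (simp add: A_def D_def)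
  have Dm: "D \<in> borel_measurable (F (\<rho> (Suc k)))"
    unfolding D_def using mono[OF k] r0 by (intro borel_measurable_diff W_measurable_F) auto
  have m1: "A (Suc k) \<in> borel_measurable (F (\<rho> (Suc k)))"
    unfolding AS[abs_def] using Dm measurable_F_mono[OF mono[OF k] Am] measurable_F_mono[OF mono[OF k] z]
    by (intro borel_measurable_add borel_measurable_times)
  have zb: "\<bar>\<zeta> k w\<bar> \<le> \<bar>B\<bar>" if "w \<in> space M" for w
    using bnd[OF k that] by simp
  have zi: "integrable M (\<lambda>w. (\<zeta> k w)\<^sup>2)"
    by (rule integrable_const_bound[of _ "B\<^sup>2"]) (use zb in \<open>auto simp: abs_le_square_iff[symmetric]\<close>)
  have Ai1: "integrable M (A k)"
    using square_integrable_imp_integrable[OF AM Ai] .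
  have Az: "integrable M (\<lambda>w. A k w * \<zeta> k w)"
    by (rule Bochner_Integration.integrable_bound[where f="\<lambda>w. B * A k w"])
       (use Ai1 zb in \<open>auto simp: abs_mult mult.commute[of "\<bar>B\<bar>"] intro!: AE_I2 mult_left_mono\<close>)
  show ?case
  proof (cases "\<rho> k = \<rho> (Suc k)")
    case True
    then have "A (Suc k) = A k" by (auto simp: A_def)
    then show ?thesis using m1 Ai E r0 True by simp
  next
    case False
    with mono[OF k] have lt: "\<rho> k < \<rho> (Suc k)" by simp
    have sq: "sqrt (\<rho> (Suc k) - \<rho> k) > 0" using lt by simp
    have "centered_normal (sqrt (\<rho> (Suc k) - \<rho> k)) D"
      unfolding D_def by (rule increment_normal[OF r0 lt])
    note mom = centered_normal_moments[OF sq this]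
    have Dsq: "integrable M (\<lambda>w. (D w)\<^sup>2)" "expectation (\<lambda>w. (D w)\<^sup>2) = \<rho> (Suc k) - \<rho> k"
      using mom lt by simp_all
    have Azm: "(\<lambda>w. A k w * \<zeta> k w) \<in> borel_measurable (F (\<rho> k))" "(\<lambda>w. (\<zeta> k w)\<^sup>2) \<in> borel_measurable (F (\<rho> k))"
      using Am z by (auto intro: borel_measurable_times borel_measurable_power)
    have i1: "integrable M (\<lambda>w. (A k w * \<zeta> k w) * D w)"
      unfolding D_def
      by (rule integrable_mult_increment[OF r0 lt Azm(1) Az, of "\<lambda>x. x"]) (simp, rule mom(1)[unfolded D_def])
    have "expectation (\<lambda>w. (A k w * \<zeta> k w) * D w) = expectation (\<lambda>w. A k w * \<zeta> k w) * expectation D"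
      unfolding D_def
      by (rule expectation_mult_increment[OF r0 lt Azm(1) Az, of "\<lambda>x. x"]) (simp, rule mom(1)[unfolded D_def])
    then have e1: "expectation (\<lambda>w. (A k w * \<zeta> k w) * D w) = 0" using mom(2) by simp
    have i2: "integrable M (\<lambda>w. (\<zeta> k w)\<^sup>2 * (D w)\<^sup>2)"
      unfolding D_def
      by (rule integrable_mult_increment[OF r0 lt Azm(2) zi, of "\<lambda>x. x\<^sup>2"]) (simp, rule Dsq(1)[unfolded D_def])
    have "expectation (\<lambda>w. (\<zeta> k w)\<^sup>2 * (D w)\<^sup>2) = expectation (\<lambda>w. (\<zeta> k w)\<^sup>2) * expectation (\<lambda>w. (D w)\<^sup>2)"
      unfolding D_def
      by (rule expectation_mult_increment[OF r0 lt Azm(2) zi, of "\<lambda>x. x\<^sup>2"]) (simp, rule Dsq(1)[unfolded D_def])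
    then have e2: "expectation (\<lambda>w. (\<zeta> k w)\<^sup>2 * (D w)\<^sup>2) = expectation (\<lambda>w. (\<zeta> k w)\<^sup>2) * (\<rho> (Suc k) - \<rho> k)"
      using Dsq(2) by simp
    have expand: "(A (Suc k) w)\<^sup>2 = (A k w)\<^sup>2 + 2 * ((A k w * \<zeta> k w) * D w) + (\<zeta> k w)\<^sup>2 * (D w)\<^sup>2" for w
      unfolding AS by (simp add: power2_eq_square algebra_simps)
    show ?thesis
      unfolding expand using m1 Ai i1 i2 e1 e2 E r0 lt by simp
  qed
qed

text \<open>The coefficients are set to zero from the first time on at which the bracket exceeds \<open>\<delta>\<close>.\<close>
lemma simple_sum_tail:
  fixes \<rho> :: "nat \<Rightarrow> real" and \<zeta> :: "nat \<Rightarrow> 'a \<Rightarrow> real"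
  assumes "0 \<le> \<rho> 0" and mono: "\<And>i. i < q \<Longrightarrow> \<rho> i \<le> \<rho> (Suc i)"
    and meas: "\<And>i. i < q \<Longrightarrow> \<zeta> i \<in> borel_measurable (F (\<rho> i))"
    and bnd: "\<And>i w. i < q \<Longrightarrow> w \<in> space M \<Longrightarrow> \<bar>\<zeta> i w\<bar> \<le> B"
    and "\<epsilon> > 0" "\<delta> \<ge> 0"
  shows "\<P>(w in M. \<epsilon> < \<bar>\<Sum>i<q. \<zeta> i w * (W (\<rho> (Suc i)) w - W (\<rho> i) w)\<bar>)
    \<le> \<delta> / \<epsilon>\<^sup>2 + \<P>(w in M. \<delta> < (\<Sum>i<q. (\<zeta> i w)\<^sup>2 * (\<rho> (Suc i) - \<rho> i)))"
proof -
  define V where "V k w = (\<Sum>i<k. (\<zeta> i w)\<^sup>2 * (\<rho> (Suc i) - \<rho> i))" for k w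
  \<comment> \<open>The test at index i uses the bracket that already includes the i-th term. It is
    still known at time \<open>\<rho> i\<close>, because the grid is deterministic, and it prevents
    the truncated bracket from overshooting \<open>\<delta>\<close>.\<close>
  define \<zeta>' where "\<zeta>' i w = (if V (Suc i) w \<le> \<delta> then \<zeta> i w else 0)" for i w
  have rmono: "\<rho> i \<le> \<rho> j" if "i \<le> j" "j \<le> q" for i j
    using that by (induction j) (auto simp: le_Suc_eq intro: order_trans[OF _ mono])
  have Vm: "V (Suc i) \<in> borel_measurable (F (\<rho> i))" if "i < q" for i
    unfolding V_def
  proof (intro borel_measurable_sum borel_measurable_times borel_measurable_power borel_measurable_const)
    fix j assume "j \<in> {..<Suc i}"
    then show "\<zeta> j \<in> borel_measurable (F (\<rho> i))"
      using that by (intro measurable_F_mono[OF rmono meas]) auto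
  qed
  have zm: "\<zeta>' i \<in> borel_measurable (F (\<rho> i))" if "i < q" for i
    unfolding \<zeta>'_def using Vm[OF that] meas[OF that] by measurable
  have zb: "\<bar>\<zeta>' i w\<bar> \<le> \<bar>B\<bar>" if "i < q" "w \<in> space M" for i w
    using bnd[OF that] by (auto simp: \<zeta>'_def)
  have zM[measurable]: "\<zeta> i \<in> borel_measurable M" "\<zeta>' i \<in> borel_measurable M" if "i < q" for i
    using that meas zm measurable_F_imp_M by blast+
  have r0: "0 \<le> \<rho> i" if "i \<le> q" for i using rmono[of 0 i] that assms(1) by auto
  have Wm[measurable]: "W (\<rho> i) \<in> borel_measurable M" if "i \<le> q" for i
    using r0[OF that] by (rule W_measurable)
  define A where "A w = (\<Sum>i<q. \<zeta>' i w * (W (\<rho> (Suc i)) w - W (\<rho> i) w))" for w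
  note iso = simple_sum_isometry[of \<rho> q \<zeta>' "\<bar>B\<bar>" q, OF assms(1) mono zm zb order_refl, folded A_def]
  have Am[measurable]: "A \<in> borel_measurable M"
    using iso measurable_F_imp_M unfolding A_def[abs_def] by blast
  have Ai: "integrable M (\<lambda>w. (A w)\<^sup>2)" using iso by blast
  have bracket: "(\<Sum>i<k. (\<zeta>' i w)\<^sup>2 * (\<rho> (Suc i) - \<rho> i)) \<le> \<delta>" if "k \<le> q" for k w
    using that
  proof (induction k)
    case (Suc k)
    show ?case
    proof (cases "V (Suc k) w \<le> \<delta>")
      case True
      have "(\<Sum>i<Suc k. (\<zeta>' i w)\<^sup>2 * (\<rho> (Suc i) - \<rho> i)) \<le> V (Suc k) w"
        unfolding V_def using Suc(2) mono by (intro sum_mono mult_right_mono) (auto simp: \<zeta>'_def)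
      with True show ?thesis by simp
    qed (use Suc in \<open>simp add: \<zeta>'_def\<close>)
  qed (use assms in simp)
  have zi: "integrable M (\<lambda>w. (\<zeta>' i w)\<^sup>2)" if "i < q" for i
    by (rule integrable_const_bound[of _ "B\<^sup>2"])
       (use zb[OF that] zM(2)[OF that] in \<open>auto simp: abs_le_square_iff[symmetric]\<close>)
  have "expectation (\<lambda>w. (A w)\<^sup>2) = (\<Sum>i<q. expectation (\<lambda>w. (\<zeta>' i w)\<^sup>2) * (\<rho> (Suc i) - \<rho> i))"
    using iso by blast
  also have "\<dots> = expectation (\<lambda>w. \<Sum>i<q. (\<zeta>' i w)\<^sup>2 * (\<rho> (Suc i) - \<rho> i))"
    using zi by (subst Bochner_Integration.integral_sum) auto
  also have "\<dots> \<le> expectation (\<lambda>w. \<delta>)"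
    using zi by (intro integral_mono bracket) auto
  finally have EA: "expectation (\<lambda>w. (A w)\<^sup>2) \<le> \<delta>" by (simp add: prob_space)
  have tail: "\<P>(w in M. \<epsilon> < \<bar>A w\<bar>) \<le> \<delta> / \<epsilon>\<^sup>2"
  proof -
    have "\<P>(w in M. \<epsilon> < \<bar>A w\<bar>) \<le> \<P>(w in M. \<epsilon>\<^sup>2 \<le> (A w)\<^sup>2)"
      using assms(5) by (intro finite_measure_mono) (auto simp: abs_le_square_iff[symmetric])
    also have "\<dots> \<le> expectation (\<lambda>w. (A w)\<^sup>2) / \<epsilon>\<^sup>2"
      using integral_Markov_inequality_measure[OF Ai, of "{}" "\<epsilon>\<^sup>2"] assms(5) by simp
    also have "\<dots> \<le> \<delta> / \<epsilon>\<^sup>2" using EA by (intro divide_right_mono) auto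
    finally show ?thesis .
  qed
  have VM[measurable]: "V q \<in> borel_measurable M" unfolding V_def by (intro borel_measurable_sum) auto
  have eq: "A w = (\<Sum>i<q. \<zeta> i w * (W (\<rho> (Suc i)) w - W (\<rho> i) w))" if "V q w \<le> \<delta>" for w
  proof -
    have "V (Suc i) w \<le> V q w" if "i < q" for i
      unfolding V_def using that mono by (intro sum_mono2) auto
    with that have "\<zeta>' i w = \<zeta> i w" if "i < q" for i
      using that by (force simp: \<zeta>'_def)
    then show ?thesis unfolding A_def by simp
  qed
  have "\<P>(w in M. \<epsilon> < \<bar>\<Sum>i<q. \<zeta> i w * (W (\<rho> (Suc i)) w - W (\<rho> i) w)\<bar>)
      \<le> prob ({w\<in>space M. \<epsilon> < \<bar>A w\<bar>} \<union> {w\<in>space M. \<delta> < V q w})"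
    by (intro finite_measure_mono) (auto simp: not_less eq)
  also have "\<dots> \<le> \<P>(w in M. \<epsilon> < \<bar>A w\<bar>) + \<P>(w in M. \<delta> < V q w)"
    by (intro measure_Un_le) measurable
  finally show ?thesis using tail by (simp add: V_def)
qed

text \<open>Rewrites a simple integral over any finer grid, so that two integrands with different
  partitions can be subtracted. The grid is strictly increasing, hence each grid cell lies either
  inside or outside a given interval of the original partition clipped at \<open>t\<close>.\<close>

lemma simple_integral_on_grid:
  fixes \<rho> \<tau> :: "nat \<Rightarrow> real"
  assumes simple: "simple_integrand M F m \<tau> \<xi>"
    and grid: "\<And>i. i < q \<Longrightarrow> \<rho> i < \<rho> (Suc i)"
    and sub: "\<And>i. i \<le> m \<Longrightarrow> min (\<tau> i) t \<in> \<rho> ` {..q}"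
  obtains \<zeta> B where "\<And>k. k < q \<Longrightarrow> \<zeta> k \<in> borel_measurable (F (\<rho> k))"
    and "\<And>k w. w \<in> space M \<Longrightarrow> \<bar>\<zeta> k w\<bar> \<le> B"
    and "\<And>w. simple_integral W m \<tau> \<xi> t w = (\<Sum>k<q. \<zeta> k w * (W (\<rho> (Suc k)) w - W (\<rho> k) w))"
    and "\<And>k s w. k < q \<Longrightarrow> \<rho> k < s \<Longrightarrow> s \<le> \<rho> (Suc k) \<Longrightarrow> s \<le> t \<Longrightarrow> simple_process m \<tau> \<xi> s w = \<zeta> k w"
proof -
  have rless: "\<rho> i < \<rho> j" if "i < j" "j \<le> q" for i j
    using that by (induction j) (auto simp: less_Suc_eq intro: less_trans[OF _ grid] grid)
  have rle: "\<rho> i \<le> \<rho> j \<longleftrightarrow> i \<le> j" if "i \<le> q" "j \<le> q" for i j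
    using rless[of i j] rless[of j i] that by (cases i j rule: linorder_cases) auto
  have "\<forall>i\<in>{..m}. \<exists>k. k \<le> q \<and> \<rho> k = min (\<tau> i) t" using sub by (auto simp: image_iff eq_commute)
  then obtain a where a: "\<And>i. i \<le> m \<Longrightarrow> a i \<le> q" "\<And>i. i \<le> m \<Longrightarrow> \<rho> (a i) = min (\<tau> i) t"
    unfolding bchoice_iff by auto
  have tm: "\<tau> i \<le> \<tau> (Suc i)" if "i < m" for i using simple that by (auto simp: simple_integrand_def)
  have am: "a i \<le> a (Suc i)" if "i < m" for i
    using tm[OF that] that by (subst rle[symmetric]) (auto simp: a)
  obtain B where B: "\<And>i w. i < m \<Longrightarrow> w \<in> space M \<Longrightarrow> \<bar>\<xi> i w\<bar> \<le> B"
    using simple unfolding simple_integrand_def by blast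
  define \<zeta> where "\<zeta> k w = (\<Sum>i<m. \<xi> i w * (if a i \<le> k \<and> k < a (Suc i) then 1 else 0))" for k w
  show ?thesis
  proof (rule that[of \<zeta> "real m * \<bar>B\<bar>"])
    fix k assume k: "k < q"
    have "(\<lambda>w. \<xi> i w * (if a i \<le> k \<and> k < a (Suc i) then 1 else 0)) \<in> borel_measurable (F (\<rho> k))" if i: "i < m" for i
    proof (cases "a i \<le> k \<and> k < a (Suc i)")
      case True
      \<comment> \<open>An interval that stays nonempty after clipping starts before
        \<open>t\<close>, so its left end is unclipped and \<open>\<xi> i\<close> is known at
        \<open>\<rho> k\<close>.\<close>
      then have "\<rho> (a i) < \<rho> (a (Suc i))" using rless[of "a i" "a (Suc i)"] a(1)[of "Suc i"] i by auto
      then have "\<tau> i = \<rho> (a i)" using a(2)[of i] a(2)[of "Suc i"] i tm[OF i] by (auto simp: min_def split: if_splits)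
      moreover have "\<rho> (a i) \<le> \<rho> k" using True k by (subst rle) auto
      moreover have "\<xi> i \<in> borel_measurable (F (\<tau> i))" using simple i by (auto simp: simple_integrand_def)
      ultimately have "\<xi> i \<in> borel_measurable (F (\<rho> k))" by (auto intro: measurable_F_mono)
      then show ?thesis using True by simp
    qed auto
    then show "\<zeta> k \<in> borel_measurable (F (\<rho> k))"
      unfolding \<zeta>_def by (intro borel_measurable_sum) auto
  next
    fix k w assume wM: "w \<in> space M"
    have "\<bar>\<xi> i w\<bar> \<le> \<bar>B\<bar>" if "i < m" for i using B[OF that wM] by simp
    then have "\<bar>\<zeta> k w\<bar> \<le> (\<Sum>i<m. \<bar>B\<bar>)"
      unfolding \<zeta>_def by (intro order_trans[OF sum_abs] sum_mono) auto
    then show "\<bar>\<zeta> k w\<bar> \<le> real m * \<bar>B\<bar>" by simp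
  next
    fix w
    have tele: "W (\<rho> c) w - W (\<rho> b) w = (\<Sum>k<q. (if b \<le> k \<and> k < c then 1 else 0) * (W (\<rho> (Suc k)) w - W (\<rho> k) w))"
      if "b \<le> c" "c \<le> q" for b c
    proof -
      have "W (\<rho> c) w - W (\<rho> b) w = (\<Sum>k=b..<c. W (\<rho> (Suc k)) w - W (\<rho> k) w)"
        using sum_Suc_diff'[OF that(1), of "\<lambda>k. W (\<rho> k) w"] by simp
      also have "\<dots> = (\<Sum>k<q. if k \<in> {b..<c} then W (\<rho> (Suc k)) w - W (\<rho> k) w else 0)"
        using that by (subst sum.inter_restrict[symmetric]) (auto intro!: sum.cong)
      also have "\<dots> = (\<Sum>k<q. (if b \<le> k \<and> k < c then 1 else 0) * (W (\<rho> (Suc k)) w - W (\<rho> k) w))"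
        by (intro sum.cong) auto
      finally show ?thesis .
    qed
    have "simple_integral W m \<tau> \<xi> t w = (\<Sum>i<m. \<xi> i w * (W (\<rho> (a (Suc i))) w - W (\<rho> (a i)) w))"
      unfolding simple_integral_def by (intro sum.cong) (auto simp: a)
    also have "\<dots> = (\<Sum>i<m. \<Sum>k<q. \<xi> i w * (if a i \<le> k \<and> k < a (Suc i) then 1 else 0) * (W (\<rho> (Suc k)) w - W (\<rho> k) w))"
      by (intro sum.cong refl, subst tele) (auto simp: a am sum_distrib_left mult.assoc)
    also have "\<dots> = (\<Sum>k<q. \<Sum>i<m. \<xi> i w * (if a i \<le> k \<and> k < a (Suc i) then 1 else 0) * (W (\<rho> (Suc k)) w - W (\<rho> k) w))"
      by (rule sum.swap)
    also have "\<dots> = (\<Sum>k<q. \<zeta> k w * (W (\<rho> (Suc k)) w - W (\<rho> k) w))"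
      unfolding \<zeta>_def by (simp only: sum_distrib_right)
    finally show "simple_integral W m \<tau> \<xi> t w = (\<Sum>k<q. \<zeta> k w * (W (\<rho> (Suc k)) w - W (\<rho> k) w))" .
  next
    fix k s w assume k: "k < q" and s: "\<rho> k < s" "s \<le> \<rho> (Suc k)" "s \<le> t"
    have "indicator {\<tau> i<..\<tau> (Suc i)} s = (if a i \<le> k \<and> k < a (Suc i) then 1 else 0 :: real)" if i: "i < m" for i
    proof -
      have "\<tau> i < s \<longleftrightarrow> \<rho> (a i) < s" using s(3) a(2)[of i] i by (auto simp: min_def)
      also have "\<dots> \<longleftrightarrow> a i \<le> k"
        using rle[of "a i" k] rle[of "Suc k" "a i"] a(1)[of i] i k s by auto
      finally have 1: "\<tau> i < s \<longleftrightarrow> a i \<le> k" .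
      have "s \<le> \<tau> (Suc i) \<longleftrightarrow> s \<le> \<rho> (a (Suc i))" using s(3) a(2)[of "Suc i"] i by (auto simp: min_def)
      also have "\<dots> \<longleftrightarrow> k < a (Suc i)"
        using rle[of "a (Suc i)" k] rle[of "Suc k" "a (Suc i)"] a(1)[of "Suc i"] i k s by auto
      finally show ?thesis using 1 by (auto simp: indicator_def)
    qed
    then show "simple_process m \<tau> \<xi> s w = \<zeta> k w"
      unfolding simple_process_def \<zeta>_def by (intro sum.cong) auto
  qed
qed

section \<open>Pathwise L2 distance and approximation of the Ito integral\<close>

definition L2_dist_sq :: "(real \<Rightarrow> 'a \<Rightarrow> real) \<Rightarrow> (real \<Rightarrow> 'a \<Rightarrow> real) \<Rightarrow> real \<Rightarrow> 'a \<Rightarrow> ennreal" where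
  "L2_dist_sq S H t w = (\<integral>\<^sup>+ s\<in>{0..t}. ennreal ((S s w - H s w)\<^sup>2) \<partial>lborel)"

lemma L2_dist_sq_measurable:
  assumes "(\<lambda>(s, w). S s w) \<in> borel_measurable (restrict_space borel {0..t} \<Otimes>\<^sub>M M)"
    and "(\<lambda>(s, w). H s w) \<in> borel_measurable (restrict_space borel {0..t} \<Otimes>\<^sub>M M)"
  shows "L2_dist_sq S H t \<in> borel_measurable M"
proof -
  let ?L = "restrict_space lborel {0..t}"
  interpret L: sigma_finite_measure ?L
    by (rule sigma_finite_measure_restrict_space) (auto intro: lborel.sigma_finite_measure_axioms)
  have sets: "sets (?L \<Otimes>\<^sub>M M) = sets (restrict_space borel {0..t} \<Otimes>\<^sub>M M)"
    by (intro sets_pair_measure_cong sets_restrict_space_cong) auto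
  have "(\<lambda>(s, w). ennreal ((S s w - H s w)\<^sup>2)) \<in> borel_measurable (?L \<Otimes>\<^sub>M M)"
    using assms unfolding measurable_cong_sets[OF sets refl] split_beta'
    by (intro measurable_compose[OF _ measurable_ennreal] borel_measurable_power borel_measurable_diff)
  then have "(\<lambda>(w, s). ennreal ((S s w - H s w)\<^sup>2)) \<in> borel_measurable (M \<Otimes>\<^sub>M ?L)"
    using measurable_pair_swap by fastforce
  then have "(\<lambda>w. \<integral>\<^sup>+s. ennreal ((S s w - H s w)\<^sup>2) \<partial>?L) \<in> borel_measurable M"
    by (rule L.borel_measurable_nn_integral)
  then show ?thesis
    by (simp add: L2_dist_sq_def[abs_def] nn_integral_restrict_space)
qed

lemma progressively_measurable_M:
  assumes "progressively_measurable F H" "0 \<le> t"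
  shows "(\<lambda>(s, w). H s w) \<in> borel_measurable (restrict_space borel {0..t} \<Otimes>\<^sub>M M)"
proof -
  have "(\<lambda>(s, w). H s w) \<in> borel_measurable (restrict_space borel {0..t} \<Otimes>\<^sub>M F t)"
    using assms by (auto simp: progressively_measurable_def)
  moreover have "(\<lambda>x. x) \<in> measurable (restrict_space borel {0..t} \<Otimes>\<^sub>M M) (restrict_space borel {0..t} \<Otimes>\<^sub>M F t)"
    by (rule measurable_pair) (auto simp: comp_def intro!: measurable_compose[OF measurable_snd] measurable_F_imp_M[of "\<lambda>x. x" t])
  ultimately show ?thesis by (rule measurable_compose[rotated])
qed

lemma simple_process_measurable:
  assumes "simple_integrand M F m \<tau> \<xi>"
  shows "(\<lambda>(s, w). simple_process m \<tau> \<xi> s w) \<in> borel_measurable (restrict_space borel {0..t} \<Otimes>\<^sub>M M)"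
proof -
  have "\<xi> i \<in> borel_measurable M" if "i < m" for i
    by (rule measurable_F_imp_M[of _ "\<tau> i"]) (use assms that in \<open>auto simp: simple_integrand_def\<close>)
  moreover have "(\<lambda>s. indicator {\<tau> i<..\<tau> (Suc i)} s :: real) \<in> borel_measurable (restrict_space borel {0..t})" for i
    by (rule measurable_restrict_space1) auto
  ultimately show ?thesis
    unfolding simple_process_def split_beta'
    by (intro borel_measurable_sum borel_measurable_times measurable_compose[OF measurable_snd] measurable_compose[OF measurable_fst]) auto
qed

lemma simple_integral_measurable:
  assumes "simple_integrand M F m \<tau> \<xi>" "0 \<le> t"
  shows "simple_integral W m \<tau> \<xi> t \<in> borel_measurable M"
proof -
  have "0 \<le> \<tau> i" if "i \<le> m" for i
    using assms(1) that by (induction i) (auto simp: simple_integrand_def intro: order_trans)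
  then show ?thesis
    using assms unfolding simple_integral_def[abs_def]
    by (intro borel_measurable_sum borel_measurable_times borel_measurable_diff W_measurable)
       (auto simp: simple_integrand_def intro: measurable_F_imp_M)
qed

text \<open>On the common refinement, clipped at \<open>t\<close>, the difference of the integrals
  is one grid sum. Its bracket is the integral of the squared difference of the integrands over the
  grid cells, which lie in \<open>{0..t}\<close>; then \<open>simple_sum_tail\<close>
  applies.\<close>

lemma simple_integral_diff_tail:
  assumes S1: "simple_integrand M F m1 \<tau>1 \<xi>1" and S2: "simple_integrand M F m2 \<tau>2 \<xi>2"
    and "0 \<le> t" "\<epsilon> > 0" "\<delta> \<ge> 0"
  shows "\<P>(w in M. \<epsilon> < \<bar>simple_integral W m1 \<tau>1 \<xi>1 t w - simple_integral W m2 \<tau>2 \<xi>2 t w\<bar>)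
    \<le> \<delta> / \<epsilon>\<^sup>2 + \<P>(w in M. ennreal \<delta> < L2_dist_sq (simple_process m1 \<tau>1 \<xi>1) (simple_process m2 \<tau>2 \<xi>2) t w)"
proof -
  define P where "P = (\<lambda>x. min x t) ` (\<tau>1 ` {..m1} \<union> \<tau>2 ` {..m2})"
  have P: "finite P" "P \<noteq> {}" by (auto simp: P_def)
  have n1: "0 \<le> \<tau>1 i" if "i \<le> m1" for i
    using S1 that by (induction i) (auto simp: simple_integrand_def intro: order_trans)
  have n2: "0 \<le> \<tau>2 i" if "i \<le> m2" for i
    using S2 that by (induction i) (auto simp: simple_integrand_def intro: order_trans)
  have Pb: "0 \<le> x \<and> x \<le> t" if "x \<in> P" for x using that n1 n2 assms(3) by (auto simp: P_def)
  define q where "q = card P - 1"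
  have q: "card P = Suc q" using P by (simp add: q_def card_gt_0_iff)
  define \<rho> where "\<rho> i = sorted_list_of_set P ! i" for i
  have grid: "\<rho> i < \<rho> (Suc i)" if "i < q" for i
    unfolding \<rho>_def using that q strict_sorted_list_of_set[of P]
    by (auto simp: sorted_wrt_iff_nth_less length_sorted_list_of_set)
  have img: "\<rho> ` {..q} = P"
  proof -
    have "\<rho> ` {..q} = set (sorted_list_of_set P)"
      unfolding \<rho>_def set_conv_nth length_sorted_list_of_set q by (auto simp: less_Suc_eq_le)
    then show ?thesis using P by simp
  qed
  have rb: "0 \<le> \<rho> i \<and> \<rho> i \<le> t" if "i \<le> q" for i using Pb img that by blast
  obtain \<zeta>1 B1 where z1: "\<And>k. k < q \<Longrightarrow> \<zeta>1 k \<in> borel_measurable (F (\<rho> k))"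
    "\<And>k w. w \<in> space M \<Longrightarrow> \<bar>\<zeta>1 k w\<bar> \<le> B1"
    "\<And>w. simple_integral W m1 \<tau>1 \<xi>1 t w = (\<Sum>k<q. \<zeta>1 k w * (W (\<rho> (Suc k)) w - W (\<rho> k) w))"
    "\<And>k s w. k < q \<Longrightarrow> \<rho> k < s \<Longrightarrow> s \<le> \<rho> (Suc k) \<Longrightarrow> s \<le> t \<Longrightarrow> simple_process m1 \<tau>1 \<xi>1 s w = \<zeta>1 k w"
    by (rule simple_integral_on_grid[OF S1, of q \<rho> t, OF grid]) (auto simp: img P_def)
  obtain \<zeta>2 B2 where z2: "\<And>k. k < q \<Longrightarrow> \<zeta>2 k \<in> borel_measurable (F (\<rho> k))"
    "\<And>k w. w \<in> space M \<Longrightarrow> \<bar>\<zeta>2 k w\<bar> \<le> B2"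
    "\<And>w. simple_integral W m2 \<tau>2 \<xi>2 t w = (\<Sum>k<q. \<zeta>2 k w * (W (\<rho> (Suc k)) w - W (\<rho> k) w))"
    "\<And>k s w. k < q \<Longrightarrow> \<rho> k < s \<Longrightarrow> s \<le> \<rho> (Suc k) \<Longrightarrow> s \<le> t \<Longrightarrow> simple_process m2 \<tau>2 \<xi>2 s w = \<zeta>2 k w"
    by (rule simple_integral_on_grid[OF S2, of q \<rho> t, OF grid]) (auto simp: img P_def)
  define \<zeta> where "\<zeta> k w = \<zeta>1 k w - \<zeta>2 k w" for k w
  have diff: "simple_integral W m1 \<tau>1 \<xi>1 t w - simple_integral W m2 \<tau>2 \<xi>2 t w
      = (\<Sum>k<q. \<zeta> k w * (W (\<rho> (Suc k)) w - W (\<rho> k) w))" for w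
    unfolding z1(3) z2(3) \<zeta>_def by (simp add: sum_subtractf left_diff_distrib)
  let ?L = "L2_dist_sq (simple_process m1 \<tau>1 \<xi>1) (simple_process m2 \<tau>2 \<xi>2) t"
  have le: "ennreal (\<Sum>k<q. (\<zeta> k w)\<^sup>2 * (\<rho> (Suc k) - \<rho> k)) \<le> ?L w" for w
  proof -
    have "ennreal (\<Sum>k<q. (\<zeta> k w)\<^sup>2 * (\<rho> (Suc k) - \<rho> k)) = (\<Sum>k<q. ennreal ((\<zeta> k w)\<^sup>2) * emeasure lborel {\<rho> k<..\<rho> (Suc k)})"
      using grid by (subst sum_ennreal[symmetric]) (auto intro!: sum.cong simp: ennreal_mult' less_imp_le)
    also have "\<dots> = (\<Sum>k<q. \<integral>\<^sup>+s. ennreal ((\<zeta> k w)\<^sup>2) * indicator {\<rho> k<..\<rho> (Suc k)} s \<partial>lborel)"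
      by (simp add: nn_integral_cmult_indicator)
    also have "\<dots> = (\<integral>\<^sup>+s. (\<Sum>k<q. ennreal ((\<zeta> k w)\<^sup>2) * indicator {\<rho> k<..\<rho> (Suc k)} s) \<partial>lborel)"
      by (rule nn_integral_sum[symmetric]) auto
    also have "\<dots> \<le> ?L w"
      unfolding L2_dist_sq_def
    proof (intro nn_integral_mono)
      fix s :: real
      show "(\<Sum>k<q. ennreal ((\<zeta> k w)\<^sup>2) * indicator {\<rho> k<..\<rho> (Suc k)} s)
        \<le> ennreal ((simple_process m1 \<tau>1 \<xi>1 s w - simple_process m2 \<tau>2 \<xi>2 s w)\<^sup>2) * indicator {0..t} s"
      proof (cases "\<exists>k<q. \<rho> k < s \<and> s \<le> \<rho> (Suc k)")
        case True
        then obtain k where k: "k < q" "\<rho> k < s" "s \<le> \<rho> (Suc k)" by auto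
        have rmono: "\<rho> i \<le> \<rho> j" if "i \<le> j" "j \<le> q" for i j
          using that by (induction j) (auto simp: le_Suc_eq intro: order_trans[OF _ less_imp_le[OF grid]])
        have "indicator {\<rho> j<..\<rho> (Suc j)} s = (if j = k then 1 else 0 :: ennreal)" if "j < q" for j
          using k that rmono[of "Suc j" k] rmono[of "Suc k" j] by (cases j k rule: linorder_cases) (auto simp: indicator_def)
        then have "(\<Sum>j<q. ennreal ((\<zeta> j w)\<^sup>2) * indicator {\<rho> j<..\<rho> (Suc j)} s) = (\<Sum>j<q. if j = k then ennreal ((\<zeta> j w)\<^sup>2) else 0)"
          by (intro sum.cong) auto
        also have "\<dots> = ennreal ((\<zeta> k w)\<^sup>2)" using k by simp
        finally show ?thesis
          using k rb[of k] rb[of "Suc k"] z1(4)[of k s w] z2(4)[of k s w] by (simp add: \<zeta>_def)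
      next
        case False
        then have "(\<Sum>k<q. ennreal ((\<zeta> k w)\<^sup>2) * indicator {\<rho> k<..\<rho> (Suc k)} s) = 0"
          by (intro sum.neutral) (auto simp: indicator_def)
        then show ?thesis by (simp only: zero_le)
      qed
    qed
    finally show ?thesis .
  qed
  have [measurable]: "?L \<in> borel_measurable M"
    by (intro L2_dist_sq_measurable simple_process_measurable S1 S2)
  have "\<P>(w in M. \<epsilon> < \<bar>\<Sum>i<q. \<zeta> i w * (W (\<rho> (Suc i)) w - W (\<rho> i) w)\<bar>)
    \<le> \<delta> / \<epsilon>\<^sup>2 + \<P>(w in M. \<delta> < (\<Sum>i<q. (\<zeta> i w)\<^sup>2 * (\<rho> (Suc i) - \<rho> i)))"
  proof (rule simple_sum_tail[where B="B1 + B2"])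
    show "\<bar>\<zeta> i w\<bar> \<le> B1 + B2" if "w \<in> space M" for i w
      using z1(2)[OF that, of i] z2(2)[OF that, of i] by (auto simp: \<zeta>_def)
  qed (use rb grid assms z1(1) z2(1) in \<open>auto simp: \<zeta>_def[abs_def] intro: less_imp_le\<close>)
  also have "\<P>(w in M. \<delta> < (\<Sum>i<q. (\<zeta> i w)\<^sup>2 * (\<rho> (Suc i) - \<rho> i))) \<le> \<P>(w in M. ennreal \<delta> < ?L w)"
    using assms(5) by (intro finite_measure_mono) (auto intro!: less_le_trans[OF _ le] simp: ennreal_less_iff)
  finally show ?thesis unfolding diff by simp
qed

lemma L2_dist_sq_triangle:
  assumes "(\<lambda>s. S s w) \<in> borel_measurable (restrict_space borel {0..t})"
    and "(\<lambda>s. H s w) \<in> borel_measurable (restrict_space borel {0..t})"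
    and "(\<lambda>s. T s w) \<in> borel_measurable (restrict_space borel {0..t})"
  shows "L2_dist_sq S T t w \<le> 2 * L2_dist_sq S H t w + 2 * L2_dist_sq T H t w"
proof -
  let ?L = "restrict_space lborel {0..t}"
  have sets: "sets ?L = sets (restrict_space borel {0..t})"
    by (intro sets_restrict_space_cong) auto
  note [measurable] = assms[folded measurable_cong_sets[OF sets refl]]
  have eq: "L2_dist_sq S' T' t w = (\<integral>\<^sup>+s. ennreal ((S' s w - T' s w)\<^sup>2) \<partial>?L)" for S' T'
    by (simp add: L2_dist_sq_def nn_integral_restrict_space)
  have "(a - c)\<^sup>2 \<le> 2 * (a - b)\<^sup>2 + 2 * (c - b)\<^sup>2" for a b c :: real
    using zero_le_power2[of "(a - b) + (c - b)"] by (simp add: power2_eq_square algebra_simps)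
  then have "L2_dist_sq S T t w \<le> (\<integral>\<^sup>+s. 2 * ennreal ((S s w - H s w)\<^sup>2) + 2 * ennreal ((T s w - H s w)\<^sup>2) \<partial>?L)"
    unfolding eq
    by (intro nn_integral_mono)
       (simp add: ennreal_numeral[symmetric] ennreal_mult'[symmetric] ennreal_plus[symmetric] ennreal_leI del: ennreal_plus ennreal_numeral)
  also have "\<dots> = 2 * L2_dist_sq S H t w + 2 * L2_dist_sq T H t w"
    unfolding eq by (subst nn_integral_add) (auto simp: nn_integral_cmult)
  finally show ?thesis .
qed

text \<open>The definition of the integral merely provides some approximating sequence; this lets a
  chosen simple integrand take its place. Half of \<open>\<epsilon>\<close> is spent on each side of
  a member of that sequence. The triangle inequality for squares turns two distances
  \<open>\<delta>\<close> into \<open>4 * \<delta>\<close>, whence 4 \<open>\<delta>\<close> /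
  (\<open>\<epsilon>\<close>/2)^2. The two probabilities that involve the sequence vanish in the
  limit.\<close>

lemma ito_integral_approx:
  assumes ito: "has_ito_integral M F W H t J" and simple: "simple_integrand M F m \<tau> \<xi>"
    and "0 \<le> t" "\<epsilon> > 0" "\<delta> > 0"
  shows "\<P>(w in M. \<epsilon> < \<bar>J w - simple_integral W m \<tau> \<xi> t w\<bar>)
    \<le> 16 * \<delta> / \<epsilon>\<^sup>2 + \<P>(w in M. ennreal \<delta> < L2_dist_sq (simple_process m \<tau> \<xi>) H t w)"
proof -
  from ito obtain m' \<tau>' \<xi>' where simple': "\<And>n. simple_integrand M F (m' n) (\<tau>' n) (\<xi>' n)"
    and c1: "tendsto_0_in_prob M (\<lambda>n w. L2_dist_sq (simple_process (m' n) (\<tau>' n) (\<xi>' n)) H t w)"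
    and c2: "tendsto_0_in_prob M (\<lambda>n w. ennreal \<bar>simple_integral W (m' n) (\<tau>' n) (\<xi>' n) t w - J w\<bar>)"
    and H: "progressively_measurable F H" and J[measurable]: "J \<in> borel_measurable M"
    unfolding has_ito_integral_def L2_dist_sq_def by blast
  note Hm = progressively_measurable_M[OF H \<open>0 \<le> t\<close>]
  let ?S = "simple_process m \<tau> \<xi>" and ?I = "simple_integral W m \<tau> \<xi> t"
  let ?S' = "\<lambda>n. simple_process (m' n) (\<tau>' n) (\<xi>' n)" and ?I' = "\<lambda>n. simple_integral W (m' n) (\<tau>' n) (\<xi>' n) t"
  have [measurable]: "?I \<in> borel_measurable M" "\<And>n. ?I' n \<in> borel_measurable M"
    using simple_integral_measurable simple simple' \<open>0 \<le> t\<close> by auto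
  have [measurable]: "L2_dist_sq ?S H t \<in> borel_measurable M" "\<And>n. L2_dist_sq (?S' n) H t \<in> borel_measurable M"
    "\<And>n. L2_dist_sq (?S' n) ?S t \<in> borel_measurable M"
    using L2_dist_sq_measurable simple_process_measurable simple simple' Hm by auto
  let ?a = "\<lambda>n. \<P>(w in M. ennreal \<delta> < L2_dist_sq (?S' n) H t w)"
  let ?b = "\<lambda>n. \<P>(w in M. ennreal (\<epsilon> / 2) < ennreal \<bar>?I' n w - J w\<bar>)"
  have lim: "?a \<longlonglongrightarrow> 0" "?b \<longlonglongrightarrow> 0"
    using c1 c2 assms(4,5) unfolding tendsto_0_in_prob_def by auto
  let ?L = "\<P>(w in M. \<epsilon> < \<bar>J w - ?I w\<bar>)"
  let ?R = "16 * \<delta> / \<epsilon>\<^sup>2 + \<P>(w in M. ennreal \<delta> < L2_dist_sq ?S H t w)"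
  have step: "?L \<le> ?R + (?a n + ?b n)" for n
  proof -
    have tri: "L2_dist_sq (?S' n) ?S t w \<le> 2 * L2_dist_sq (?S' n) H t w + 2 * L2_dist_sq ?S H t w" if wM: "w \<in> space M" for w
    proof (rule L2_dist_sq_triangle)
      have sec: "(\<lambda>s. T s w) \<in> borel_measurable (restrict_space borel {0..t})"
        if "(\<lambda>(s, w). T s w) \<in> borel_measurable (restrict_space borel {0..t} \<Otimes>\<^sub>M M)" for T :: "real \<Rightarrow> 'a \<Rightarrow> real"
        using measurable_Pair1[OF that, of w] wM measurable_compose[OF measurable_Pair2'[OF wM] that] by simp
      show "(\<lambda>s. ?S' n s w) \<in> borel_measurable (restrict_space borel {0..t})"
        "(\<lambda>s. H s w) \<in> borel_measurable (restrict_space borel {0..t})"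
        "(\<lambda>s. ?S s w) \<in> borel_measurable (restrict_space borel {0..t})"
        by (intro sec simple_process_measurable simple simple' Hm)+
    qed
    have "?L \<le> prob ({w\<in>space M. ennreal (\<epsilon> / 2) < ennreal \<bar>?I' n w - J w\<bar>} \<union> {w\<in>space M. \<epsilon> / 2 < \<bar>?I' n w - ?I w\<bar>})"
    proof (intro finite_measure_mono subsetI)
      fix w assume "w \<in> {w\<in>space M. \<epsilon> < \<bar>J w - ?I w\<bar>}"
      then have "w \<in> space M" "\<epsilon> / 2 < \<bar>?I' n w - J w\<bar> \<or> \<epsilon> / 2 < \<bar>?I' n w - ?I w\<bar>" by (simp, simp, argo)
      then show "w \<in> {w\<in>space M. ennreal (\<epsilon> / 2) < ennreal \<bar>?I' n w - J w\<bar>} \<union> {w\<in>space M. \<epsilon> / 2 < \<bar>?I' n w - ?I w\<bar>}"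
        using assms(4) by (auto simp: ennreal_less_iff)
    qed measurable
    also have "\<dots> \<le> ?b n + \<P>(w in M. \<epsilon> / 2 < \<bar>?I' n w - ?I w\<bar>)"
      by (intro measure_Un_le) measurable
    also have "\<P>(w in M. \<epsilon> / 2 < \<bar>?I' n w - ?I w\<bar>) \<le> 4 * \<delta> / (\<epsilon> / 2)\<^sup>2 + \<P>(w in M. ennreal (4 * \<delta>) < L2_dist_sq (?S' n) ?S t w)"
      using assms by (intro simple_integral_diff_tail simple simple') auto
    also have "\<P>(w in M. ennreal (4 * \<delta>) < L2_dist_sq (?S' n) ?S t w)
        \<le> prob ({w\<in>space M. ennreal \<delta> < L2_dist_sq (?S' n) H t w} \<union> {w\<in>space M. ennreal \<delta> < L2_dist_sq ?S H t w})"
    proof (intro finite_measure_mono)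
      show "{w\<in>space M. ennreal (4 * \<delta>) < L2_dist_sq (?S' n) ?S t w}
        \<subseteq> {w\<in>space M. ennreal \<delta> < L2_dist_sq (?S' n) H t w} \<union> {w\<in>space M. ennreal \<delta> < L2_dist_sq ?S H t w}"
      proof (rule ccontr)
        assume "\<not> ?thesis"
        then obtain w where wM: "w \<in> space M" "ennreal (4 * \<delta>) < L2_dist_sq (?S' n) ?S t w"
          "\<not> ennreal \<delta> < L2_dist_sq (?S' n) H t w" "\<not> ennreal \<delta> < L2_dist_sq ?S H t w" by blast
        have "L2_dist_sq (?S' n) ?S t w \<le> 2 * ennreal \<delta> + 2 * ennreal \<delta>"
          by (rule order_trans[OF tri[OF wM(1)]]) (intro add_mono mult_left_mono; use wM in \<open>simp add: not_less\<close>)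
        also have "\<dots> = ennreal (4 * \<delta>)"
          using assms(5) by (simp add: ennreal_numeral[symmetric] ennreal_mult'[symmetric] ennreal_plus[symmetric] del: ennreal_plus ennreal_numeral)
        finally show False using wM(2) by simp
      qed
    qed measurable
    also have "\<dots> \<le> ?a n + \<P>(w in M. ennreal \<delta> < L2_dist_sq ?S H t w)"
      by (intro measure_Un_le) measurable
    finally show ?thesis by (simp add: power_divide)
  qed
  have "(\<lambda>n. ?R + (?a n + ?b n)) \<longlonglongrightarrow> ?R + (0 + 0)"
    by (intro tendsto_intros lim)
  then show ?thesis
    using step by (intro LIMSEQ_le_const[of _ ?R ?L]) auto
qed

end

section \<open>Riemann sums for the solution\<close>

lemma (in prob_space) prob_tendsto_0:
  assumes meas: "\<And>n. A n \<in> events" and "AE w in M. \<forall>\<^sub>F n in sequentially. w \<notin> A n"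
  shows "(\<lambda>n. prob (A n)) \<longlonglongrightarrow> 0"
proof -
  have "(\<lambda>n. expectation (indicator (A n) :: _ \<Rightarrow> real)) \<longlonglongrightarrow> expectation (\<lambda>_. 0)"
  proof (rule integral_dominated_convergence[where w="\<lambda>_. 1"])
    show "AE w in M. (\<lambda>n. indicator (A n) w :: real) \<longlonglongrightarrow> 0"
      using assms(2)
    proof eventually_elim
      case (elim w)
      show ?case
        by (rule tendsto_eventually) (use elim in \<open>eventually_elim, simp\<close>)
    qed
  qed (use meas in \<open>auto simp: indicator_def\<close>)
  then show ?thesis using meas by simp
qed

locale sde = bm +
  fixes X :: "real \<Rightarrow> 'a \<Rightarrow> real" and x0 :: real
  assumes x0: "x0 \<ge> 0"
    and sol: "strong_solution M F W (\<lambda>x. 1) (\<lambda>x. 2 * sqrt x) x0 X"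
    and X_nonneg: "AE w in M. \<forall>t\<ge>0. X t w \<ge> 0"
begin

lemma X_measurable_F: "0 \<le> s \<Longrightarrow> s \<le> t \<Longrightarrow> X s \<in> borel_measurable (F t)"
  using sol by (auto simp: strong_solution_def adapted_def intro: measurable_F_mono)

lemma X_measurable[measurable (raw)]: "0 \<le> t \<Longrightarrow> X t \<in> borel_measurable M"
  by (rule measurable_F_imp_M[OF X_measurable_F[OF _ order_refl]])

lemma continuous_paths:
  "AE w in M. continuous_on {0..1} (\<lambda>t. W t w) \<and> continuous_on {0..1} (\<lambda>t. X t w)"
proof -
  have "AE w in M. continuous_on {0..} (\<lambda>t. W t w)" "AE w in M. continuous_on {0..} (\<lambda>t. X t w)"
    using BM sol by (auto simp: brownian_motion_def strong_solution_def)
  then show ?thesis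
    by eventually_elim (auto elim!: continuous_on_subset)
qed

definition dW :: "nat \<Rightarrow> nat \<Rightarrow> 'a \<Rightarrow> real" where
  "dW N j w = W (real (Suc j) / real N) w - W (real j / real N) w"

text \<open>Rational times make this an event, and all grid points i/N are rational, so the bound
  holds on every grid without recourse to continuity. Continuity is needed only to see that the
  event is likely for large K.\<close>

definition bounded_paths :: "real \<Rightarrow> 'a set" where
  "bounded_paths K = {w\<in>space M. \<forall>r\<in>\<rat> \<inter> {0..1}. \<bar>X r w\<bar> \<le> K \<and> \<bar>W r w\<bar> \<le> K}"

lemma bounded_paths_sets[measurable]: "bounded_paths K \<in> events"
proof -
  have "countable (\<rat> \<inter> {0..1::real})" using countable_rat by (rule countable_subset[rotated]) auto
  then have "space M - (\<Union>r\<in>\<rat> \<inter> {0..1}. {w\<in>space M. \<not> (\<bar>X r w\<bar> \<le> K \<and> \<bar>W r w\<bar> \<le> K)}) \<in> events"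
    by (intro sets.Diff sets.countable_UN') auto
  also have "space M - (\<Union>r\<in>\<rat> \<inter> {0..1}. {w\<in>space M. \<not> (\<bar>X r w\<bar> \<le> K \<and> \<bar>W r w\<bar> \<le> K)}) = bounded_paths K"
    by (auto simp: bounded_paths_def)
  finally show ?thesis .
qed

lemma bounded_pathsD:
  assumes "w \<in> bounded_paths K" "i \<le> N"
  shows "\<bar>X (real i / real N) w\<bar> \<le> K" "\<bar>W (real i / real N) w\<bar> \<le> K"
proof -
  have "real i / real N \<in> \<rat> \<inter> {0..1}" using assms(2) by (auto simp: divide_simps)
  then show "\<bar>X (real i / real N) w\<bar> \<le> K" "\<bar>W (real i / real N) w\<bar> \<le> K"
    using assms(1) by (auto simp: bounded_paths_def)
qed

lemma bounded_paths_likely: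
  assumes "\<kappa> > 0"
  obtains K where "K > 0" "prob (space M - bounded_paths K) \<le> \<kappa>"
proof -
  have "AE w in M. \<forall>\<^sub>F k in sequentially. w \<notin> space M - bounded_paths (real k)"
    using continuous_paths
  proof eventually_elim
    case (elim w)
    then have cont: "continuous_on {0..1} (\<lambda>t. W t w)" "continuous_on {0..1} (\<lambda>t. X t w)" by auto
    have "bounded ((\<lambda>t. W t w) ` {0..1})" "bounded ((\<lambda>t. X t w) ` {0..1})"
      by (intro compact_imp_bounded compact_continuous_image cont compact_Icc)+
    then obtain a b where ab: "\<forall>t\<in>{0..1}. \<bar>W t w\<bar> \<le> a" "\<forall>t\<in>{0..1}. \<bar>X t w\<bar> \<le> b"
      unfolding bounded_iff ball_simps real_norm_def by blast
    have "\<forall>\<^sub>F k in sequentially. max a b \<le> real k"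
      using filterlim_real_sequentially unfolding filterlim_at_top by blast
    then show ?case
    proof eventually_elim
      case (elim k)
      then show ?case using ab by (fastforce simp: bounded_paths_def)
    qed
  qed
  then have "(\<lambda>k. prob (space M - bounded_paths (real k))) \<longlonglongrightarrow> 0"
    by (intro prob_tendsto_0) auto
  then have "\<forall>\<^sub>F k in sequentially. prob (space M - bounded_paths (real k)) < \<kappa> \<and> 0 < k"
    using assms by (intro eventually_conj order_tendstoD eventually_gt_at_top)
  then obtain k where "prob (space M - bounded_paths (real k)) < \<kappa>" "0 < k"
    by (auto simp: eventually_sequentially)
  then show ?thesis by (intro that[of "real k"]) auto
qed

text \<open>What is left of the equation at time i/N when the Ito integral is replaced by its
  left-point sum.\<close>

definition riemann_error :: "nat \<Rightarrow> nat \<Rightarrow> 'a \<Rightarrow> real" where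
  "riemann_error N i w = X (real i / real N) w - x0 - real i / real N
     - (\<Sum>j<i. 2 * sqrt (X (real j / real N) w) * dW N j w)"

lemma dW_measurable[measurable]: "dW N j \<in> borel_measurable M"
  unfolding dW_def[abs_def] by measurable

lemma riemann_error_measurable[measurable]: "riemann_error N i \<in> borel_measurable M"
  unfolding riemann_error_def[abs_def] by measurable

text \<open>Left-point sums are simple integrals whose integrands converge to \<open>H\<close> in L2
  along continuous paths. The distance on the interval up to i/N is at most that on
  \<open>{0..1}\<close>, so one N serves every i. The quantifier over i stands outside the
  probability, so no maximal inequality is required.\<close>

lemma riemann_error_small:
  assumes "\<kappa> > 0"
  shows "\<forall>\<^sub>F N in sequentially. \<forall>i\<le>N. \<P>(w in M. \<kappa> < \<bar>riemann_error N i w\<bar>) \<le> \<kappa>"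
proof -
  obtain K where K: "K > 0" "prob (space M - bounded_paths K) \<le> \<kappa> / 4"
    using bounded_paths_likely[of "\<kappa> / 4"] assms by auto
  \<comment> \<open>Chosen so that 16 \<open>\<delta>\<close> / \<open>\<kappa>\<close>^2 =
    \<open>\<kappa>\<close>/4 in \<open>ito_integral_approx\<close>. The remaining 3/4 of
    \<open>\<kappa>\<close> go to \<open>A N\<close> (1/4) and to two uses of the complement of
    \<open>bounded_paths K\<close>.\<close>
  define \<delta> where "\<delta> = \<kappa> ^ 3 / 64"
  have \<delta>: "\<delta> > 0" "16 * \<delta> / \<kappa>\<^sup>2 \<le> \<kappa> / 4"
    using assms by (auto simp: \<delta>_def power2_eq_square power3_eq_cube)
  define \<tau> where "\<tau> N j = real j / real N" for N j :: nat
  \<comment> \<open>Simple integrands have to be bounded, hence the cut at K; it is inactive on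
    \<open>bounded_paths K\<close>.\<close>
  define \<xi> where "\<xi> N j w = (if \<bar>X (real j / real N) w\<bar> \<le> K then 2 * sqrt (X (real j / real N) w) else 0)"
    for N j :: nat and w
  define H where "H s w = 2 * sqrt (X s w)" for s w
  let ?S = "\<lambda>N. simple_process N (\<tau> N) (\<xi> N)"
  have simple: "simple_integrand M F N (\<tau> N) (\<xi> N)" for N
  proof -
    have "\<xi> N j \<in> borel_measurable (F (\<tau> N j))" for j
      unfolding \<xi>_def[abs_def] \<tau>_def using X_measurable_F[of "real j / real N" "real j / real N"] by measurable
    moreover have "\<bar>sqrt x\<bar> \<le> sqrt K" if "\<bar>x\<bar> \<le> K" for x
      using that real_sqrt_le_mono[of x K] real_sqrt_le_mono[of "- x" K]
      by (auto simp: real_sqrt_minus abs_if)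
    then have "\<bar>\<xi> N j w\<bar> \<le> 2 * sqrt K" for j w
      using K(1) by (auto simp: \<xi>_def abs_mult)
    ultimately show ?thesis
      unfolding simple_integrand_def by (auto simp: \<tau>_def divide_right_mono)
  qed
  have ito: "\<exists>J. has_ito_integral M F W H t J \<and> (AE w in M. X t w = x0 + t + J w)" if "0 \<le> t" for t
  proof -
    have "(LINT s:{0..t}|lborel. (1::real)) = t" using that by (simp add: set_lebesgue_integral_def)
    moreover have "\<exists>J. has_ito_integral M F W H t J \<and> (AE w in M. X t w = x0 + (LINT s:{0..t}|lborel. 1) + J w)"
      using sol that unfolding strong_solution_def H_def[abs_def] by blast
    ultimately show ?thesis by simp
  qed
  have H: "progressively_measurable F H" using ito[of 0] by (auto simp: has_ito_integral_def)
  have L[measurable]: "L2_dist_sq (?S N) H t \<in> borel_measurable M" if "0 \<le> t" for N t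
    by (intro L2_dist_sq_measurable simple_process_measurable simple progressively_measurable_M H that)
  define A where "A N = bounded_paths K \<inter> {w\<in>space M. ennreal \<delta> < L2_dist_sq (?S N) H 1 w}" for N
  have A[measurable]: "A N \<in> events" for N
    unfolding A_def by measurable
  have "AE w in M. \<forall>\<^sub>F N in sequentially. w \<notin> A N"
    using continuous_paths
  proof eventually_elim
    case (elim w)
    show ?case
    proof (cases "w \<in> bounded_paths K")
      case True
      have "continuous_on {0..1} (\<lambda>s. H s w)"
        unfolding H_def using elim by (intro continuous_intros) (auto elim!: continuous_on_subset)
      then have "uniformly_continuous_on {0..1} (\<lambda>s. H s w)"
        by (rule compact_uniformly_continuous) auto
      then obtain d where d: "d > 0" "\<And>s t. s \<in> {0..1} \<Longrightarrow> t \<in> {0..1} \<Longrightarrow> \<bar>s - t\<bar> < d \<Longrightarrow> \<bar>H s w - H t w\<bar> < sqrt \<delta>"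
        using \<delta>(1) unfolding uniformly_continuous_on_def dist_real_def by (metis real_sqrt_gt_0_iff)
      have "\<forall>\<^sub>F N in sequentially. 1 / d < real N"
        using filterlim_real_sequentially by (auto simp: filterlim_at_top_dense)
      then show ?thesis
      proof eventually_elim
        case (elim N)
        have "0 < 1 / d" using d(1) by simp
        also note elim
        finally have "0 < real N" .
        with elim d(1) have N: "0 < real N" "1 / real N < d"
          by (auto simp: field_simps)
        have "L2_dist_sq (?S N) H 1 w \<le> (\<integral>\<^sup>+s. ennreal \<delta> * indicator {0..1::real} s \<partial>lborel)"
          unfolding L2_dist_sq_def
        proof (rule nn_integral_mono_AE)
          \<comment> \<open>The intervals of a simple process are open on the left, so it vanishes
            at time 0 instead of being close to \<open>H\<close>.\<close>
          have "AE s in lborel. s \<noteq> (0::real)" by (rule AE_lborel_singleton)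
          then show "AE s in lborel. ennreal ((?S N s w - H s w)\<^sup>2) * indicator {0..1} s \<le> ennreal \<delta> * indicator {0..1} s"
          proof eventually_elim
            case (elim s)
            show ?case
            proof (cases "s \<in> {0..1}")
              case s: True
              \<comment> \<open>The index of the cell with k/N < s <= (k + 1)/N.\<close>
              define k where "k = nat (\<lceil>s * real N\<rceil> - 1)"
              have sN: "0 < s * real N" "s * real N \<le> real N" using s elim N by auto
              then have "\<lceil>s * real N\<rceil> \<ge> 1" by (simp add: one_le_ceiling)
              then have k1: "real k < s * real N" "s * real N \<le> real (Suc k)"
                unfolding k_def by linarith+
              have kN: "k < N" using k1 sN by linarith
              have ks: "real k / real N < s" "s \<le> real (Suc k) / real N" using k1 N by (auto simp: field_simps)
              have "indicator {\<tau> N j<..\<tau> N (Suc j)} s = (if j = k then 1 else 0 :: real)" for j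
              proof -
                have "\<tau> N j < s \<longleftrightarrow> real j < s * real N" "s \<le> \<tau> N (Suc j) \<longleftrightarrow> s * real N \<le> real (Suc j)"
                  using N by (auto simp: \<tau>_def field_simps)
                moreover have "real j < s * real N \<and> s * real N \<le> real (Suc j) \<longleftrightarrow> j = k"
                  using k1 by auto
                ultimately show ?thesis by (auto simp: indicator_def)
              qed
              then have "?S N s w = (\<Sum>j<N. if j = k then \<xi> N j w else 0)"
                unfolding simple_process_def by (intro sum.cong) auto
              also have "\<dots> = \<xi> N k w" using kN by simp
              also have "\<dots> = H (real k / real N) w"
                using bounded_pathsD(1)[OF True, of k N] kN by (simp add: \<xi>_def H_def)
              finally have eq: "?S N s w = H (real k / real N) w" .
              have "s - real k / real N \<le> 1 / real N" using ks by (simp add: add_divide_distrib)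
              then have "\<bar>real k / real N - s\<bar> < d" using ks N by auto
              then have "\<bar>?S N s w - H s w\<bar> < sqrt \<delta>"
                unfolding eq using s ks kN by (intro d(2)) auto
              then have "(?S N s w - H s w)\<^sup>2 \<le> (sqrt \<delta>)\<^sup>2"
                using \<delta>(1) by (subst abs_le_square_iff[symmetric]) auto
              then have "(?S N s w - H s w)\<^sup>2 \<le> \<delta>" using \<delta>(1) by simp
              then show ?thesis using s by (simp add: ennreal_leI)
            qed simp
          qed
        qed
        also have "\<dots> = ennreal \<delta>" by (simp add: nn_integral_cmult_indicator)
        finally show ?case by (simp add: A_def not_less)
      qed
    qed (simp add: A_def)
  qed
  then have "(\<lambda>N. prob (A N)) \<longlonglongrightarrow> 0" by (intro prob_tendsto_0 A)
  then have "\<forall>\<^sub>F N in sequentially. prob (A N) < \<kappa> / 4" using assms by (intro order_tendstoD) auto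
  then show ?thesis
    using eventually_gt_at_top[of 0]
  proof eventually_elim
    case (elim N)
    show ?case
    proof (intro allI impI)
      fix i assume i: "i \<le> N"
      let ?t = "real i / real N"
      obtain J where J: "has_ito_integral M F W H ?t J" "AE w in M. X ?t w = x0 + ?t + J w"
        using ito[of ?t] by auto
      have Jm[measurable]: "J \<in> borel_measurable M" using J(1) by (simp add: has_ito_integral_def)
      have t: "0 \<le> ?t" "?t \<le> 1" using i elim by auto
      let ?I = "simple_integral W N (\<tau> N) (\<xi> N) ?t"
      have [measurable]: "?I \<in> borel_measurable M" by (rule simple_integral_measurable[OF simple t(1)])
      have I: "?I w = (\<Sum>j<i. \<xi> N j w * dW N j w)" for w
      proof -
        have "min (\<tau> N j) ?t = (if j < i then \<tau> N j else ?t)" for j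
          using elim by (auto simp: \<tau>_def min_def divide_le_cancel)
        moreover have "min (\<tau> N (Suc j)) ?t = (if j < i then \<tau> N (Suc j) else ?t)" for j
          using elim by (auto simp: \<tau>_def min_def divide_le_cancel)
        ultimately have "?I w = (\<Sum>j<N. if j \<in> {..<i} then \<xi> N j w * dW N j w else 0)"
          unfolding simple_integral_def by (intro sum.cong) (auto simp: dW_def \<tau>_def)
        also have "\<dots> = (\<Sum>j<i. \<xi> N j w * dW N j w)"
          using i by (subst sum.inter_restrict[symmetric]) (auto intro!: sum.cong)
        finally show ?thesis .
      qed
      have Lmono: "L2_dist_sq (?S N) H ?t w \<le> L2_dist_sq (?S N) H 1 w" for w
        unfolding L2_dist_sq_def using t by (intro nn_integral_mono) (auto simp: indicator_def)
      have "\<P>(w in M. ennreal \<delta> < L2_dist_sq (?S N) H ?t w) \<le> prob (A N \<union> (space M - bounded_paths K))"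
        by (intro finite_measure_mono) (auto simp: A_def intro: less_le_trans[OF _ Lmono])
      also have "\<dots> \<le> prob (A N) + prob (space M - bounded_paths K)"
        by (intro measure_Un_le) auto
      finally have 1: "\<P>(w in M. ennreal \<delta> < L2_dist_sq (?S N) H ?t w) \<le> \<kappa> / 2"
        using elim(1) K(2) by simp
      have 2: "\<P>(w in M. \<kappa> < \<bar>J w - ?I w\<bar>) \<le> 16 * \<delta> / \<kappa>\<^sup>2 + \<P>(w in M. ennreal \<delta> < L2_dist_sq (?S N) H ?t w)"
        using ito_integral_approx[OF J(1) simple t(1) assms \<delta>(1)] .
      have "\<P>(w in M. \<kappa> < \<bar>riemann_error N i w\<bar>) \<le> prob ({w\<in>space M. \<kappa> < \<bar>J w - ?I w\<bar>} \<union> (space M - bounded_paths K))"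
      proof (rule finite_measure_mono_AE)
        show "AE w in M. w \<in> {w\<in>space M. \<kappa> < \<bar>riemann_error N i w\<bar>} \<longrightarrow>
          w \<in> {w\<in>space M. \<kappa> < \<bar>J w - ?I w\<bar>} \<union> (space M - bounded_paths K)"
          using J(2)
        proof eventually_elim
          case (elim w)
          have "riemann_error N i w = J w - ?I w" if "w \<in> bounded_paths K"
          proof -
            have "\<xi> N j w = 2 * sqrt (X (real j / real N) w)" if "j < i" for j
              using bounded_pathsD(1)[OF \<open>w \<in> bounded_paths K\<close>, of j N] that i by (simp add: \<xi>_def)
            then show ?thesis using elim by (simp add: riemann_error_def I)
          qed
          then show ?case by auto
        qed
      qed measurable
      also have "\<dots> \<le> \<P>(w in M. \<kappa> < \<bar>J w - ?I w\<bar>) + prob (space M - bounded_paths K)"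
        by (intro measure_Un_le) auto
      finally show "\<P>(w in M. \<kappa> < \<bar>riemann_error N i w\<bar>) \<le> \<kappa>"
        using 1 2 K(2) \<delta>(2) by linarith
    qed
  qed
qed

end

section \<open>The discrete reflection\<close>

context sde
begin

fun reflected :: "nat \<Rightarrow> nat \<Rightarrow> 'a \<Rightarrow> real" where
  "reflected N 0 w = sqrt x0"
| "reflected N (Suc i) w = max 0 (reflected N i w + dW N i w)"

lemma reflected_nonneg: "0 \<le> reflected N i w"
  using x0 by (cases i) auto

lemma dW_measurable_F: "Suc j \<le> i \<Longrightarrow> dW N j \<in> borel_measurable (F (real i / real N))"
  unfolding dW_def[abs_def] by (intro borel_measurable_diff W_measurable_F) (auto intro!: divide_right_mono)

lemma reflected_measurable_F: "i \<le> k \<Longrightarrow> reflected N i \<in> borel_measurable (F (real k / real N))"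
proof (induction i)
  case 0
  have "reflected N 0 = (\<lambda>w. sqrt x0)" by (rule ext) simp
  then show ?case by simp
next
  case (Suc i)
  have "reflected N (Suc i) = (\<lambda>w. max 0 (reflected N i w + dW N i w))" by (rule ext) simp
  moreover have "reflected N i \<in> borel_measurable (F (real k / real N))"
    "dW N i \<in> borel_measurable (F (real k / real N))"
    using Suc by (auto intro: dW_measurable_F)
  ultimately show ?case by simp
qed

lemma reflected_measurable[measurable]: "reflected N i \<in> borel_measurable M"
  by (rule measurable_F_imp_M[OF reflected_measurable_F[OF order_refl]])

text \<open>The discrete Skorokhod formula; the induction step is a pointwise identity between
  \<open>max\<close> and \<open>min\<close>. \<open>W 0 w = 0\<close> appears as a hypothesis
  because it is given only almost surely.\<close>

lemma reflected_eq:
  assumes "W 0 w = 0"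
  shows "reflected N i w = W (real i / real N) w + sqrt x0 + neg_part ((MIN k\<in>{0..i}. W (real k / real N) w) + sqrt x0)"
proof (induction i)
  case 0
  then show ?case using assms x0 by (simp add: neg_part_def)
next
  case (Suc i)
  let ?W = "\<lambda>k. W (real k / real N) w"
  have "(MIN k\<in>{0..Suc i}. ?W k) = min (?W (Suc i)) (MIN k\<in>{0..i}. ?W k)"
    by (simp add: atLeast0_atMost_Suc)
  moreover have "max 0 (a + sqrt x0 + neg_part (m + sqrt x0) + (b - a)) = b + sqrt x0 + neg_part (min b m + sqrt x0)" for a b m :: real
    by (simp add: neg_part_def min_def max_def)
  ultimately show ?case
    by (simp only: reflected.simps Suc dW_def)
qed

lemma X_hat_eq:
  assumes "W 0 w = 0" "N > 0"
  shows "X_hat W x0 N w = (reflected N N w)\<^sup>2"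
  using assms by (simp add: X_hat_def reflected_eq)

lemma reflected_le:
  assumes "w \<in> bounded_paths K" "i \<le> N" "W 0 w = 0"
  shows "reflected N i w \<le> sqrt x0 + 2 * K"
proof -
  let ?W = "\<lambda>k. W (real k / real N) w"
  have "- K \<le> ?W k" if "k \<le> i" for k
    using bounded_pathsD(2)[OF assms(1), of k N] assms(2) that by auto
  then have "- K \<le> (MIN k\<in>{0..i}. ?W k)"
    by (subst Min_ge_iff) auto
  moreover have "\<bar>?W i\<bar> \<le> K" by (rule bounded_pathsD(2)[OF assms(1,2)])
  moreover have "sqrt x0 \<ge> 0" using x0 by simp
  ultimately show ?thesis unfolding reflected_eq[OF assms(3)] neg_part_def by linarith
qed

section \<open>The square of the reflected walk\<close>

definition reflected_error :: "nat \<Rightarrow> nat \<Rightarrow> 'a \<Rightarrow> real" where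
  "reflected_error N i w = (reflected N i w)\<^sup>2 - x0 - real i / real N
     - (\<Sum>j<i. 2 * reflected N j w * dW N j w)"

lemma reflected_error_measurable[measurable]: "reflected_error N i \<in> borel_measurable M"
  unfolding reflected_error_def[abs_def] by measurable

text \<open>The increment of the regulator in the Skorokhod decomposition, a discrete local time at
  0: what the maximum with 0 adds to the free step.\<close>

definition push :: "nat \<Rightarrow> nat \<Rightarrow> 'a \<Rightarrow> real" where
  "push N j w = max 0 (- (reflected N j w + dW N j w))"

lemma push_measurable[measurable]: "push N i \<in> borel_measurable M"
  unfolding push_def[abs_def] by measurable

lemma push_bounds: "0 \<le> push N j w" "push N j w \<le> \<bar>dW N j w\<bar>"
  using reflected_nonneg[of N j w] by (auto simp: push_def)

lemma sum_push: "(\<Sum>j<i. push N j w) = reflected N i w - sqrt x0 - (W (real i / real N) w - W 0 w)"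
proof (induction i)
  case (Suc i)
  have "push N i w = reflected N (Suc i) w - reflected N i w - dW N i w" by (simp add: push_def)
  with Suc show ?case by (simp add: dW_def)
qed simp

text \<open>For every real z, (max 0 z)^2 = z^2 - (max 0 (-z))^2. The squared free step provides the
  martingale term and the quadratic variation, so only squared pushes are lost: the discrete trace
  of the fact that local time grows only at 0.\<close>

lemma reflected_error_eq:
  assumes "N > 0"
  shows "reflected_error N i w = (\<Sum>j<i. (dW N j w)\<^sup>2 - 1 / real N) - (\<Sum>j<i. (push N j w)\<^sup>2)"
proof (induction i)
  case 0
  then show ?case using x0 by (simp add: reflected_error_def)
next
  case (Suc i)
  have "(reflected N (Suc i) w)\<^sup>2 = (reflected N i w + dW N i w)\<^sup>2 - (push N i w)\<^sup>2"
    by (cases "0 \<le> reflected N i w + dW N i w") (simp_all add: push_def power2_eq_square algebra_simps)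
  then show ?case using Suc by (simp add: reflected_error_def power2_sum add_divide_distrib)
qed

lemma dW_normal:
  assumes "N > 0"
  shows "centered_normal (sqrt (1 / real N)) (dW N j)"
  unfolding dW_def[abs_def] using gaussian_walk.normal[OF gaussian_walk_increments[OF assms, of "Suc j"], of j] by simp

text \<open>The summands are centered, orthogonal and of variance 3/N^2 - 1/N^2 = 2/N^2; Chebyshev
  concludes.\<close>

lemma quadratic_variation_small:
  assumes "N > 0" "\<kappa> > 0"
  shows "\<P>(w in M. \<kappa> < \<bar>\<Sum>j<i. (dW N j w)\<^sup>2 - 1 / real N\<bar>) \<le> 2 * real i / (real N)\<^sup>2 / \<kappa>\<^sup>2"
proof -
  define Q where "Q i w = (\<Sum>j<i. (dW N j w)\<^sup>2 - 1 / real N)" for i w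
  have s: "sqrt (1 / real N) > 0" using assms by simp
  have s4: "sqrt (1 / real N) ^ 4 = 1 / (real N)\<^sup>2"
    using power_mult[of "sqrt (1 / real N)" 2 2] by (simp add: power_divide)
  define g where "g = (\<lambda>x::real. x\<^sup>2 - 1 / real N)"
  have Qi: "Q i \<in> borel_measurable (F (real i / real N)) \<and> integrable M (\<lambda>w. (Q i w)\<^sup>2) \<and>
    expectation (\<lambda>w. (Q i w)\<^sup>2) = 2 * real i / (real N)\<^sup>2" for i
  proof (induction i)
    case 0
    then show ?case by (simp add: Q_def)
  next
    case (Suc i)
    note mom = centered_normal_moments[OF s dW_normal[OF assms(1), of i]]
    have lt: "0 \<le> real i / real N" "real i / real N < real (Suc i) / real N"
      using assms by (auto intro: divide_strict_right_mono)
    have gi: "integrable M (\<lambda>w. g (dW N i w))" "expectation (\<lambda>w. g (dW N i w)) = 0"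
      using mom assms by (simp_all add: g_def prob_space)
    have sq: "(g x)\<^sup>2 = x ^ 4 - 2 / real N * x\<^sup>2 + 1 / (real N)\<^sup>2" for x
      by (simp add: g_def power2_diff power_divide flip: power_mult)
    have gi2: "integrable M (\<lambda>w. (g (dW N i w))\<^sup>2)" "expectation (\<lambda>w. (g (dW N i w))\<^sup>2) = 2 / (real N)\<^sup>2"
      unfolding sq using mom assms by (simp_all add: prob_space s4 power2_eq_square)
    have QM: "Q i \<in> borel_measurable M" using Suc measurable_F_imp_M by blast
    have Qint: "integrable M (Q i)" using square_integrable_imp_integrable[OF QM] Suc by blast
    have gm: "g \<in> borel_measurable borel" by (simp add: g_def)
    have i1: "integrable M (\<lambda>w. Q i w * g (dW N i w))" "expectation (\<lambda>w. Q i w * g (dW N i w)) = 0"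
      using integrable_mult_increment[OF lt _ Qint gm gi(1)[unfolded dW_def]]
        expectation_mult_increment[OF lt _ Qint gm gi(1)[unfolded dW_def]] Suc gi(2)
      by (simp_all add: dW_def)
    have step: "Q (Suc i) w = Q i w + g (dW N i w)" for w by (simp add: Q_def g_def)
    have expand: "(Q (Suc i) w)\<^sup>2 = (Q i w)\<^sup>2 + 2 * (Q i w * g (dW N i w)) + (g (dW N i w))\<^sup>2" for w
      unfolding step by (simp add: power2_sum)
    have "Q i \<in> borel_measurable (F (real (Suc i) / real N))"
      using Suc lt by (auto intro: measurable_F_mono less_imp_le)
    moreover have "(\<lambda>w. g (dW N i w)) \<in> borel_measurable (F (real (Suc i) / real N))"
      by (rule measurable_compose[OF dW_measurable_F gm]) simp
    ultimately have "Q (Suc i) \<in> borel_measurable (F (real (Suc i) / real N))"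
      unfolding step[abs_def] by (rule borel_measurable_add)
    then show ?case
      unfolding expand using Suc i1 gi2 by (simp add: add_divide_distrib)
  qed
  have [measurable]: "Q i \<in> borel_measurable M" using Qi measurable_F_imp_M by blast
  have "\<P>(w in M. \<kappa> < \<bar>Q i w\<bar>) \<le> \<P>(w in M. \<kappa>\<^sup>2 \<le> (Q i w)\<^sup>2)"
    using assms(2) by (intro finite_measure_mono) (auto simp: abs_le_square_iff[symmetric])
  also have "\<dots> \<le> expectation (\<lambda>w. (Q i w)\<^sup>2) / \<kappa>\<^sup>2"
    using integral_Markov_inequality_measure[OF Qi[of i, THEN conjunct2, THEN conjunct1], of "{}" "\<kappa>\<^sup>2"] assms(2)
    by simp
  finally show ?thesis using Qi[of i] by (simp add: Q_def)
qed

lemma max_increment_small: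
  assumes "N > 0" "\<eta> > 0"
  shows "\<P>(w in M. \<exists>j<N. \<eta> < \<bar>dW N j w\<bar>) \<le> 6 / (real N * \<eta> ^ 4)"
proof -
  have s: "sqrt (1 / real N) > 0" using assms by simp
  have s4: "sqrt (1 / real N) ^ 4 = 1 / (real N)\<^sup>2"
    using power_mult[of "sqrt (1 / real N)" 2 2] by (simp add: power_divide)
  have "\<P>(w in M. \<exists>j<N. \<eta> < \<bar>dW N j w\<bar>) \<le> prob (\<Union>j<N. {w\<in>space M. dW N j w > \<eta>} \<union> {w\<in>space M. - dW N j w > \<eta>})"
    by (intro finite_measure_mono) auto
  also have "\<dots> \<le> (\<Sum>j<N. prob ({w\<in>space M. dW N j w > \<eta>} \<union> {w\<in>space M. - dW N j w > \<eta>}))"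
    by (intro finite_measure_subadditive_finite) auto
  also have "\<dots> \<le> (\<Sum>j<N. 6 / (real N)\<^sup>2 / \<eta> ^ 4)"
  proof (intro sum_mono)
    fix j
    have "prob ({w\<in>space M. dW N j w > \<eta>} \<union> {w\<in>space M. - dW N j w > \<eta>})
      \<le> \<P>(w in M. dW N j w > \<eta>) + \<P>(w in M. - dW N j w > \<eta>)"
      by (intro measure_Un_le) measurable
    also have "\<dots> \<le> 3 * sqrt (1 / real N) ^ 4 / \<eta> ^ 4 + 3 * sqrt (1 / real N) ^ 4 / \<eta> ^ 4"
      by (intro add_mono centered_normal_fourth_tail centered_normal_uminus dW_normal s assms)
    finally show "prob ({w\<in>space M. dW N j w > \<eta>} \<union> {w\<in>space M. - dW N j w > \<eta>}) \<le> 6 / (real N)\<^sup>2 / \<eta> ^ 4"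
      unfolding s4 by (simp add: mult.commute)
  qed
  also have "\<dots> = 6 / (real N * \<eta> ^ 4)"
    using assms by (simp add: power2_eq_square)
  finally show ?thesis .
qed

text \<open>The quadratic variation is handled by Chebyshev. The squared pushes are at most the
  largest step times the total push, and the total push is bounded on \<open>bounded_paths K\<close>
  because it telescopes.\<close>

lemma reflected_error_small:
  assumes "\<kappa> > 0"
  shows "\<forall>\<^sub>F N in sequentially. \<forall>i\<le>N. \<P>(w in M. \<kappa> < \<bar>reflected_error N i w\<bar>) \<le> \<kappa>"
proof -
  obtain K where K: "K > 0" "prob (space M - bounded_paths K) \<le> \<kappa> / 4"
    using bounded_paths_likely[of "\<kappa> / 4"] assms by auto
  \<comment> \<open>With the total push at most 4K, this makes the squared pushes sum to at most
    \<open>\<kappa>\<close>/2.\<close>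
  define \<eta> where "\<eta> = \<kappa> / (8 * K)"
  have \<eta>: "\<eta> > 0" using assms K by (simp add: \<eta>_def)
  have lim: "(\<lambda>N. 6 / (real N * \<eta> ^ 4)) \<longlonglongrightarrow> 0" "(\<lambda>N. 2 / real N / (\<kappa> / 2)\<^sup>2) \<longlonglongrightarrow> 0"
    using \<eta> assms by real_asymp+
  have "\<kappa> / 4 > 0" using assms by simp
  from order_tendstoD(2)[OF lim(1) this] order_tendstoD(2)[OF lim(2) this]
  have "\<forall>\<^sub>F N in sequentially. 6 / (real N * \<eta> ^ 4) < \<kappa> / 4" "\<forall>\<^sub>F N in sequentially. 2 / real N / (\<kappa> / 2)\<^sup>2 < \<kappa> / 4" .
  then show ?thesis
    using eventually_gt_at_top[of 0]
  proof eventually_elim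
    case (elim N)
    show ?case
    proof (intro allI impI)
      fix i assume i: "i \<le> N"
      let ?Q = "{w\<in>space M. \<kappa> / 2 < \<bar>\<Sum>j<i. (dW N j w)\<^sup>2 - 1 / real N\<bar>}"
      let ?D = "{w\<in>space M. \<exists>j<N. \<eta> < \<bar>dW N j w\<bar>}"
      have "\<P>(w in M. \<kappa> < \<bar>reflected_error N i w\<bar>) \<le> prob (?Q \<union> (?D \<union> (space M - bounded_paths K)))"
      proof (rule finite_measure_mono_AE)
        show "AE w in M. w \<in> {w\<in>space M. \<kappa> < \<bar>reflected_error N i w\<bar>} \<longrightarrow> w \<in> ?Q \<union> (?D \<union> (space M - bounded_paths K))"
          using W_0
        proof eventually_elim
          case W0: (elim w)
          show ?case
          proof (rule ccontr)
            assume "\<not> ?thesis"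
            then have *: "w \<in> space M" "\<kappa> < \<bar>reflected_error N i w\<bar>" "w \<in> bounded_paths K"
              "\<bar>\<Sum>j<i. (dW N j w)\<^sup>2 - 1 / real N\<bar> \<le> \<kappa> / 2" "\<forall>j<N. \<bar>dW N j w\<bar> \<le> \<eta>" by (auto simp: not_less) (metis not_le)
            have "(\<Sum>j<i. (push N j w)\<^sup>2) \<le> (\<Sum>j<i. \<eta> * push N j w)"
              unfolding power2_eq_square
            proof (intro sum_mono mult_right_mono)
              fix j assume "j \<in> {..<i}"
              then show "push N j w \<le> \<eta>"
                using push_bounds(2)[of N j w] *(5)[rule_format, of j] i by simp
            qed (rule push_bounds)
            also have "\<dots> = \<eta> * (\<Sum>j<i. push N j w)" by (simp add: sum_distrib_left)
            also have "\<dots> \<le> \<eta> * (4 * K)"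
              using reflected_le[OF *(3) i W0] bounded_pathsD(2)[OF *(3) i] \<eta> K(1) unfolding sum_push W0
              by (intro mult_left_mono) auto
            also have "\<dots> = \<kappa> / 2" using K(1) by (simp add: \<eta>_def)
            finally have "\<bar>reflected_error N i w\<bar> \<le> \<kappa>"
              using *(4) sum_nonneg[of "{..<i}" "\<lambda>j. (push N j w)\<^sup>2"] elim(3) by (simp add: reflected_error_eq)
            with *(2) show False by simp
          qed
        qed
      qed measurable
      also have "\<dots> \<le> prob ?Q + prob (?D \<union> (space M - bounded_paths K))"
        by (rule measure_Un_le) measurable
      also have "prob (?D \<union> (space M - bounded_paths K)) \<le> prob ?D + prob (space M - bounded_paths K)"
        by (rule measure_Un_le) measurable
      also have "prob ?D \<le> 6 / (real N * \<eta> ^ 4)" by (rule max_increment_small[OF elim(3) \<eta>])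
      also have "prob ?Q \<le> 2 * real i / (real N)\<^sup>2 / (\<kappa> / 2)\<^sup>2"
        by (rule quadratic_variation_small[OF elim(3)]) (use assms in simp)
      also have "\<dots> \<le> 2 * real N / (real N)\<^sup>2 / (\<kappa> / 2)\<^sup>2"
        using i by (intro divide_right_mono) auto
      also have "\<dots> = 2 / real N / (\<kappa> / 2)\<^sup>2" using elim(3) by (simp add: power2_eq_square)
      finally have "\<P>(w in M. \<kappa> < \<bar>reflected_error N i w\<bar>)
        \<le> 2 / real N / (\<kappa> / 2)\<^sup>2 + (6 / (real N * \<eta> ^ 4) + prob (space M - bounded_paths K))" by simp
      then show "\<P>(w in M. \<kappa> < \<bar>reflected_error N i w\<bar>) \<le> \<kappa>"
        using elim(1,2) K(2) assms by linarith
    qed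
  qed
qed

end

section \<open>The Yamada--Watanabe test function\<close>

text \<open>
  \<open>yw L\<close> has second derivative \<open>1 / sqrt (x\<^sup>2 + 1 / L\<^sup>2)\<close>, hence \<open>\<bar>x\<bar> * yw'' x \<le> 1\<close>, although
  \<open>yw L x\<close> tends to infinity with \<open>L\<close> for every \<open>x \<noteq> 0\<close>.
\<close>
definition yw :: "real \<Rightarrow> real \<Rightarrow> real" where
  "yw L x = x * arsinh (L * x) - sqrt ((L * x)\<^sup>2 + 1) / L + 1 / L"

definition yw'' :: "real \<Rightarrow> real \<Rightarrow> real" where
  "yw'' L x = L / sqrt ((L * x)\<^sup>2 + 1)"

lemma sqrt_pos: "sqrt ((y::real)\<^sup>2 + 1) > 0" "sqrt (y\<^sup>2 + 1) \<ge> 1" "\<bar>y\<bar> \<le> sqrt (y\<^sup>2 + 1)"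
proof -
  have "y\<^sup>2 + 1 > 0" by (rule add_nonneg_pos) auto
  then show "sqrt (y\<^sup>2 + 1) > 0" by simp
  show "sqrt (y\<^sup>2 + 1) \<ge> 1" by simp
  show "\<bar>y\<bar> \<le> sqrt (y\<^sup>2 + 1)" by (rule real_le_rsqrt) simp
qed

lemma arsinh_scaled_deriv: "((\<lambda>x. arsinh (L * x)) has_field_derivative yw'' L x) (at x)"
proof -
  have "((\<lambda>x. arsinh (L * x)) has_field_derivative 1 / sqrt ((L * x)\<^sup>2 + 1) * L) (at x)"
    by (rule DERIV_chain2[OF arsinh_real_has_field_derivative]) (auto intro!: derivative_eq_intros)
  then show ?thesis by (simp add: yw''_def)
qed

lemma yw_deriv:
  assumes "L > 0"
  shows "(yw L has_field_derivative arsinh (L * x)) (at x)"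
proof -
  have pos: "(L * x)\<^sup>2 + 1 > 0" using sqrt_pos(1)[of "L * x"] by simp
  have "((\<lambda>x. x * arsinh (L * x) - sqrt ((L * x)\<^sup>2 + 1) / L + 1 / L) has_field_derivative
    (1 * arsinh (L * x) + yw'' L x * x - (inverse (sqrt ((L * x)\<^sup>2 + 1)) / 2 * (2 * (L * x) * L)) / L + 0)) (at x)"
    using assms pos by (auto intro!: derivative_eq_intros arsinh_scaled_deriv)
  then show ?thesis
    unfolding yw_def[abs_def] using assms by (simp add: yw''_def field_simps)
qed

lemma yw''_deriv:
  "(yw'' L has_field_derivative - (L ^ 3 * x) / (sqrt ((L * x)\<^sup>2 + 1)) ^ 3) (at x)"
proof -
  let ?r = "sqrt ((L * x)\<^sup>2 + 1)"
  have pos: "(L * x)\<^sup>2 + 1 > 0" "?r > 0" using sqrt_pos(1)[of "L * x"] by simp_all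
  have "((\<lambda>x. L / sqrt ((L * x)\<^sup>2 + 1)) has_field_derivative
    (0 * ?r - L * (inverse ?r / 2 * (2 * (L * x) * L))) / (?r * ?r)) (at x)"
    using pos by (auto intro!: derivative_eq_intros)
  moreover have "(0 * ?r - L * (inverse ?r / 2 * (2 * (L * x) * L))) / (?r * ?r) = - (L ^ 3 * x) / ?r ^ 3"
    using pos by (simp add: field_simps power3_eq_cube)
  ultimately show ?thesis unfolding yw''_def[abs_def] by simp
qed

lemma yw''_bounds:
  assumes "L > 0"
  shows "0 \<le> yw'' L x" "yw'' L x \<le> L" "yw'' L x * \<bar>x\<bar> \<le> 1"
proof -
  note pos = sqrt_pos[of "L * x"]
  show "0 \<le> yw'' L x" using assms pos by (simp add: yw''_def)
  show "yw'' L x \<le> L" using assms pos by (simp add: yw''_def divide_le_eq mult_left_le_one_le mult_le_cancel_left1)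
  have "L * \<bar>x\<bar> \<le> sqrt ((L * x)\<^sup>2 + 1)" using pos(3) assms by (simp add: abs_mult)
  then show "yw'' L x * \<bar>x\<bar> \<le> 1" using pos(1) by (simp add: yw''_def divide_le_eq)
qed

lemma yw'''_bound:
  assumes "L > 0"
  shows "\<bar>- (L ^ 3 * x) / (sqrt ((L * x)\<^sup>2 + 1)) ^ 3\<bar> \<le> L\<^sup>2"
proof -
  let ?r = "sqrt ((L * x)\<^sup>2 + 1)"
  note pos = sqrt_pos[of "L * x"]
  have "?r * 1 \<le> ?r ^ 3" using pos(2) by (simp add: self_le_power)
  with pos(3) have "\<bar>L * x\<bar> \<le> ?r ^ 3" by simp
  then have "L\<^sup>2 * \<bar>L * x\<bar> \<le> L\<^sup>2 * ?r ^ 3" by (intro mult_left_mono) auto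
  then show ?thesis
    using pos(1) assms by (simp add: abs_mult divide_le_eq power2_eq_square power3_eq_cube)
qed

text \<open>The increments to be inserted are multiples of Gaussian ones and hence unbounded, so the
  remainder rests on a global bound of the third derivative. An upper bound suffices, since only
  expectations are estimated from above.\<close>

lemma yw_taylor:
  assumes "L > 0"
  shows "yw L (x + y) \<le> yw L x + arsinh (L * x) * y + yw'' L x / 2 * y\<^sup>2 + L\<^sup>2 / 6 * \<bar>y\<bar> ^ 3"
proof (cases "y = 0")
  case False
  define diff where "diff m = (if m = 0 then yw L else if m = 1 then (\<lambda>x. arsinh (L * x)) else if m = 2 then yw'' L
    else (\<lambda>x. - (L ^ 3 * x) / (sqrt ((L * x)\<^sup>2 + 1)) ^ 3))" for m :: nat
  have "\<forall>m t. m < 3 \<and> x - \<bar>y\<bar> \<le> t \<and> t \<le> x + \<bar>y\<bar> \<longrightarrow> (diff m has_field_derivative diff (Suc m) t) (at t)"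
    using yw_deriv[OF assms] arsinh_scaled_deriv[of L] yw''_deriv[of L]
    by (auto simp: diff_def less_Suc_eq numeral_3_eq_3 numeral_2_eq_2)
  then have "\<exists>t. (if x + y < x then x + y < t \<and> t < x else x < t \<and> t < x + y) \<and>
    yw L (x + y) = (\<Sum>m<3. diff m x / fact m * (x + y - x) ^ m) + diff 3 t / fact 3 * (x + y - x) ^ 3"
    by (intro Taylor[of 3 diff "yw L" "x - \<bar>y\<bar>" "x + \<bar>y\<bar>" x "x + y"])
      (use False in \<open>simp_all add: diff_def del: fact_numeral\<close>)
  then obtain t where t: "yw L (x + y) = (\<Sum>m<3. diff m x / fact m * (x + y - x) ^ m) + diff 3 t / fact 3 * (x + y - x) ^ 3"
    by blast
  have "\<bar>diff 3 t\<bar> \<le> L\<^sup>2" using yw'''_bound[OF assms, of t] by (simp add: diff_def)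
  then have "\<bar>diff 3 t\<bar> * \<bar>y ^ 3\<bar> \<le> L\<^sup>2 * \<bar>y ^ 3\<bar>" by (rule mult_right_mono) simp
  then have "diff 3 t / fact 3 * y ^ 3 \<le> L\<^sup>2 / 6 * \<bar>y\<bar> ^ 3"
    using abs_ge_self[of "diff 3 t * y ^ 3"] by (simp add: abs_mult power_abs fact_numeral)
  moreover have "(\<Sum>m<3. diff m x / fact m * (x + y - x) ^ m) = yw L x + arsinh (L * x) * y + yw'' L x / 2 * y\<^sup>2"
    by (simp add: diff_def numeral_3_eq_3 numeral_2_eq_2 power2_eq_square)
  ultimately show ?thesis using t by simp
qed simp

lemma arsinh_abs_le:
  fixes x :: real
  assumes "L > 0"
  shows "\<bar>arsinh (L * x)\<bar> \<le> L * \<bar>x\<bar>"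
proof -
  have "\<bar>arsinh (L * x) - arsinh (L * 0)\<bar> \<le> L * \<bar>x - 0\<bar>"
    using field_differentiable_bound[of UNIV "\<lambda>x. arsinh (L * x)" "yw'' L" L x 0]
      arsinh_scaled_deriv[of L] yw''_bounds[OF assms] by auto
  then show ?thesis by simp
qed

lemma yw_mono:
  assumes "L > 0" "0 \<le> x" "x \<le> y"
  shows "yw L x \<le> yw L y"
proof (rule DERIV_nonneg_imp_nondecreasing[OF assms(3)])
  fix z assume "x \<le> z" "z \<le> y"
  then have "\<not> arsinh (L * z) < 0" using assms by (simp add: not_less)
  then have "0 \<le> arsinh (L * z)" by (rule leI)
  then show "\<exists>d. (yw L has_field_derivative d) (at z) \<and> 0 \<le> d" using yw_deriv[OF assms(1)] by blast
qed

text \<open>The summand 1/L in \<open>yw\<close> is there for this normalisation, which starts the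
  recursion for the expectations at 0.\<close>

lemma yw_0 [simp]: "yw L 0 = 0"
  by (simp add: yw_def)

lemma yw_abs: "yw L \<bar>x\<bar> = yw L x"
  by (auto simp: yw_def abs_if)

lemma yw_nonneg: "L > 0 \<Longrightarrow> 0 \<le> yw L x"
  using yw_mono[of L 0 "\<bar>x\<bar>"] by (simp add: yw_abs)

text \<open>Quadratic growth makes the test function integrable along a square-integrable
  transform.\<close>

lemma yw_le: "L > 0 \<Longrightarrow> yw L x \<le> L * x\<^sup>2"
proof -
  assume L: "L > 0"
  have "yw L x \<le> x * arsinh (L * x)"
    using sqrt_pos(2)[of "L * x"] L by (simp add: yw_def divide_right_mono)
  also have "\<dots> \<le> \<bar>x\<bar> * \<bar>arsinh (L * x)\<bar>" by (metis abs_ge_self abs_mult)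
  also have "\<dots> \<le> \<bar>x\<bar> * (L * \<bar>x\<bar>)" by (intro mult_left_mono arsinh_abs_le L) auto
  finally show ?thesis by (simp add: power2_eq_square mult.left_commute)
qed

lemma yw_measurable[measurable]: "L > 0 \<Longrightarrow> yw L \<in> borel_measurable borel"
  by (auto intro!: borel_measurable_continuous_onI continuous_at_imp_continuous_on intro: DERIV_isCont yw_deriv)

text \<open>From sqrt(y^2 + 1) <= y + 1 one gets \<open>yw L \<eta>\<close> >= \<open>\<eta>\<close>
  (arsinh(L \<open>\<eta>\<close>) - 1). This divergence at a fixed distance is what converts a
  bound on the expectation that does not grow with L into a small probability.\<close>

lemma yw_tendsto:
  assumes "\<eta> > 0"
  shows "filterlim (\<lambda>L. yw L \<eta>) at_top at_top"
proof (rule filterlim_at_top_mono)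
  have "filterlim (\<lambda>L. arsinh (L * \<eta>)) at_top at_top"
    by (rule filterlim_compose[OF arsinh_real_at_top]) (use assms in real_asymp)
  then show "filterlim (\<lambda>L. \<eta> * (- 1 + arsinh (L * \<eta>))) at_top at_top"
    using assms by (intro filterlim_tendsto_pos_mult_at_top[OF tendsto_const] filterlim_tendsto_add_at_top[OF tendsto_const])
  show "\<forall>\<^sub>F L in at_top. \<eta> * (- 1 + arsinh (L * \<eta>)) \<le> yw L \<eta>"
    using eventually_gt_at_top[of 0]
  proof eventually_elim
    case (elim L)
    have "sqrt ((L * \<eta>)\<^sup>2 + 1) \<le> L * \<eta> + 1"
      using elim assms by (intro real_le_lsqrt) (auto simp: power2_sum)
    then have "sqrt ((L * \<eta>)\<^sup>2 + 1) / L \<le> (L * \<eta> + 1) / L" using elim by (intro divide_right_mono) auto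
    then show ?case using elim by (simp add: yw_def add_divide_distrib right_diff_distrib)
  qed
qed

section \<open>The solution is the reflected path\<close>

context sde
begin

section \<open>The martingale transform that drives X - U^2\<close>

definition gap :: "nat \<Rightarrow> nat \<Rightarrow> 'a \<Rightarrow> real" where
  "gap N j w = 2 * (sqrt (X (real j / real N) w) - reflected N j w)"

text \<open>The coefficient is switched off for good once some |gap| exceeds K. It stays bounded and
  adapted, and since the test covers all earlier indices, passing it at j guarantees that no earlier
  coefficient was truncated.\<close>

definition gap' :: "real \<Rightarrow> nat \<Rightarrow> nat \<Rightarrow> 'a \<Rightarrow> real" where
  "gap' K N j w = (if \<forall>k\<le>j. \<bar>gap N k w\<bar> \<le> K then gap N j w else 0)"

definition V :: "real \<Rightarrow> nat \<Rightarrow> nat \<Rightarrow> 'a \<Rightarrow> real" where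
  "V K N i w = (\<Sum>j<i. gap' K N j w * dW N j w)"

definition total_error :: "nat \<Rightarrow> nat \<Rightarrow> 'a \<Rightarrow> real" where
  "total_error N i w = riemann_error N i w - reflected_error N i w"

lemma total_error_measurable[measurable]: "total_error N i \<in> borel_measurable M"
  unfolding total_error_def[abs_def] by measurable

lemma gap_measurable_F: "j \<le> k \<Longrightarrow> gap N j \<in> borel_measurable (F (real k / real N))"
  using X_measurable_F[of "real j / real N" "real k / real N"] reflected_measurable_F[of j k N]
  unfolding gap_def[abs_def] by (auto simp: divide_right_mono)

lemma gap'_measurable_F: "gap' K N j \<in> borel_measurable (F (real j / real N))"
proof -
  let ?F = "F (real j / real N)"
  have g: "gap N k \<in> borel_measurable ?F" if "k \<le> j" for k using that by (rule gap_measurable_F)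
  have "{w\<in>space ?F. \<forall>k\<in>{..j}. \<bar>gap N k w\<bar> \<le> K} \<in> sets ?F"
  proof (rule sets.sets_Collect_finite_All')
    fix k assume "k \<in> {..j}"
    then have [measurable]: "gap N k \<in> borel_measurable ?F" using g by simp
    show "{w\<in>space ?F. \<bar>gap N k w\<bar> \<le> K} \<in> sets ?F" by measurable
  qed auto
  then have "{w\<in>space ?F. \<forall>k\<le>j. \<bar>gap N k w\<bar> \<le> K} \<in> sets ?F"
    by (simp only: Ball_def atMost_iff)
  then show ?thesis
    unfolding gap'_def[abs_def] by (rule measurable_If[OF g[OF order_refl] borel_measurable_const])
qed

lemma gap'_bound: "K \<ge> 0 \<Longrightarrow> \<bar>gap' K N j w\<bar> \<le> K"
  by (auto simp: gap'_def)

lemma gap'_measurable[measurable]: "gap' K N j \<in> borel_measurable M"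
  by (rule measurable_F_imp_M[OF gap'_measurable_F])

lemma V_isometry:
  assumes "K \<ge> 0" "N > 0"
  shows "V K N i \<in> borel_measurable (F (real i / real N))" "integrable M (\<lambda>w. (V K N i w)\<^sup>2)"
  using simple_sum_isometry[of "\<lambda>j. real j / real N" i "gap' K N" K i] gap'_measurable_F gap'_bound[OF assms(1)]
  by (simp_all add: V_def[abs_def] dW_def divide_right_mono)

text \<open>The Yamada--Watanabe cancellation. While nothing is truncated, X - U^2 equals
  \<open>V\<close> plus \<open>total_error\<close>, the squared gap is at most 4 |X - U^2|, and
  \<open>yw''\<close> at \<open>V\<close> times |\<open>V\<close>| is at most 1. Where the error is
  large, the crude bound L K^2 is used, to be paid for by the small probability of that
  event.\<close>

lemma gap'_sq_le:
  assumes L: "L > 0" and K: "K \<ge> 0" and N: "N > 0" and \<kappa>: "\<kappa> \<ge> 0" and nonneg: "\<forall>t\<ge>0. X t w \<ge> 0"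
  shows "yw'' L (V K N i w) * (gap' K N i w)\<^sup>2 \<le> 4 + 4 * L * \<kappa> + L * K\<^sup>2 * indicator {w. \<kappa> < \<bar>total_error N i w\<bar>} w"
proof (cases "\<forall>k\<le>i. \<bar>gap N k w\<bar> \<le> K")
  case False
  then show ?thesis using L K \<kappa> by (auto simp: gap'_def intro!: add_nonneg_nonneg mult_nonneg_nonneg)
next
  case True
  let ?y = "yw'' L (V K N i w)"
  note b = yw''_bounds[OF L, of "V K N i w"]
  have g: "gap' K N i w = gap N i w" using True by (simp add: gap'_def)
  show ?thesis
  proof (cases "\<kappa> < \<bar>total_error N i w\<bar>")
    case big: True
    have "(gap N i w)\<^sup>2 \<le> K\<^sup>2" using True K by (subst abs_le_square_iff[symmetric]) auto
    then have "?y * (gap N i w)\<^sup>2 \<le> L * K\<^sup>2" using b by (intro mult_mono) auto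
    moreover have "0 \<le> 4 * L * \<kappa>" using L \<kappa> by simp
    ultimately show ?thesis using big by (simp add: g)
  next
    case small: False
    let ?x = "X (real i / real N) w" and ?u = "reflected N i w"
    have "V K N i w = (\<Sum>j<i. gap N j w * dW N j w)"
      using True by (auto simp: V_def gap'_def intro!: sum.cong)
    also have "\<dots> = ?x - ?u\<^sup>2 - total_error N i w"
      by (simp add: gap_def total_error_def riemann_error_def reflected_error_def sum_subtractf algebra_simps)
    finally have V: "?x - ?u\<^sup>2 = V K N i w + total_error N i w" by simp
    have x: "?x \<ge> 0" "sqrt ?x \<ge> 0" "?u \<ge> 0" using nonneg reflected_nonneg by simp_all
    have "(sqrt ?x - ?u)\<^sup>2 = \<bar>sqrt ?x - ?u\<bar> * \<bar>sqrt ?x - ?u\<bar>" by (simp add: power2_eq_square)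
    \<comment> \<open>Both roots are nonnegative, so their difference is dominated by their
      sum.\<close>
    also have "\<dots> \<le> \<bar>sqrt ?x - ?u\<bar> * (sqrt ?x + ?u)" by (intro mult_left_mono; use x in linarith)
    also have "\<dots> = \<bar>(sqrt ?x - ?u) * (sqrt ?x + ?u)\<bar>" using x by (simp add: abs_mult)
    also have "(sqrt ?x - ?u) * (sqrt ?x + ?u) = ?x - ?u\<^sup>2"
      using x by (simp add: algebra_simps power2_eq_square)
    also have "\<bar>?x - ?u\<^sup>2\<bar> \<le> \<bar>V K N i w\<bar> + \<kappa>" unfolding V using small by linarith
    finally have "(gap N i w)\<^sup>2 \<le> 4 * (\<bar>V K N i w\<bar> + \<kappa>)" unfolding gap_def power_mult_distrib by simp
    then have "?y * (gap N i w)\<^sup>2 \<le> ?y * (4 * (\<bar>V K N i w\<bar> + \<kappa>))" using b by (intro mult_left_mono) auto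
    also have "\<dots> = 4 * (?y * \<bar>V K N i w\<bar>) + 4 * \<kappa> * ?y" by (simp add: algebra_simps)
    also have "\<dots> \<le> 4 * 1 + 4 * \<kappa> * L" using b \<kappa> by (intro add_mono mult_left_mono) auto
    finally show ?thesis using small by (simp add: g mult.commute mult.left_commute)
  qed
qed

text \<open>Expansion of (h - |x|)^2 x^2 >= 0. It trades the absolute third moment for even moments;
  with h the standard deviation, both terms have mean of order h^3.\<close>

lemma abs_cube_le:
  fixes x h :: real
  assumes "h > 0"
  shows "\<bar>x\<bar> ^ 3 \<le> (h * x\<^sup>2 + x ^ 4 / h) / 2"
proof -
  have "0 \<le> (h - \<bar>x\<bar>)\<^sup>2 * x\<^sup>2" by simp
  also have "\<dots> = h\<^sup>2 * x\<^sup>2 + x ^ 4 - 2 * h * \<bar>x\<bar> ^ 3"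
    by (auto simp: power2_eq_square power3_eq_cube power4_eq_xxxx algebra_simps abs_if)
  finally have "2 * h * \<bar>x\<bar> ^ 3 \<le> h * (h * x\<^sup>2 + x ^ 4 / h)"
    using assms by (simp add: power2_eq_square algebra_simps)
  then show ?thesis using assms by (simp add: mult.assoc mult_le_cancel_left_pos)
qed

lemma yw_integrable:
  assumes L: "L > 0" and K: "K \<ge> 0" and N: "N > 0"
  shows "integrable M (\<lambda>w. yw L (V K N i w))"
proof (rule Bochner_Integration.integrable_bound)
  show "integrable M (\<lambda>w. L * (V K N i w)\<^sup>2)" using V_isometry(2)[OF K N] by simp
  have "V K N i \<in> borel_measurable M" by (rule measurable_F_imp_M[OF V_isometry(1)[OF K N]])
  then show "(\<lambda>w. yw L (V K N i w)) \<in> borel_measurable M"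
    by (rule measurable_compose[OF _ yw_measurable[OF L]])
  show "AE w in M. norm (yw L (V K N i w)) \<le> norm (L * (V K N i w)\<^sup>2)"
    using yw_nonneg[OF L] yw_le[OF L] L by auto
qed

text \<open>Taylor expansion at \<open>V K N i\<close>: the first-order term has mean 0, the
  second-order term is controlled by \<open>gap'_sq_le\<close> times the variance 1/N, and the cubic
  remainder is of order N^(-3/2), hence negligible after N steps.\<close>

lemma yw_step:
  assumes L: "L > 0" and K: "K \<ge> 0" and N: "N > 0" and \<kappa>: "\<kappa> \<ge> 0"
    and err: "\<P>(w in M. \<kappa> < \<bar>total_error N i w\<bar>) \<le> \<kappa>"
  shows "expectation (\<lambda>w. yw L (V K N (Suc i) w)) \<le> expectation (\<lambda>w. yw L (V K N i w))
    + (4 + 4 * L * \<kappa> + L * K\<^sup>2 * \<kappa>) / (2 * real N) + L\<^sup>2 * K ^ 3 / (3 * real N * sqrt (real N))"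
proof -
  let ?V = "V K N i" and ?g = "gap' K N i" and ?D = "dW N i"
  define h where "h = sqrt (1 / real N)"
  have h: "h > 0" "h\<^sup>2 = 1 / real N" using N by (simp_all add: h_def)
  note mom = centered_normal_moments[OF h(1)[unfolded h_def] dW_normal[OF N, of i], folded h_def]
  have lt: "0 \<le> real i / real N" "real i / real N < real (Suc i) / real N"
    using N by (auto intro: divide_strict_right_mono)
  note Vm = V_isometry(1)[OF K N, of i] and gm = gap'_measurable_F[of K N i]
  have VM[measurable]: "?V \<in> borel_measurable M" by (rule measurable_F_imp_M[OF Vm])
  have Vi: "integrable M ?V" by (rule square_integrable_imp_integrable[OF VM V_isometry(2)[OF K N]])
  define a where "a w = arsinh (L * ?V w) * ?g w" for w
  define b where "b w = yw'' L (?V w) / 2 * (?g w)\<^sup>2" for w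
  have arsm: "(\<lambda>x. arsinh (L * x)) \<in> borel_measurable borel" "yw'' L \<in> borel_measurable borel"
    using arsinh_scaled_deriv[of L] yw''_deriv[of L]
    by (auto intro!: borel_measurable_continuous_onI continuous_at_imp_continuous_on DERIV_isCont)
  have am: "a \<in> borel_measurable (F (real i / real N))" and bm: "b \<in> borel_measurable (F (real i / real N))"
    unfolding a_def[abs_def] b_def[abs_def]
    using gm measurable_compose[OF Vm arsm(1)] measurable_compose[OF Vm arsm(2)]
    by (auto intro!: borel_measurable_times borel_measurable_power borel_measurable_divide)
  have aM[measurable]: "a \<in> borel_measurable M" and bM[measurable]: "b \<in> borel_measurable M"
    using am bm by (auto intro: measurable_F_imp_M)
  have ai: "integrable M a"
  proof (rule Bochner_Integration.integrable_bound[where f="\<lambda>w. L * K * ?V w"])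
    show "AE w in M. norm (a w) \<le> norm (L * K * ?V w)"
    proof (rule AE_I2)
      fix w
      have "\<bar>arsinh (L * ?V w)\<bar> * \<bar>?g w\<bar> \<le> (L * \<bar>?V w\<bar>) * K"
        using L K by (intro mult_mono arsinh_abs_le gap'_bound) auto
      then show "norm (a w) \<le> norm (L * K * ?V w)" using L K by (simp add: a_def abs_mult ac_simps)
    qed
  qed (use Vi in auto)
  have bbound: "0 \<le> b w" "b w \<le> L * K\<^sup>2" for w
  proof -
    have "(?g w)\<^sup>2 \<le> K\<^sup>2" using gap'_bound[OF K, of N i w] K by (subst abs_le_square_iff[symmetric]) auto
    then have "yw'' L (?V w) / 2 * (?g w)\<^sup>2 \<le> L * K\<^sup>2"
      using yw''_bounds[OF L, of "?V w"] L by (intro mult_mono) auto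
    then show "b w \<le> L * K\<^sup>2" by (simp add: b_def)
    show "0 \<le> b w" using yw''_bounds[OF L, of "?V w"] by (simp add: b_def)
  qed
  have bi: "integrable M b" by (rule integrable_const_bound[of _ "L * K\<^sup>2"]) (use bbound in auto)
  have i1: "integrable M (\<lambda>w. a w * ?D w)" "expectation (\<lambda>w. a w * ?D w) = 0"
  proof -
    have D: "integrable M (\<lambda>w. W (real (Suc i) / real N) w - W (real i / real N) w)"
      using mom(1) unfolding dW_def[abs_def] .
    show "integrable M (\<lambda>w. a w * ?D w)"
      unfolding dW_def by (rule integrable_mult_increment[OF lt am ai, of "\<lambda>x. x"]) (simp, rule D)
    have "expectation (\<lambda>w. a w * ?D w) = expectation a * expectation (\<lambda>w. ?D w)"
      unfolding dW_def by (rule expectation_mult_increment[OF lt am ai, of "\<lambda>x. x"]) (simp, rule D)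
    then show "expectation (\<lambda>w. a w * ?D w) = 0" using mom(2) by simp
  qed
  have i2: "integrable M (\<lambda>w. b w * (?D w)\<^sup>2)" "expectation (\<lambda>w. b w * (?D w)\<^sup>2) = expectation b * (1 / real N)"
  proof -
    have D: "integrable M (\<lambda>w. (W (real (Suc i) / real N) w - W (real i / real N) w)\<^sup>2)"
      using mom(3) unfolding dW_def .
    show "integrable M (\<lambda>w. b w * (?D w)\<^sup>2)"
      unfolding dW_def by (rule integrable_mult_increment[OF lt bm bi, of "\<lambda>x. x\<^sup>2"]) (simp, rule D)
    have "expectation (\<lambda>w. b w * (?D w)\<^sup>2) = expectation b * expectation (\<lambda>w. (?D w)\<^sup>2)"
      unfolding dW_def by (rule expectation_mult_increment[OF lt bm bi, of "\<lambda>x. x\<^sup>2"]) (simp, rule D)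
    then show "expectation (\<lambda>w. b w * (?D w)\<^sup>2) = expectation b * (1 / real N)" using mom(4) h(2) by simp
  qed
  \<comment> \<open>The Taylor constant L^2/6, the truncation K^3 and the factor 1/2 of
    \<open>abs_cube_le\<close>.\<close>
  define c where "c = L\<^sup>2 * K ^ 3 / 12"
  have c: "c \<ge> 0" using K by (simp add: c_def)
  have i3: "integrable M (\<lambda>w. c * (h * (?D w)\<^sup>2 + ?D w ^ 4 / h))" using mom by simp
  have e3: "expectation (\<lambda>w. c * (h * (?D w)\<^sup>2 + ?D w ^ 4 / h)) = c * (4 * h ^ 3)"
  proof -
    have "expectation (\<lambda>w. c * (h * (?D w)\<^sup>2 + ?D w ^ 4 / h)) = c * (h * h\<^sup>2 + 3 * h ^ 4 / h)"
      using mom(3,5) by (simp add: mom(4,6))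
    also have "\<dots> = c * (4 * h ^ 3)" using h(1) by (simp add: power2_eq_square power3_eq_cube power4_eq_xxxx)
    finally show ?thesis .
  qed
  have pw: "yw L (V K N (Suc i) w) \<le> yw L (?V w) + a w * ?D w + b w * (?D w)\<^sup>2 + c * (h * (?D w)\<^sup>2 + ?D w ^ 4 / h)" for w
  proof -
    have "V K N (Suc i) w = ?V w + ?g w * ?D w" by (simp add: V_def)
    then have "yw L (V K N (Suc i) w) \<le> yw L (?V w) + arsinh (L * ?V w) * (?g w * ?D w)
      + yw'' L (?V w) / 2 * (?g w * ?D w)\<^sup>2 + L\<^sup>2 / 6 * \<bar>?g w * ?D w\<bar> ^ 3"
      using yw_taylor[OF L] by simp
    also have "L\<^sup>2 / 6 * \<bar>?g w * ?D w\<bar> ^ 3 \<le> L\<^sup>2 / 6 * (K ^ 3 * ((h * (?D w)\<^sup>2 + ?D w ^ 4 / h) / 2))"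
      unfolding abs_mult power_mult_distrib using K gap'_bound[OF K]
      by (intro mult_left_mono mult_mono power_mono abs_cube_le h) auto
    finally show ?thesis by (simp add: a_def b_def c_def power_mult_distrib mult.assoc)
  qed
  have "expectation (\<lambda>w. yw L (V K N (Suc i) w))
    \<le> expectation (\<lambda>w. yw L (?V w) + a w * ?D w + b w * (?D w)\<^sup>2 + c * (h * (?D w)\<^sup>2 + ?D w ^ 4 / h))"
    by (intro integral_mono pw yw_integrable L K N Bochner_Integration.integrable_add i1 i2 i3)
  also have "\<dots> = expectation (\<lambda>w. yw L (?V w)) + expectation b * (1 / real N) + c * (4 * h ^ 3)"
    using i1 i2 i3 e3 yw_integrable[OF L K N, of i] by simp
  also have "expectation b \<le> (4 + 4 * L * \<kappa> + L * K\<^sup>2 * \<kappa>) / 2"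
  proof -
    let ?E = "{w\<in>space M. \<kappa> < \<bar>total_error N i w\<bar>}"
    have indi: "integrable M (indicat_real ?E)"
      by (rule integrable_real_indicator) (simp_all add: emeasure_eq_measure)
    have "expectation b \<le> expectation (\<lambda>w. (4 + 4 * L * \<kappa>) / 2 + L * K\<^sup>2 / 2 * indicator ?E w)"
    proof (rule integral_mono_AE[OF bi])
      show "AE w in M. b w \<le> (4 + 4 * L * \<kappa>) / 2 + L * K\<^sup>2 / 2 * indicator ?E w"
        using X_nonneg AE_space
      proof eventually_elim
        case (elim w)
        then show ?case using gap'_sq_le[OF L K N \<kappa> elim(1), of i] by (simp add: b_def indicator_def field_simps)
      qed
      show "integrable M (\<lambda>w. (4 + 4 * L * \<kappa>) / 2 + L * K\<^sup>2 / 2 * indicat_real ?E w)"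
        by (intro Bochner_Integration.integrable_add integrable_mult_right integrable_const indi)
    qed
    also have "\<dots> = (4 + 4 * L * \<kappa>) / 2 + L * K\<^sup>2 / 2 * prob ?E"
      by (subst Bochner_Integration.integral_add[OF integrable_const integrable_mult_right[OF indi]])
        (simp add: prob_space)
    also have "\<dots> \<le> (4 + 4 * L * \<kappa>) / 2 + L * K\<^sup>2 / 2 * \<kappa>"
      using err L by (intro add_left_mono mult_left_mono) auto
    finally show ?thesis by (simp add: add_divide_distrib)
  qed
  finally have "expectation (\<lambda>w. yw L (V K N (Suc i) w)) \<le> expectation (\<lambda>w. yw L (?V w))
     + (4 + 4 * L * \<kappa> + L * K\<^sup>2 * \<kappa>) / 2 * (1 / real N) + c * (4 * h ^ 3)"
    by (simp add: mult_right_mono divide_right_mono)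
  moreover have "h ^ 3 = 1 / (real N * sqrt (real N))"
    using h(2) by (simp add: power3_eq_cube power2_eq_square h_def real_sqrt_divide)
  ultimately show ?thesis by (simp add: c_def ac_simps)
qed

text \<open>The parameters are chosen in the order K0, K, L, \<open>\<epsilon>\<close>, N. Summing
  \<open>yw_step\<close> bounds the expected test function by 3 independently of L, while its value
  at \<open>\<kappa>\<close>/2 is as large as desired; Markov's inequality then makes
  \<open>V K N N\<close> small.\<close>

lemma X_hat_tendsto_in_prob:
  assumes "\<kappa> > 0"
  shows "\<forall>\<^sub>F N in sequentially. \<P>(w in M. \<kappa> < \<bar>X 1 w - X_hat W x0 N w\<bar>) \<le> \<kappa>"
proof -
  obtain K0 where K0: "K0 > 0" "prob (space M - bounded_paths K0) \<le> \<kappa> / 4"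
    using bounded_paths_likely[of "\<kappa> / 4"] assms by auto
  \<comment> \<open>On \<open>bounded_paths K0\<close> no gap exceeds this level, so the truncation
    never acts there.\<close>
  define K where "K = 2 * sqrt K0 + 2 * (sqrt x0 + 2 * K0)"
  have K: "K \<ge> 0" using K0 x0 by (simp add: K_def)
  \<comment> \<open>The expectation will be at most 5/2 from the second-order terms plus 1/2 from
    the remainders; 3 divided by 12/\<open>\<kappa>\<close> is \<open>\<kappa>\<close>/4.\<close>
  have "\<forall>\<^sub>F L in at_top. 12 / \<kappa> \<le> yw L (\<kappa> / 2)"
    using yw_tendsto[of "\<kappa> / 2"] assms unfolding filterlim_at_top by simp
  then have "\<forall>\<^sub>F L in at_top. 12 / \<kappa> \<le> yw L (\<kappa> / 2) \<and> L > 0"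
    by (intro eventually_conj eventually_gt_at_top)
  then obtain L where L: "L > 0" "12 / \<kappa> \<le> yw L (\<kappa> / 2)" by (auto simp: eventually_at_top_linorder)
  \<comment> \<open>The second entry makes 4 L \<open>\<epsilon>\<close> + L K^2
    \<open>\<epsilon>\<close> at most 1, so that the numerator 4 in \<open>yw_step\<close> grows at
    most to 5.\<close>
  define \<epsilon> where "\<epsilon> = min (\<kappa> / 4) (1 / (4 * L + L * K\<^sup>2))"
  have LK: "4 * L + L * K\<^sup>2 > 0" using L by (simp add: add_pos_nonneg)
  have \<epsilon>: "\<epsilon> > 0" "\<epsilon> \<le> \<kappa> / 4" using assms LK by (simp_all add: \<epsilon>_def)
  have "\<epsilon> * (4 * L + L * K\<^sup>2) \<le> 1 / (4 * L + L * K\<^sup>2) * (4 * L + L * K\<^sup>2)"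
    using LK by (intro mult_right_mono) (auto simp: \<epsilon>_def)
  then have \<epsilon>L: "4 + 4 * L * \<epsilon> + L * K\<^sup>2 * \<epsilon> \<le> 5" using LK by (simp add: algebra_simps)
  have lim: "(\<lambda>N. L\<^sup>2 * K ^ 3 / (3 * sqrt (real N))) \<longlonglongrightarrow> 0" by real_asymp
  have half: "\<epsilon> / 2 > 0" using \<epsilon> by simp
  show ?thesis
    using riemann_error_small[OF half] reflected_error_small[OF half] order_tendstoD(2)[OF lim, of "1/2", OF half_gt_zero[OF zero_less_one]]
      eventually_gt_at_top[of 0]
  proof eventually_elim
    case (elim N)
    then have N: "N > 0" by simp
    have err: "\<P>(w in M. \<epsilon> < \<bar>total_error N i w\<bar>) \<le> \<epsilon>" if "i \<le> N" for i
    proof -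
      have "\<P>(w in M. \<epsilon> < \<bar>total_error N i w\<bar>)
        \<le> prob ({w\<in>space M. \<epsilon> / 2 < \<bar>riemann_error N i w\<bar>} \<union> {w\<in>space M. \<epsilon> / 2 < \<bar>reflected_error N i w\<bar>})"
        by (rule finite_measure_mono) (auto simp: total_error_def)
      also have "\<dots> \<le> \<P>(w in M. \<epsilon> / 2 < \<bar>riemann_error N i w\<bar>) + \<P>(w in M. \<epsilon> / 2 < \<bar>reflected_error N i w\<bar>)"
        by (rule measure_Un_le) measurable
      also have "\<dots> \<le> \<epsilon> / 2 + \<epsilon> / 2" using elim(1,2) that by (intro add_mono) auto
      finally show ?thesis by simp
    qed
    define \<Delta> where "\<Delta> = 5 / (2 * real N) + L\<^sup>2 * K ^ 3 / (3 * real N * sqrt (real N))"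
    have "expectation (\<lambda>w. yw L (V K N i w)) \<le> real i * \<Delta>" if "i \<le> N" for i
      using that
    proof (induction i)
      case (Suc i)
      have "expectation (\<lambda>w. yw L (V K N (Suc i) w)) \<le> expectation (\<lambda>w. yw L (V K N i w))
        + (4 + 4 * L * \<epsilon> + L * K\<^sup>2 * \<epsilon>) / (2 * real N) + L\<^sup>2 * K ^ 3 / (3 * real N * sqrt (real N))"
        using Suc \<epsilon> by (intro yw_step L K N err) auto
      also have "\<dots> \<le> real i * \<Delta> + 5 / (2 * real N) + L\<^sup>2 * K ^ 3 / (3 * real N * sqrt (real N))"
        using Suc \<epsilon>L by (intro add_mono divide_right_mono) auto
      also have "\<dots> = real (Suc i) * \<Delta>" by (simp add: \<Delta>_def distrib_right)
      finally show ?case .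
    qed (simp add: V_def)
    from this[of N] have "expectation (\<lambda>w. yw L (V K N N w)) \<le> real N * \<Delta>" by simp
    also have "\<dots> = 5 / 2 + L\<^sup>2 * K ^ 3 / (3 * sqrt (real N))" using N by (simp add: \<Delta>_def distrib_left)
    also have "\<dots> \<le> 3" using elim(3) by simp
    finally have Ele: "expectation (\<lambda>w. yw L (V K N N w)) \<le> 3" .
    have VM[measurable]: "V K N N \<in> borel_measurable M" by (rule measurable_F_imp_M[OF V_isometry(1)[OF K N]])
    have yw0: "yw L (\<kappa> / 2) > 0" using L(2) assms by (intro less_le_trans[OF _ L(2)]) simp
    have "\<P>(w in M. \<kappa> / 2 < \<bar>V K N N w\<bar>) \<le> \<P>(w in M. yw L (\<kappa> / 2) \<le> yw L (V K N N w))"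
    proof (rule finite_measure_mono)
      show "{w\<in>space M. \<kappa> / 2 < \<bar>V K N N w\<bar>} \<subseteq> {w\<in>space M. yw L (\<kappa> / 2) \<le> yw L (V K N N w)}"
        using yw_mono[OF L(1), of "\<kappa> / 2" "\<bar>V K N N _\<bar>"] assms by (auto simp: yw_abs)
      have "(\<lambda>w. yw L (V K N N w)) \<in> borel_measurable M"
        by (rule measurable_compose[OF VM yw_measurable[OF L(1)]])
      then show "{w\<in>space M. yw L (\<kappa> / 2) \<le> yw L (V K N N w)} \<in> events" by measurable
    qed
    also have "\<dots> \<le> expectation (\<lambda>w. yw L (V K N N w)) / yw L (\<kappa> / 2)"
      using integral_Markov_inequality_measure[OF yw_integrable[OF L(1) K N, of N], of "{}" "yw L (\<kappa> / 2)"]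
        yw_nonneg[OF L(1)] yw0 by simp
    also have "\<dots> \<le> 3 / (12 / \<kappa>)" using Ele L(2) assms by (intro frac_le) auto
    finally have PV: "\<P>(w in M. \<kappa> / 2 < \<bar>V K N N w\<bar>) \<le> \<kappa> / 4" using assms by simp
    have "\<P>(w in M. \<kappa> < \<bar>X 1 w - X_hat W x0 N w\<bar>)
      \<le> prob ({w\<in>space M. \<kappa> / 2 < \<bar>V K N N w\<bar>} \<union> ({w\<in>space M. \<epsilon> < \<bar>total_error N N w\<bar>} \<union> (space M - bounded_paths K0)))"
    proof (rule finite_measure_mono_AE)
      show "AE w in M. w \<in> {w\<in>space M. \<kappa> < \<bar>X 1 w - X_hat W x0 N w\<bar>} \<longrightarrow>
        w \<in> {w\<in>space M. \<kappa> / 2 < \<bar>V K N N w\<bar>} \<union> ({w\<in>space M. \<epsilon> < \<bar>total_error N N w\<bar>} \<union> (space M - bounded_paths K0))"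
        using W_0 X_nonneg
      proof eventually_elim
        case (elim w)
        show ?case
        proof (rule impI, rule ccontr)
          assume A: "w \<in> {w\<in>space M. \<kappa> < \<bar>X 1 w - X_hat W x0 N w\<bar>}"
            and B: "w \<notin> {w\<in>space M. \<kappa> / 2 < \<bar>V K N N w\<bar>} \<union> ({w\<in>space M. \<epsilon> < \<bar>total_error N N w\<bar>} \<union> (space M - bounded_paths K0))"
          then have bp: "w \<in> bounded_paths K0" by auto
          have "\<bar>gap N k w\<bar> \<le> K" if "k \<le> N" for k
          proof -
            have "X (real k / real N) w \<ge> 0" using elim(2) by simp
            moreover have "sqrt (X (real k / real N) w) \<le> sqrt K0"
              using bounded_pathsD(1)[OF bp that] by simp
            moreover have "0 \<le> sqrt (X (real k / real N) w)" "0 \<le> sqrt K0" using elim(2) K0 by simp_all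
            moreover have "\<bar>2 * (a - u)\<bar> \<le> 2 * c + 2 * d" if "0 \<le> a" "a \<le> c" "0 \<le> u" "u \<le> d" for a c d u :: real
              using that by (simp add: abs_le_iff)
            ultimately show ?thesis
              using reflected_le[OF bp that elim(1)] reflected_nonneg[of N k w] unfolding gap_def K_def by blast
          qed
          then have "V K N N w = (\<Sum>j<N. gap N j w * dW N j w)"
            by (auto simp: V_def gap'_def intro!: sum.cong)
          also have "\<dots> = X 1 w - X_hat W x0 N w - total_error N N w"
            using N X_hat_eq[OF elim(1) N]
            by (simp add: gap_def total_error_def riemann_error_def reflected_error_def sum_subtractf algebra_simps)
          finally have "V K N N w = X 1 w - X_hat W x0 N w - total_error N N w" .
          then have "\<bar>X 1 w - X_hat W x0 N w\<bar> \<le> \<bar>V K N N w\<bar> + \<bar>total_error N N w\<bar>"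
            using abs_triangle_ineq[of "V K N N w" "total_error N N w"] by simp
          moreover have "\<kappa> < \<bar>X 1 w - X_hat W x0 N w\<bar>" "\<bar>V K N N w\<bar> \<le> \<kappa> / 2" "\<bar>total_error N N w\<bar> \<le> \<epsilon>"
            using A B by simp_all
          ultimately show False using \<epsilon> by argo
        qed
      qed
    qed measurable
    also have "\<dots> \<le> \<P>(w in M. \<kappa> / 2 < \<bar>V K N N w\<bar>) + prob ({w\<in>space M. \<epsilon> < \<bar>total_error N N w\<bar>} \<union> (space M - bounded_paths K0))"
      by (rule measure_Un_le) measurable
    also have "prob ({w\<in>space M. \<epsilon> < \<bar>total_error N N w\<bar>} \<union> (space M - bounded_paths K0))
      \<le> \<P>(w in M. \<epsilon> < \<bar>total_error N N w\<bar>) + prob (space M - bounded_paths K0)"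
      by (rule measure_Un_le) measurable
    finally show "\<P>(w in M. \<kappa> < \<bar>X 1 w - X_hat W x0 N w\<bar>) \<le> \<kappa>"
      using PV err[of N] K0(2) \<epsilon>(2) assms by simp
  qed
qed

end

section \<open>Exponential moments of the maximum of a Gaussian walk\<close>

lemma exp_minus_nat_le: "exp (- real i) \<le> (1 / 2) ^ i"
proof -
  have "exp (-1) \<le> 1 / (2::real)"
    using exp_ge_add_one_self[of 1] by (simp add: exp_minus field_simps)
  then have "exp (-1) ^ i \<le> (1 / 2 :: real) ^ i" by (intro power_mono) auto
  moreover have "exp (- real i) = exp (-1) ^ i" using exp_of_nat_mult[of i "-1"] by simp
  ultimately show ?thesis by simp
qed

lemma ennreal_le_suminf:
  fixes f :: "nat \<Rightarrow> ennreal"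
  shows "f i \<le> (\<Sum>i. f i)"
  using sum_le_suminf[of f "{i}"] by simp

lemma nat_ceiling_bounds:
  assumes "(m::real) \<ge> 0"
  shows "m \<le> real (nat \<lceil>m\<rceil>)" "real (nat \<lceil>m\<rceil>) < m + 1"
  using assms by linarith+

context gaussian_walk
begin

text \<open>Covers the three variants used below: sign change, time reversal and restriction to a
  shifted block.\<close>

lemma walk_reindex:
  assumes f: "inj_on f {..<N'}" "f ` {..<N'} \<subseteq> {..<N}" and c: "\<bar>c\<bar> = 1"
  shows "gaussian_walk M (\<lambda>j w. c * \<xi> (f j) w) N' s"
proof
  have "indep_vars (\<lambda>j. PiM {f j} (\<lambda>_. borel)) (\<lambda>j w. restrict (\<lambda>i. \<xi> i w) {f j}) {..<N'}"
    using f by (intro indep_vars_restrict[OF indep]) (auto simp: disjoint_family_on_def inj_on_def)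
  then have "indep_vars (\<lambda>_. borel) (\<lambda>j w. (\<lambda>g. c * g (f j)) (restrict (\<lambda>i. \<xi> i w) {f j})) {..<N'}"
    by (rule indep_vars_compose2) simp
  then show "indep_vars (\<lambda>_. borel) (\<lambda>j w. c * \<xi> (f j) w) {..<N'}" by simp
  fix j assume "j < N'"
  then have "f j < N" using f by auto
  from normal[OF this] have "centered_normal (\<bar>c\<bar> * s) (\<lambda>w. 0 + c * \<xi> (f j) w)"
    using normal_density_affine[of "\<xi> (f j)" 0 s c 0] s_pos c by auto
  then show "centered_normal s (\<lambda>w. c * \<xi> (f j) w)" using c by simp
qed (rule s_pos)

lemma max_nonneg: "0 \<le> Max ((\<lambda>k. S k w) ` {..N})"
  by (rule Max_ge) (auto simp: S_def intro: image_eqI[of _ _ 0])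

text \<open>Decomposition into integer levels of the normalised maximum. The Chernoff parameter 5
  beats the weight 4: the i-th term is 2 exp(4i + 25/2 - 5(i - 1)) = 2 exp(35/2) exp(-i). The weight
  4 is the coefficient of the oscillation in \<open>exp_grid_gap_le\<close>.\<close>

lemma nn_integral_exp_max:
  assumes "N > 0"
  shows "(\<integral>\<^sup>+w. ennreal (exp (4 * (Max ((\<lambda>k. S k w) ` {..N}) / (s * sqrt N)))) \<partial>M) \<le> ennreal (4 * exp (35 / 2))"
proof -
  define t where "t = s * sqrt N"
  have t: "t > 0" using s_pos assms by (simp add: t_def)
  let ?m = "\<lambda>w. Max ((\<lambda>k. S k w) ` {..N}) / t"
  have SN: "centered_normal t (S N)"
    using sum_normal[of "{..<N}"] assms by (auto simp: S_def[abs_def] t_def)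
  let ?A = "\<lambda>i. {w\<in>space M. \<exists>k\<le>N. S k w > t * (real i - 1)}"
  have A: "?A i \<in> events" for i unfolding Union_first_passage[symmetric] by auto
  have P: "prob (?A i) \<le> 2 * exp (25 / 2 - 5 * (real i - 1))" for i
    using prob_max_le[of "t * (real i - 1)"] centered_normal_exp_tail[OF t SN, of 5 "t * (real i - 1)"] t
    by simp
  have "(\<integral>\<^sup>+w. ennreal (exp (4 * ?m w)) \<partial>M) \<le> (\<integral>\<^sup>+w. (\<Sum>i. ennreal (exp (4 * real i)) * indicator (?A i) w) \<partial>M)"
  proof (rule nn_integral_mono)
    fix w assume wM: "w \<in> space M"
    define i where "i = nat \<lceil>?m w\<rceil>"
    have m: "?m w \<ge> 0" using max_nonneg[of w] t by simp
    note i = nat_ceiling_bounds[OF m, folded i_def]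
    have "Max ((\<lambda>k. S k w) ` {..N}) \<in> (\<lambda>k. S k w) ` {..N}" by (rule Max_in) auto
    then obtain k where k: "k \<le> N" "Max ((\<lambda>k. S k w) ` {..N}) = S k w"
      unfolding image_iff Bex_def atMost_iff by blast
    have "real i - 1 < S k w / t" using i k by simp
    then have "S k w > t * (real i - 1)" using t by (simp add: field_simps)
    then have "w \<in> ?A i" using wM k by auto
    then have "ennreal (exp (4 * ?m w)) \<le> ennreal (exp (4 * real i)) * indicator (?A i) w"
      using i by (simp add: ennreal_leI)
    also have "\<dots> \<le> (\<Sum>i. ennreal (exp (4 * real i)) * indicator (?A i) w)"
      by (rule ennreal_le_suminf)
    finally show "ennreal (exp (4 * ?m w)) \<le> (\<Sum>i. ennreal (exp (4 * real i)) * indicator (?A i) w)" .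
  qed
  also have "\<dots> = (\<Sum>i. ennreal (exp (4 * real i)) * emeasure M (?A i))"
    using A by (subst nn_integral_suminf) (auto simp: nn_integral_cmult_indicator)
  also have "\<dots> \<le> (\<Sum>i. ennreal (2 * exp (35 / 2) * (1 / 2) ^ i))"
  proof (intro suminf_le allI)
    fix i
    have "exp (4 * real i) * prob (?A i) \<le> exp (4 * real i) * (2 * exp (25 / 2 - 5 * (real i - 1)))"
      using P by (intro mult_left_mono) auto
    also have "\<dots> = 2 * exp (35 / 2) * exp (- real i)"
      by (simp flip: exp_add add: algebra_simps)
    also have "\<dots> \<le> 2 * exp (35 / 2) * (1 / 2) ^ i"
      by (intro mult_left_mono exp_minus_nat_le) auto
    finally show "ennreal (exp (4 * real i)) * emeasure M (?A i) \<le> ennreal (2 * exp (35 / 2) * (1 / 2) ^ i)"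
      by (simp add: emeasure_eq_measure ennreal_leI flip: ennreal_mult')
  qed auto
  also have "\<dots> = ennreal (2 * exp (35 / 2) * (1 / (1 - 1 / 2)))"
    by (intro suminf_ennreal_eq sums_mult geometric_sums) auto
  finally show ?thesis by (simp add: t_def)
qed

lemma nn_integral_exp_max_abs:
  assumes "N > 0"
  shows "(\<integral>\<^sup>+w. ennreal (exp (4 * (Max ((\<lambda>k. \<bar>S k w\<bar>) ` {..N}) / (s * sqrt N)))) \<partial>M) \<le> ennreal (8 * exp (35 / 2))"
proof -
  interpret neg: gaussian_walk M "\<lambda>j w. - \<xi> j w" N s
    using walk_reindex[of id N "- 1"] by simp
  have negS: "neg.S k w = - S k w" for k w
    by (simp add: neg.S_def S_def sum_negf)
  define t where "t = s * sqrt N"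
  have t: "t > 0" using s_pos assms by (simp add: t_def)
  have meas: "(\<lambda>w. Max ((\<lambda>k. S k w) ` {..N})) \<in> borel_measurable M" "(\<lambda>w. Max ((\<lambda>k. - S k w) ` {..N})) \<in> borel_measurable M"
    by (auto intro!: borel_measurable_Max)
  let ?p = "\<lambda>w. exp (4 * (Max ((\<lambda>k. S k w) ` {..N}) / t))" and ?n = "\<lambda>w. exp (4 * (Max ((\<lambda>k. - S k w) ` {..N}) / t))"
  have "(\<integral>\<^sup>+w. ennreal (exp (4 * (Max ((\<lambda>k. \<bar>S k w\<bar>) ` {..N}) / t))) \<partial>M) \<le> (\<integral>\<^sup>+w. ennreal (?p w) + ennreal (?n w) \<partial>M)"
  proof (rule nn_integral_mono)
    fix w
    have "Max ((\<lambda>k. \<bar>S k w\<bar>) ` {..N}) \<in> (\<lambda>k. \<bar>S k w\<bar>) ` {..N}" by (rule Max_in) auto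
    then obtain k where k: "k \<le> N" "Max ((\<lambda>k. \<bar>S k w\<bar>) ` {..N}) = \<bar>S k w\<bar>"
      unfolding image_iff Bex_def atMost_iff by blast
    have "S k w \<le> Max ((\<lambda>k. S k w) ` {..N})" "- S k w \<le> Max ((\<lambda>k. - S k w) ` {..N})"
      using k by (auto intro!: Max_ge)
    from this[THEN divide_right_mono, of t] t have "S k w / t \<le> Max ((\<lambda>k. S k w) ` {..N}) / t" "- S k w / t \<le> Max ((\<lambda>k. - S k w) ` {..N}) / t"
      by simp_all
    then have "exp (4 * (S k w / t)) \<le> ?p w" "exp (4 * (- S k w / t)) \<le> ?n w"
      unfolding exp_le_cancel_iff by linarith+
    moreover have "0 < ?p w" "0 < ?n w" by simp_all
    ultimately have "exp (4 * (\<bar>S k w\<bar> / t)) \<le> ?p w + ?n w"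
      unfolding abs_if by (auto intro: add_increasing add_increasing2 less_imp_le)
    then show "ennreal (exp (4 * (Max ((\<lambda>k. \<bar>S k w\<bar>) ` {..N}) / t))) \<le> ennreal (?p w) + ennreal (?n w)"
      unfolding k by (simp add: ennreal_leI flip: ennreal_plus)
  qed
  also have "\<dots> = (\<integral>\<^sup>+w. ennreal (?p w) \<partial>M) + (\<integral>\<^sup>+w. ennreal (?n w) \<partial>M)"
    using meas by (intro nn_integral_add) auto
  also have "\<dots> \<le> ennreal (4 * exp (35 / 2)) + ennreal (4 * exp (35 / 2))"
    using nn_integral_exp_max[OF assms] neg.nn_integral_exp_max[OF assms] unfolding negS t_def
    by (rule add_mono)
  also have "\<dots> = ennreal (8 * exp (35 / 2))" by (simp flip: ennreal_plus)
  finally show ?thesis by (simp add: t_def)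
qed

text \<open>A walk over k coarse intervals stays below i / sqrt n with probability of order (i + 7)
  / sqrt k, by the lower half of the reflection principle; the exponential weight makes this
  summable in i. Writing \<open>Suc k\<close> keeps the bound finite at k = 0, where the integral is
  1.\<close>

lemma nn_integral_exp_neg_max:
  fixes n l k :: nat
  assumes "n > 0" "l \<ge> n\<^sup>2" "k \<le> n" "N = k * l" "s = sqrt (1 / real (n * l))"
  shows "(\<integral>\<^sup>+w. ennreal (exp (- (sqrt n * Max ((\<lambda>j. S j w) ` {..N})))) \<partial>M) \<le> ennreal (56 * exp 1 / sqrt (real (Suc k)))"
proof (cases "k = 0")
  case True
  then have "(\<integral>\<^sup>+w. ennreal (exp (- (sqrt n * Max ((\<lambda>j. S j w) ` {..N})))) \<partial>M) = 1"
    using assms(4) by (simp add: S_def emeasure_space_1)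
  also have "\<dots> \<le> ennreal (56 * exp 1)"
    using exp_ge_add_one_self[of 1] by (simp flip: ennreal_1 add: ennreal_leI)
  finally show ?thesis using True by simp
next
  case False
  have l: "l > 0" using assms(1,2) by (intro less_le_trans[OF _ assms(2)]) auto
  have N: "N > 0" using False l assms(4) by simp
  define r where "r = sqrt (real n)"
  have r: "r > 0" "r\<^sup>2 = real n" using assms(1) by (simp_all add: r_def)
  let ?m = "\<lambda>w. r * Max ((\<lambda>j. S j w) ` {..N})"
  let ?A = "\<lambda>i. {w\<in>space M. \<forall>j\<le>N. S j w \<le> real i / r}"
  have A: "?A i \<in> events" for i
  proof -
    have "?A i = space M - (\<Union>j\<le>N. first_passage (real i / r) j)"
      unfolding Union_first_passage by (auto simp: not_less not_le)
    also have "\<dots> \<in> events" by auto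
    finally show ?thesis .
  qed
  have P: "prob (?A i) \<le> (real i + 7) / sqrt k" for i
  proof -
    have sN: "s * sqrt N = sqrt k / r"
      using l assms(1) by (simp add: assms(4,5) r_def real_sqrt_mult real_sqrt_divide)
    have k1: "sqrt k \<ge> 1" using False by simp
    have "prob (?A i) \<le> (real i / r + 1 / r) / (s * sqrt N) + 6 * real N * s ^ 4 / (1 / r) ^ 4"
      using r by (intro prob_max_le_small N) auto
    also have "(real i / r + 1 / r) / (s * sqrt N) = (real i + 1) / sqrt k"
      unfolding sN using r False by (simp add: field_simps)
    also have "6 * real N * s ^ 4 / (1 / r) ^ 4 = 6 * real k / real l"
    proof -
      have "s ^ 4 = (s\<^sup>2)\<^sup>2" "r ^ 4 = (r\<^sup>2)\<^sup>2" by (simp_all flip: power_mult)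
      then have s4: "s ^ 4 = 1 / (real n * real l)\<^sup>2" "r ^ 4 = (real n)\<^sup>2"
        by (simp_all add: r assms(5) power_divide)
      show ?thesis
        unfolding power_divide s4 using l assms(1) by (simp add: assms(4) power2_eq_square field_simps)
    qed
    \<comment> \<open>The overshoot term. Here \<open>l \<ge> n\<^sup>2\<close> is decisive: k sqrt
      k <= k^2 <= n^2 <= l.\<close>
    also have "6 * real k / real l \<le> 6 / sqrt k"
    proof -
      have "real k * sqrt k \<le> real k * real k"
        using False by (intro mult_left_mono real_le_lsqrt) (auto simp: power2_eq_square)
      also have "\<dots> \<le> real n * real n" using assms(3) by (intro mult_mono) auto
      also have "\<dots> = real (n\<^sup>2)" by (simp add: power2_eq_square)
      also have "\<dots> \<le> real l" using assms(2) by (rule of_nat_mono)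
      finally have "6 * real k * sqrt k \<le> 6 * real l" by simp
      then show ?thesis using l False by (simp add: field_simps)
    qed
    finally show ?thesis by (simp add: add_divide_distrib)
  qed
  have "(\<integral>\<^sup>+w. ennreal (exp (- ?m w)) \<partial>M) \<le> (\<integral>\<^sup>+w. (\<Sum>i. ennreal (exp (1 - real i)) * indicator (?A i) w) \<partial>M)"
  proof (rule nn_integral_mono)
    fix w assume wM: "w \<in> space M"
    define i where "i = nat \<lceil>?m w\<rceil>"
    have m: "?m w \<ge> 0" using max_nonneg[of w] r by simp
    note i = nat_ceiling_bounds[OF m, folded i_def]
    have "S j w \<le> real i / r" if "j \<le> N" for j
    proof -
      have "S j w \<le> Max ((\<lambda>j. S j w) ` {..N})" using that by (intro Max_ge) auto
      also have "\<dots> \<le> real i / r" using i r by (simp add: field_simps)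
      finally show ?thesis .
    qed
    then have "w \<in> ?A i" using wM by auto
    then have "ennreal (exp (- ?m w)) \<le> ennreal (exp (1 - real i)) * indicator (?A i) w"
      using i by (simp add: ennreal_leI)
    also have "\<dots> \<le> (\<Sum>i. ennreal (exp (1 - real i)) * indicator (?A i) w)"
      by (rule ennreal_le_suminf)
    finally show "ennreal (exp (- ?m w)) \<le> (\<Sum>i. ennreal (exp (1 - real i)) * indicator (?A i) w)" .
  qed
  also have "\<dots> = (\<Sum>i. ennreal (exp (1 - real i)) * emeasure M (?A i))"
    using A by (subst nn_integral_suminf) (auto simp: nn_integral_cmult_indicator)
  also have "\<dots> \<le> (\<Sum>i. ennreal (7 * exp 1 / sqrt k * (3 / 4) ^ i))"
  proof (intro suminf_le allI)
    fix i
    \<comment> \<open>Bernoulli bounds the linear factor by 7 (3/2)^i; together with (1/2)^i a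
      geometric series of ratio 3/4 remains.\<close>
    have bern: "real i + 7 \<le> 7 * (3 / 2) ^ i"
      using Bernoulli_inequality[of "1 / 2 :: real" i] by simp
    have "exp (1 - real i) * prob (?A i) \<le> exp (1 - real i) * ((real i + 7) / sqrt k)"
      using P by (intro mult_left_mono) auto
    also have "\<dots> = exp 1 / sqrt k * (exp (- real i) * (real i + 7))"
      by (simp add: exp_diff exp_minus field_simps)
    also have "\<dots> \<le> exp 1 / sqrt k * ((1 / 2) ^ i * (7 * (3 / 2) ^ i))"
      by (intro mult_left_mono mult_mono exp_minus_nat_le bern) auto
    also have "\<dots> = 7 * exp 1 / sqrt k * (3 / 4) ^ i"
      by (simp flip: power_mult_distrib)
    finally show "ennreal (exp (1 - real i)) * emeasure M (?A i) \<le> ennreal (7 * exp 1 / sqrt k * (3 / 4) ^ i)"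
      by (simp add: emeasure_eq_measure ennreal_leI flip: ennreal_mult')
  qed auto
  also have "\<dots> = ennreal (7 * exp 1 / sqrt k * (1 / (1 - 3 / 4)))"
    by (intro suminf_ennreal_eq sums_mult geometric_sums) auto
  also have "\<dots> \<le> ennreal (56 * exp 1 / sqrt (real (Suc k)))"
  proof (rule ennreal_leI)
    have "sqrt (real (Suc k)) \<le> sqrt (4 * real k)" using False by (intro real_sqrt_le_mono) auto
    then have "sqrt (real (Suc k)) \<le> 2 * sqrt k" by (simp add: real_sqrt_mult)
    then have "28 * exp 1 * sqrt (real (Suc k)) \<le> 56 * exp 1 * sqrt k" by simp
    then show "7 * exp 1 / sqrt k * (1 / (1 - 3 / 4)) \<le> 56 * exp 1 / sqrt (real (Suc k))"
      using False by (simp add: field_simps)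
  qed
  finally show ?thesis by (simp add: r_def)
qed

end

lemma sum_inverse_sqrt_le: "(\<Sum>k<n. 1 / sqrt (real (Suc k))) \<le> 2 * sqrt n"
proof (induction n)
  case (Suc n)
  have pos: "sqrt (real (Suc n)) > 0" by simp
  have "sqrt n * sqrt (Suc n) \<le> real n + 1 / 2"
  proof -
    have "real n * real (Suc n) \<le> (real n + 1 / 2)\<^sup>2" by (simp add: power2_eq_square algebra_simps)
    then have "sqrt (real n * real (Suc n)) \<le> real n + 1 / 2" by (intro real_le_lsqrt) auto
    then show ?thesis by (simp add: real_sqrt_mult)
  qed
  then have "2 * sqrt n * sqrt (real (Suc n)) + 1 \<le> 2 * (sqrt (real (Suc n)) * sqrt (real (Suc n)))"
    by simp
  then have "2 * sqrt n + 1 / sqrt (real (Suc n)) \<le> 2 * sqrt (real (Suc n))"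
    using pos by (simp add: field_simps)
  then show ?case using Suc by simp
qed simp

text \<open>With a = sqrt(k + 1), b = sqrt(n - k) and c = sqrt(n + 1), subadditivity gives c <= a +
  b, hence 1/(a b) <= (1/a + 1/b)/c. The two resulting sums agree by reversal.\<close>

lemma sum_inverse_sqrt_convolution:
  "(\<Sum>k<n. 1 / sqrt (real (Suc k)) * (1 / sqrt (real (n - k)))) \<le> 4"
proof -
  have le: "1 / sqrt (real (Suc k)) * (1 / sqrt (real (n - k)))
    \<le> 1 / sqrt (real (Suc n)) * (1 / sqrt (real (Suc k)) + 1 / sqrt (real (n - k)))" if k: "k < n" for k
  proof -
    let ?a = "sqrt (real (Suc k))" and ?b = "sqrt (real (n - k))" and ?c = "sqrt (real (Suc n))"
    have pos: "?a > 0" "?b > 0" "?c > 0" using k by auto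
    have "?c = sqrt (real (Suc k) + real (n - k))" using k by simp
    also have "\<dots> \<le> ?a + ?b" by (rule sqrt_add_le_add_sqrt) auto
    finally have "?c \<le> ?a + ?b" .
    then show ?thesis using pos by (simp add: field_simps)
  qed
  have refl: "(\<Sum>k<n. 1 / sqrt (real (n - k))) = (\<Sum>k<n. 1 / sqrt (real (Suc k)))"
    by (rule sum.reindex_bij_witness[of _ "\<lambda>k. n - Suc k" "\<lambda>k. n - Suc k"]) (auto simp: Suc_diff_Suc)
  have "(\<Sum>k<n. 1 / sqrt (real (Suc k)) * (1 / sqrt (real (n - k))))
    \<le> (\<Sum>k<n. 1 / sqrt (real (Suc n)) * (1 / sqrt (real (Suc k)) + 1 / sqrt (real (n - k))))"
    using le by (intro sum_mono) auto
  also have "\<dots> = 1 / sqrt (real (Suc n)) * (2 * (\<Sum>k<n. 1 / sqrt (real (Suc k))))"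
    by (simp only: sum_distrib_left[symmetric] sum.distrib refl mult_2)
  also have "\<dots> \<le> 1 / sqrt (real (Suc n)) * (2 * (2 * sqrt n))"
    by (intro mult_left_mono sum_inverse_sqrt_le) auto
  also have "\<dots> = 4 * (sqrt n / sqrt (real (Suc n)))" by simp
  also have "\<dots> \<le> 4 * 1" by (intro mult_left_mono) (auto simp: divide_le_eq)
  finally show ?thesis by simp
qed

section \<open>The minimum over a coarse and over a fine grid\<close>

context gaussian_walk
begin

section \<open>Past, block and future of a walk\<close>

definition backward_max :: "nat \<Rightarrow> 'a \<Rightarrow> real" where
  "backward_max c w = Max ((\<lambda>j. S c w - S j w) ` {..c})"

definition forward_max :: "nat \<Rightarrow> 'a \<Rightarrow> real" where
  "forward_max c w = Max ((\<lambda>j. S c w - S j w) ` {c..N})"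

definition osc :: "nat \<Rightarrow> nat \<Rightarrow> 'a \<Rightarrow> real" where
  "osc b l w = Max ((\<lambda>r. \<bar>S (b + r) w - S b w\<bar>) ` {..l})"

lemma backward_max_measurable[measurable]: "c \<le> N \<Longrightarrow> backward_max c \<in> borel_measurable M"
  unfolding backward_max_def[abs_def] by (intro borel_measurable_Max borel_measurable_diff measurable_S) auto

lemma forward_max_measurable[measurable]: "c \<le> N \<Longrightarrow> forward_max c \<in> borel_measurable M"
  unfolding forward_max_def[abs_def] by (intro borel_measurable_Max borel_measurable_diff measurable_S) auto

lemma osc_measurable[measurable]: "b + l \<le> N \<Longrightarrow> osc b l \<in> borel_measurable M"
  unfolding osc_def[abs_def] by (intro borel_measurable_Max borel_measurable_abs borel_measurable_diff measurable_S) auto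

text \<open>Read backwards from \<open>k * l\<close>, the increments form a Gaussian walk again, and
  \<open>backward_max\<close> is its maximum.\<close>

lemma nn_integral_exp_backward:
  fixes n l k :: nat
  assumes "n > 0" "l \<ge> n\<^sup>2" "k \<le> n" "k * l \<le> N" "s = sqrt (1 / real (n * l))"
  shows "(\<integral>\<^sup>+w. ennreal (exp (- (sqrt n * backward_max (k * l) w))) \<partial>M) \<le> ennreal (56 * exp 1 / sqrt (real (Suc k)))"
proof -
  let ?c = "k * l"
  interpret r: gaussian_walk M "\<lambda>j w. 1 * \<xi> (?c - 1 - j) w" ?c s
    using assms(4) by (intro walk_reindex) (auto simp: inj_on_def)
  have eq: "r.S m w = S ?c w - S (?c - m) w" if "m \<le> ?c" for m w
  proof -
    have "r.S m w = (\<Sum>j<m. \<xi> (?c - 1 - j) w)" unfolding r.S_def by simp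
    also have "\<dots> = (\<Sum>i=?c - m..<?c. \<xi> i w)"
      using that by (intro sum.reindex_bij_witness[of _ "\<lambda>i. ?c - 1 - i" "\<lambda>i. ?c - 1 - i"]) auto
    also have "\<dots> = S ?c w - S (?c - m) w" by (rule S_diff[symmetric]) simp
    finally show ?thesis .
  qed
  have "(\<lambda>m. r.S m w) ` {..?c} = (\<lambda>j. S ?c w - S j w) ` {..?c}" for w
  proof -
    have "(\<lambda>m. r.S m w) ` {..?c} = (\<lambda>m. S ?c w - S (?c - m) w) ` {..?c}"
      by (rule image_cong[OF refl eq]) simp
    also have "\<dots> = (\<lambda>j. S ?c w - S j w) ` ((\<lambda>m. ?c - m) ` {..?c})" by (simp add: image_image)
    also have "(\<lambda>m. ?c - m) ` {..?c} = {..?c}"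
    proof (intro equalityI subsetI)
      fix x assume "x \<in> {..?c}"
      then show "x \<in> (\<lambda>m. ?c - m) ` {..?c}" by (intro image_eqI[of _ _ "?c - x"]) auto
    qed auto
    finally show ?thesis .
  qed
  then show ?thesis
    using r.nn_integral_exp_neg_max[OF assms(1-3) refl assms(5)] by (simp only: backward_max_def)
qed

text \<open>The walk after \<open>c\<close> with all signs reversed is Gaussian, and
  \<open>forward_max\<close> is its maximum.\<close>

lemma nn_integral_exp_forward:
  fixes n l k :: nat
  assumes "n > 0" "l \<ge> n\<^sup>2" "k \<le> n" "N = c + k * l" "s = sqrt (1 / real (n * l))"
  shows "(\<integral>\<^sup>+w. ennreal (exp (- (sqrt n * forward_max c w))) \<partial>M) \<le> ennreal (56 * exp 1 / sqrt (real (Suc k)))"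
proof -
  interpret r: gaussian_walk M "\<lambda>j w. -1 * \<xi> (c + j) w" "k * l" s
    using assms(4) by (intro walk_reindex) (auto simp: inj_on_def)
  have eq: "r.S m w = S c w - S (c + m) w" for m w
  proof -
    have "r.S m w = - (\<Sum>j<m. \<xi> (c + j) w)" unfolding r.S_def by (simp add: sum_negf)
    also have "(\<Sum>j<m. \<xi> (c + j) w) = (\<Sum>i=c..<c + m. \<xi> i w)"
      by (rule sum.reindex_bij_witness[of _ "\<lambda>i. i - c" "\<lambda>i. c + i"]) auto
    also have "\<dots> = S (c + m) w - S c w" by (rule S_diff[symmetric]) simp
    finally show ?thesis by simp
  qed
  have "(\<lambda>m. r.S m w) ` {..k * l} = (\<lambda>j. S c w - S j w) ` {c..N}" for w
  proof -
    have "{c..N} = (\<lambda>m. c + m) ` {..k * l}"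
    proof (intro equalityI subsetI)
      fix x assume "x \<in> {c..N}"
      then show "x \<in> (\<lambda>m. c + m) ` {..k * l}"
        using assms(4) by (intro image_eqI[of _ _ "x - c"]) auto
    qed (use assms(4) in auto)
    then show ?thesis unfolding eq by (simp add: image_image)
  qed
  then show ?thesis
    using r.nn_integral_exp_neg_max[OF assms(1-3) refl assms(5)] by (simp only: forward_max_def)
qed

lemma nn_integral_exp_osc:
  assumes "l > 0" "b + l \<le> N"
  shows "(\<integral>\<^sup>+w. ennreal (exp (4 * (osc b l w / (s * sqrt l)))) \<partial>M) \<le> ennreal (8 * exp (35 / 2))"
proof -
  interpret r: gaussian_walk M "\<lambda>j w. 1 * \<xi> (b + j) w" l s
    using assms by (intro walk_reindex) (auto simp: inj_on_def)
  have eq: "r.S m w = S (b + m) w - S b w" for m w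
  proof -
    have "r.S m w = (\<Sum>j<m. \<xi> (b + j) w)" unfolding r.S_def by simp
    also have "\<dots> = (\<Sum>i=b..<b + m. \<xi> i w)"
      by (rule sum.reindex_bij_witness[of _ "\<lambda>i. i - b" "\<lambda>i. b + i"]) auto
    also have "\<dots> = S (b + m) w - S b w" by (rule S_diff[symmetric]) simp
    finally show ?thesis .
  qed
  show ?thesis
    using r.nn_integral_exp_max_abs[OF assms(1)] by (simp only: osc_def eq)
qed

text \<open>The three factors are functions of the increments in the disjoint blocks
  \<open>{..<b}\<close>, \<open>{b..<c}\<close> and \<open>{c..<N}\<close>; the restricted vectors
  of increments are independent, and this passes to the factors.\<close>

lemma nn_integral_block_product:
  assumes "b \<le> c" "c \<le> N" "a \<ge> 0"
  shows "(\<integral>\<^sup>+w. ennreal (exp (- (a * backward_max b w))) * ennreal (exp (4 * (a * osc b (c - b) w))) * ennreal (exp (- (a * forward_max c w))) \<partial>M)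
    = (\<integral>\<^sup>+w. ennreal (exp (- (a * backward_max b w))) \<partial>M) * (\<integral>\<^sup>+w. ennreal (exp (4 * (a * osc b (c - b) w))) \<partial>M)
      * (\<integral>\<^sup>+w. ennreal (exp (- (a * forward_max c w))) \<partial>M)"
proof -
  define K where "K i = (if i = 0 then {..<b} else if i = 1 then {b..<c} else {c..<N})" for i :: nat
  define Y0 where "Y0 f = ennreal (exp (- (a * Max ((\<lambda>j. \<Sum>i=j..<b. f i) ` {..b}))))" for f :: "nat \<Rightarrow> real"
  define Y1 where "Y1 f = ennreal (exp (4 * (a * Max ((\<lambda>r. \<bar>\<Sum>i=b..<b + r. f i\<bar>) ` {..c - b}))))" for f :: "nat \<Rightarrow> real"
  define Y2 where "Y2 f = ennreal (exp (- (a * Max ((\<lambda>j. - (\<Sum>i=c..<j. f i)) ` {c..N}))))" for f :: "nat \<Rightarrow> real"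
  define Y where "Y i = (if i = 0 then Y0 else if i = 1 then Y1 else Y2)" for i :: nat
  have ind: "indep_vars (\<lambda>j. PiM (K j) (\<lambda>_. borel)) (\<lambda>j w. restrict (\<lambda>i. \<xi> i w) (K j)) {0, 1, 2}"
    using assms by (intro indep_vars_restrict[OF indep]) (auto simp: K_def disjoint_family_on_def)
  have comp: "(\<lambda>f. f i) \<in> borel_measurable (PiM I (\<lambda>_. borel :: real measure))" if "i \<in> I" for i :: nat and I
    using that by (rule measurable_component_singleton)
  have "indep_vars (\<lambda>_. borel) (\<lambda>j w. Y j (restrict (\<lambda>i. \<xi> i w) (K j))) {0, 1, 2}"
  proof (rule indep_vars_compose2[OF ind])
    have "Y0 \<in> borel_measurable (PiM {..<b} (\<lambda>_. borel))"
      unfolding Y0_def[abs_def]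
      by (intro measurable_compose[OF _ measurable_ennreal] measurable_compose[OF _ borel_measurable_exp] borel_measurable_uminus
          borel_measurable_times borel_measurable_const borel_measurable_Max borel_measurable_sum comp) auto
    moreover have "Y1 \<in> borel_measurable (PiM {b..<c} (\<lambda>_. borel))"
      unfolding Y1_def[abs_def]
      by (intro measurable_compose[OF _ measurable_ennreal] measurable_compose[OF _ borel_measurable_exp] borel_measurable_abs
          borel_measurable_times borel_measurable_const borel_measurable_Max borel_measurable_sum comp) auto
    moreover have "Y2 \<in> borel_measurable (PiM {c..<N} (\<lambda>_. borel))"
      unfolding Y2_def[abs_def]
      by (intro measurable_compose[OF _ measurable_ennreal] measurable_compose[OF _ borel_measurable_exp] borel_measurable_uminus
          borel_measurable_times borel_measurable_const borel_measurable_Max borel_measurable_sum comp) auto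
    ultimately show "Y j \<in> borel_measurable (PiM (K j) (\<lambda>_. borel))" if "j \<in> {0, 1, 2}" for j
      using that by (auto simp: Y_def K_def)
  qed
  from indep_vars_nn_integral[OF _ this]
  have "(\<integral>\<^sup>+w. (\<Prod>j\<in>{0, 1, 2}. Y j (restrict (\<lambda>i. \<xi> i w) (K j))) \<partial>M)
    = (\<Prod>j\<in>{0, 1, 2}. \<integral>\<^sup>+w. Y j (restrict (\<lambda>i. \<xi> i w) (K j)) \<partial>M)" by simp
  moreover have "Y 0 (restrict (\<lambda>i. \<xi> i w) (K 0)) = ennreal (exp (- (a * backward_max b w)))" for w
  proof -
    have "(\<lambda>j. \<Sum>i=j..<b. restrict (\<lambda>i. \<xi> i w) (K 0) i) ` {..b} = (\<lambda>j. S b w - S j w) ` {..b}"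
      by (intro image_cong) (auto simp: S_diff K_def intro!: sum.cong)
    then show ?thesis by (simp add: Y_def Y0_def backward_max_def)
  qed
  moreover have "Y 1 (restrict (\<lambda>i. \<xi> i w) (K 1)) = ennreal (exp (4 * (a * osc b (c - b) w)))" for w
  proof -
    have "(\<lambda>r. \<bar>\<Sum>i=b..<b + r. restrict (\<lambda>i. \<xi> i w) (K 1) i\<bar>) ` {..c - b} = (\<lambda>r. \<bar>S (b + r) w - S b w\<bar>) ` {..c - b}"
      by (intro image_cong) (auto simp: S_diff K_def intro!: arg_cong[where f=abs] sum.cong)
    then show ?thesis by (simp add: Y_def Y1_def osc_def)
  qed
  moreover have "Y 2 (restrict (\<lambda>i. \<xi> i w) (K 2)) = ennreal (exp (- (a * forward_max c w)))" for w
  proof -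
    have "- (\<Sum>i=c..<j. restrict (\<lambda>i. \<xi> i w) (K 2) i) = S c w - S j w" if "j \<in> {c..N}" for j
    proof -
      have "(\<Sum>i=c..<j. restrict (\<lambda>i. \<xi> i w) (K 2) i) = (\<Sum>i=c..<j. \<xi> i w)"
        using that by (intro sum.cong) (auto simp: K_def)
      also have "\<dots> = S j w - S c w" using that by (intro S_diff[symmetric]) auto
      finally show ?thesis by simp
    qed
    then have "(\<lambda>j. - (\<Sum>i=c..<j. restrict (\<lambda>i. \<xi> i w) (K 2) i)) ` {c..N} = (\<lambda>j. S c w - S j w) ` {c..N}"
      by (intro image_cong) auto
    then show ?thesis by (simp add: Y_def Y2_def forward_max_def)
  qed
  ultimately show ?thesis by (simp add: mult.assoc)
qed

definition grid_gap :: "nat \<Rightarrow> nat \<Rightarrow> 'a \<Rightarrow> real" where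
  "grid_gap n l w = Min ((\<lambda>k. S (k * l) w) ` {..n}) - Min ((\<lambda>j. S j w) ` {..n * l})"

text \<open>
  If the minimum over the fine grid is attained in the block \<open>[k * l, (k + 1) * l]\<close>, then neither the
  backward nor the forward maximum seen from the ends of that block exceeds the oscillation inside it.
\<close>
lemma exp_grid_gap_le:
  assumes "n > 0" "l > 0" "N = n * l" "a \<ge> 0"
  shows "exp (a * grid_gap n l w) \<le> (\<Sum>k<n. exp (- (a * backward_max (k * l) w)) * exp (4 * (a * osc (k * l) l w)) * exp (- (a * forward_max (k * l + l) w)))"
proof -
  have "Min ((\<lambda>j. S j w) ` {..n * l}) \<in> (\<lambda>j. S j w) ` {..n * l}" by (rule Min_in) auto
  then obtain j where j: "j \<le> n * l" "Min ((\<lambda>j. S j w) ` {..n * l}) = S j w"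
    unfolding image_iff Bex_def atMost_iff by blast
  have least: "S j w \<le> S i w" if "i \<le> n * l" for i
    unfolding j(2)[symmetric] using that by (intro Min_le) auto
  \<comment> \<open>Division by l finds the block, except that a minimum at the right end point
    belongs to the last block.\<close>
  obtain k where k: "k < n" "k * l \<le> j" "j \<le> k * l + l"
  proof (cases "j = n * l")
    case True
    then show ?thesis using assms by (intro that[of "n - 1"]) (auto simp: algebra_simps)
  next
    case False
    then have "j < n * l" using j by simp
    then have "j div l < n" by (simp add: less_mult_imp_div_less)
    moreover have "j div l * l \<le> j" by simp
    moreover have "j \<le> j div l * l + l"
      using div_mult_mod_eq[of j l] mod_less_divisor[OF assms(2), of j] by linarith
    ultimately show ?thesis by (rule that)
  qed
  let ?b = "k * l" and ?c = "k * l + l"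
  have c: "?c \<le> N"
  proof -
    have "Suc k * l \<le> n * l" using k(1) by (intro mult_le_mono1) simp
    then show ?thesis using assms(3) by simp
  qed
  define A where "A = S ?b w - S j w"
  have osc_le: "\<bar>S (?b + r) w - S ?b w\<bar> \<le> osc ?b l w" if "r \<le> l" for r
    unfolding osc_def using that by (intro Max_ge) auto
  have "j - ?b \<le> l" using k by linarith
  from osc_le[OF this] have A: "A \<le> osc ?b l w"
    using k(2) by (simp add: A_def abs_le_iff)
  have gap: "grid_gap n l w \<le> A"
    unfolding grid_gap_def j(2) A_def using k(1) by (intro diff_right_mono Min_le) auto
  have bwd: "backward_max ?b w \<le> A"
    unfolding backward_max_def A_def using c assms(3) least by (subst Max_le_iff) auto
  have fwd: "forward_max ?c w \<le> 2 * osc ?b l w"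
  proof -
    have "forward_max ?c w \<le> S ?c w - S j w"
      unfolding forward_max_def using c assms(3) least by (subst Max_le_iff) auto
    also have "\<dots> \<le> 2 * osc ?b l w"
      using osc_le[of l] A by (simp add: A_def)
    finally show ?thesis .
  qed
  \<comment> \<open>Where the 4 comes from: the gap and the backward maximum are each at most one
    oscillation, the forward maximum at most two.\<close>
  have "grid_gap n l w \<le> - backward_max ?b w + 4 * osc ?b l w - forward_max ?c w"
    using gap bwd fwd A by linarith
  then have "a * grid_gap n l w \<le> a * (- backward_max ?b w + 4 * osc ?b l w - forward_max ?c w)"
    using assms(4) by (rule mult_left_mono)
  then have "exp (a * grid_gap n l w) \<le> exp (- (a * backward_max ?b w) + 4 * (a * osc ?b l w) + - (a * forward_max ?c w))"
    by (simp add: algebra_simps)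
  also have "\<dots> = exp (- (a * backward_max ?b w)) * exp (4 * (a * osc ?b l w)) * exp (- (a * forward_max ?c w))"
    by (simp only: exp_add)
  \<comment> \<open>The block depends on the path; summing over all blocks removes this
    dependence.\<close>
  also have "\<dots> \<le> (\<Sum>k<n. exp (- (a * backward_max (k * l) w)) * exp (4 * (a * osc (k * l) l w)) * exp (- (a * forward_max (k * l + l) w)))"
    by (rule member_le_sum[of k "{..<n}"]) (use k(1) in auto)
  finally show ?thesis .
qed

text \<open>Independence factorises each term. There are k coarse intervals before the k-th block
  and n - k - 1 after it, which gives 1 / sqrt(k + 1) and 1 / sqrt(n - k); the convolution estimate
  bounds the sum by 4, uniformly in n and l.\<close>

lemma nn_integral_exp_grid_gap:
  assumes "n > 0" "l \<ge> n\<^sup>2" "N = n * l" "s = sqrt (1 / real (n * l))"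
  shows "(\<integral>\<^sup>+w. ennreal (exp (sqrt n * grid_gap n l w)) \<partial>M) \<le> ennreal (4 * (56 * exp 1)\<^sup>2 * (8 * exp (35 / 2)))"
proof -
  have l: "l > 0" using assms(1,2) by (intro less_le_trans[OF _ assms(2)]) auto
  define a where "a = sqrt (real n)"
  have a: "a > 0" using assms(1) by (simp add: a_def)
  let ?e0 = "\<lambda>k w. exp (- (a * backward_max (k * l) w))" and ?e1 = "\<lambda>k w. exp (4 * (a * osc (k * l) l w))"
    and ?e2 = "\<lambda>k w. exp (- (a * forward_max (k * l + l) w))"
  have c: "k * l + l \<le> N" if "k < n" for k
  proof -
    have "Suc k * l \<le> n * l" using that by (intro mult_le_mono1) simp
    then show ?thesis using assms(3) by simp
  qed
  define C where "C = 56 * exp (1::real)"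
  define B where "B = 8 * exp (35 / 2 :: real)"
  have CB: "C > 0" "B > 0" by (simp_all add: C_def B_def)
  have "(\<integral>\<^sup>+w. ennreal (exp (a * grid_gap n l w)) \<partial>M) \<le> (\<integral>\<^sup>+w. (\<Sum>k<n. ennreal (?e0 k w) * ennreal (?e1 k w) * ennreal (?e2 k w)) \<partial>M)"
  proof (rule nn_integral_mono)
    fix w
    have "ennreal (exp (a * grid_gap n l w)) \<le> ennreal (\<Sum>k<n. ?e0 k w * ?e1 k w * ?e2 k w)"
      using a by (intro ennreal_leI exp_grid_gap_le assms l) auto
    also have "\<dots> = (\<Sum>k<n. ennreal (?e0 k w) * ennreal (?e1 k w) * ennreal (?e2 k w))"
      by (subst sum_ennreal[symmetric]) (auto simp: ennreal_mult')
    finally show "ennreal (exp (a * grid_gap n l w)) \<le> (\<Sum>k<n. ennreal (?e0 k w) * ennreal (?e1 k w) * ennreal (?e2 k w))" .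
  qed
  also have "\<dots> = (\<Sum>k<n. \<integral>\<^sup>+w. ennreal (?e0 k w) * ennreal (?e1 k w) * ennreal (?e2 k w) \<partial>M)"
  proof (rule nn_integral_sum)
    fix k assume "k \<in> {..<n}"
    then have "k * l + l \<le> N" using c by auto
    then have [measurable]: "backward_max (k * l) \<in> borel_measurable M" "osc (k * l) l \<in> borel_measurable M" "forward_max (k * l + l) \<in> borel_measurable M"
      by auto
    show "(\<lambda>w. ennreal (?e0 k w) * ennreal (?e1 k w) * ennreal (?e2 k w)) \<in> borel_measurable M" by measurable
  qed
  also have "\<dots> \<le> (\<Sum>k<n. ennreal (C\<^sup>2 * B * (1 / sqrt (real (Suc k)) * (1 / sqrt (real (n - k))))))"
  proof (rule sum_mono)
    fix k assume "k \<in> {..<n}"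
    then have k: "k < n" by simp
    have nk: "N = k * l + l + (n - Suc k) * l"
    proof -
      have "n = k + 1 + (n - Suc k)" using k by simp
      then have "n * l = (k + 1 + (n - Suc k)) * l" by simp
      then show ?thesis using assms(3) by (simp add: algebra_simps)
    qed
    have "(\<integral>\<^sup>+w. ennreal (?e0 k w) * ennreal (?e1 k w) * ennreal (?e2 k w) \<partial>M)
      = (\<integral>\<^sup>+w. ennreal (?e0 k w) \<partial>M) * (\<integral>\<^sup>+w. ennreal (?e1 k w) \<partial>M) * (\<integral>\<^sup>+w. ennreal (?e2 k w) \<partial>M)"
      using nn_integral_block_product[of "k * l" "k * l + l" a] c[OF k] a by simp
    also have "\<dots> \<le> ennreal (C / sqrt (real (Suc k))) * ennreal B * ennreal (C / sqrt (real (Suc (n - Suc k))))"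
    proof (intro mult_mono)
      show "(\<integral>\<^sup>+w. ennreal (?e0 k w) \<partial>M) \<le> ennreal (C / sqrt (real (Suc k)))"
        unfolding a_def C_def using k c[OF k] by (intro nn_integral_exp_backward assms) auto
      show "(\<integral>\<^sup>+w. ennreal (?e2 k w) \<partial>M) \<le> ennreal (C / sqrt (real (Suc (n - Suc k))))"
        unfolding a_def C_def by (intro nn_integral_exp_forward[where l=l] assms nk) auto
      have "a * x = x / (s * sqrt l)" for x
        using l assms(1) by (simp add: a_def assms(4) real_sqrt_mult real_sqrt_divide)
      then show "(\<integral>\<^sup>+w. ennreal (?e1 k w) \<partial>M) \<le> ennreal B"
        unfolding B_def using nn_integral_exp_osc[OF l c[OF k]] by simp
    qed auto
    also have "\<dots> = ennreal (C\<^sup>2 * B * (1 / sqrt (real (Suc k)) * (1 / sqrt (real (n - k)))))"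
      using CB k by (simp add: Suc_diff_Suc power2_eq_square ac_simps flip: ennreal_mult')
    finally show "(\<integral>\<^sup>+w. ennreal (?e0 k w) * ennreal (?e1 k w) * ennreal (?e2 k w) \<partial>M)
      \<le> ennreal (C\<^sup>2 * B * (1 / sqrt (real (Suc k)) * (1 / sqrt (real (n - k)))))" .
  qed
  also have "\<dots> = ennreal (C\<^sup>2 * B * (\<Sum>k<n. 1 / sqrt (real (Suc k)) * (1 / sqrt (real (n - k)))))"
    using CB by (subst sum_ennreal) (auto simp: sum_distrib_left)
  also have "\<dots> \<le> ennreal (C\<^sup>2 * B * 4)"
    using CB by (intro ennreal_leI mult_left_mono sum_inverse_sqrt_convolution) auto
  finally show ?thesis by (simp add: a_def C_def B_def mult.assoc mult.commute mult.left_commute)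
qed

end

section \<open>The error bound\<close>

lemma powr_le_exp:
  assumes "(t::real) \<ge> 0" "q > 0"
  shows "t powr q \<le> q powr q * exp t"
proof -
  have "t / q \<le> exp (t / q)" using exp_ge_add_one_self[of "t / q"] by linarith
  then have "t \<le> q * exp (t / q)" using assms(2) by (simp add: field_simps)
  then have "t powr q \<le> (q * exp (t / q)) powr q" using assms by (intro powr_mono2) auto
  also have "\<dots> = q powr q * exp t" using assms by (simp add: powr_mult powr_def[of "exp (t / q)"])
  finally show ?thesis .
qed

lemma powr_add_le:
  assumes "a \<ge> 0" "b \<ge> 0" "p \<ge> (0::real)"
  shows "(a + b) powr p \<le> 2 powr p * (a powr p + b powr p)"
proof -
  have "(a + b) powr p \<le> (2 * max a b) powr p" using assms by (intro powr_mono2) auto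
  also have "\<dots> = 2 powr p * max a b powr p" by (rule powr_mult)
  also have "max a b powr p \<le> a powr p + b powr p" by (simp add: max_def)
  finally show ?thesis by simp
qed

text \<open>The grid gap and the global oscillation are dependent, so their product is split by ab
  <= a^2 + b^2 instead of independence; each part is then dominated by an exponential.\<close>

lemma powr_mult_le:
  assumes "a \<ge> 0" "b \<ge> 0" "p > (0::real)"
  shows "(2 * a * b) powr p \<le> 2 powr p * (2 * p) powr (2 * p) * (exp a + exp b)"
proof -
  have "a powr p * b powr p \<le> (a powr p)\<^sup>2 + (b powr p)\<^sup>2"
  proof -
    have "2 * (a powr p * b powr p) \<le> (a powr p)\<^sup>2 + (b powr p)\<^sup>2"
      using sum_squares_bound[of "a powr p" "b powr p"] by (simp add: mult.assoc)
    moreover have "0 \<le> a powr p * b powr p" by simp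
    ultimately show ?thesis by linarith
  qed
  also have "\<dots> = a powr (2 * p) + b powr (2 * p)"
    by (simp add: power2_eq_square flip: powr_add)
  also have "\<dots> \<le> (2 * p) powr (2 * p) * exp a + (2 * p) powr (2 * p) * exp b"
    using assms by (intro add_mono powr_le_exp) auto
  finally have "a powr p * b powr p \<le> (2 * p) powr (2 * p) * (exp a + exp b)" by (simp add: distrib_left)
  then have "2 powr p * (a powr p * b powr p) \<le> 2 powr p * ((2 * p) powr (2 * p) * (exp a + exp b))"
    by (intro mult_left_mono) auto
  then show ?thesis using assms by (simp add: powr_mult mult.assoc)
qed

context sde
begin

lemma X_hat_measurable[measurable]: "X_hat W x0 n \<in> borel_measurable M"
  unfolding X_hat_def[abs_def] neg_part_def
  by (intro borel_measurable_power borel_measurable_add borel_measurable_uminus borel_measurable_min borel_measurable_Min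
      borel_measurable_const W_measurable) auto

lemma dW_walk: "N > 0 \<Longrightarrow> gaussian_walk M (dW N) N (sqrt (1 / real N))"
  unfolding dW_def[abs_def] by (rule gaussian_walk_increments)

text \<open>Both approximations are squares of reflected end points u <= v with the same
  \<open>W 1 w\<close>. As \<open>neg_part\<close> is 1-Lipschitz, v - u is at most the gap of the
  minima, while v + u is controlled by the largest excursion of the fine walk; the product is v^2 -
  u^2.\<close>

lemma X_hat_refinement:
  fixes n l :: nat
  defines "N \<equiv> n * l"
  assumes n: "n > 0" and l: "l > 0" and W0: "W 0 w = 0"
  defines "g \<equiv> gaussian_walk.grid_gap (dW N) n l w" and "R \<equiv> gaussian_walk.osc (dW N) 0 N w"
  shows "0 \<le> g" "0 \<le> R" "\<bar>X_hat W x0 n w - X_hat W x0 N w\<bar> \<le> 2 * g * (sqrt x0 + 2 * R)"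
proof -
  have N: "N > 0" using n l by (simp add: N_def)
  interpret gw: gaussian_walk M "dW N" N "sqrt (1 / real N)" by (rule dW_walk[OF N])
  have S: "gw.S k w = W (real k / real N) w" for k
  proof -
    have "gw.S k w = (\<Sum>j<k. W (real (Suc j) / real N) w - W (real j / real N) w)"
      by (simp add: gw.S_def dW_def)
    also have "\<dots> = W (real k / real N) w - W (real 0 / real N) w" by (rule sum_lessThan_telescope)
    finally show ?thesis using W0 by simp
  qed
  define a where "a = Min ((\<lambda>k. gw.S (k * l) w) ` {..n})"
  define b where "b = Min ((\<lambda>j. gw.S j w) ` {..N})"
  have g: "g = a - b" unfolding g_def gw.grid_gap_def a_def b_def by (simp add: N_def)
  have "b \<le> gw.S (k * l) w" if "k \<le> n" for k
    unfolding b_def using that by (intro Min_le) (auto simp: N_def)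
  then have ba: "b \<le> a" unfolding a_def by (subst Min_ge_iff) auto
  then show "0 \<le> g" by (simp add: g)
  have R: "\<bar>gw.S j w\<bar> \<le> R" if "j \<le> N" for j
    unfolding R_def gw.osc_def using that by (intro Max_ge) (auto simp: S W0)
  show R0: "0 \<le> R" using R[of 0] by simp
  have "- R \<le> gw.S j w" if "j \<le> N" for j using R[OF that] by simp
  then have bR: "- R \<le> b" unfolding b_def by (subst Min_ge_iff) auto
  have "a = (MIN k\<in>{0..n}. W (real k / real n) w)"
    unfolding a_def S using l by (simp add: N_def atLeast0AtMost)
  then have ref_n: "reflected n n w = W 1 w + sqrt x0 + neg_part (a + sqrt x0)"
    using n reflected_eq[OF W0, of n n] by simp
  have "b = (MIN k\<in>{0..N}. W (real k / real N) w)" unfolding b_def S by (simp add: atLeast0AtMost)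
  then have ref_N: "reflected N N w = W 1 w + sqrt x0 + neg_part (b + sqrt x0)"
    using N reflected_eq[OF W0, of N N] by simp
  have W1: "\<bar>W 1 w\<bar> \<le> R" using R[of N] N by (simp add: S)
  define u where "u = reflected n n w"
  define v where "v = reflected N N w"
  have sx: "sqrt x0 \<ge> 0" using x0 by simp
  have "0 \<le> u" unfolding u_def by (rule reflected_nonneg)
  moreover have "u \<le> v" "v - u \<le> g" "v \<le> sqrt x0 + 2 * R"
    using ba g bR W1 R0 sx unfolding u_def v_def ref_n ref_N neg_part_def by linarith+
  ultimately have uv: "0 \<le> u" "u \<le> v" "v - u \<le> g" "v \<le> sqrt x0 + 2 * R" .
  have "\<bar>X_hat W x0 n w - X_hat W x0 N w\<bar> = v\<^sup>2 - u\<^sup>2"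
    using uv by (simp add: X_hat_eq[OF W0 n] X_hat_eq[OF W0 N] u_def v_def power_mono)
  also have "\<dots> = (v - u) * (v + u)" by (simp add: power2_eq_square algebra_simps)
  also have "\<dots> \<le> g * (2 * (sqrt x0 + 2 * R))"
    using uv ba g by (intro mult_mono) auto
  finally show "\<bar>X_hat W x0 n w - X_hat W x0 N w\<bar> \<le> 2 * g * (sqrt x0 + 2 * R)" by (simp add: algebra_simps)
qed

text \<open>The factor r^p with r = sqrt n is placed inside the integral, where it scales the gap to
  order 1, and is divided out at the end. The constant depends on neither n nor l, which permits l
  to tend to infinity afterwards.\<close>

lemma X_hat_refinement_moment:
  assumes "p > 0"
  obtains A where "A > 0"
    and "\<And>n l :: nat. n > 0 \<Longrightarrow> l \<ge> n\<^sup>2 \<Longrightarrow>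
      (\<integral>\<^sup>+w. ennreal (\<bar>X_hat W x0 n w - X_hat W x0 (n * l) w\<bar> powr p) \<partial>M) \<le> ennreal (A * real n powr (- p / 2))"
proof -
  define c where "c = 2 powr p * (2 * p) powr (2 * p)"
  define A1 where "A1 = 4 * (56 * exp 1)\<^sup>2 * (8 * exp (35 / 2 :: real))"
  define A2 where "A2 = exp (sqrt x0) * (8 * exp (35 / 2))"
  have pos: "c > 0" "A1 > 0" "A2 > 0" using assms by (simp_all add: c_def A1_def A2_def)
  show ?thesis
  proof (rule that[of "c * (A1 + A2)"])
    fix n l :: nat assume n: "n > 0" and ln: "l \<ge> n\<^sup>2"
    have l: "l > 0" using n ln by (intro less_le_trans[OF _ ln]) auto
    let ?N = "n * l"
    have N: "?N > 0" using n l by simp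
    interpret gw: gaussian_walk M "dW ?N" ?N "sqrt (1 / real ?N)" by (rule dW_walk[OF N])
    let ?g = "gw.grid_gap n l" and ?R = "gw.osc 0 ?N"
    define r where "r = sqrt (real n)"
    have r: "r > 0" using n by (simp add: r_def)
    have rp: "r powr p = real n powr (p / 2)" using n by (simp add: r_def powr_half_sqrt[symmetric] powr_powr)
    have gm: "?g \<in> borel_measurable M"
      unfolding gw.grid_gap_def[abs_def]
      by (intro borel_measurable_diff borel_measurable_Min gw.measurable_S) auto
    have Rm: "?R \<in> borel_measurable M" by (rule gw.osc_measurable) simp
    have "(\<integral>\<^sup>+w. ennreal (r powr p) * ennreal (\<bar>X_hat W x0 n w - X_hat W x0 ?N w\<bar> powr p) \<partial>M)
      \<le> (\<integral>\<^sup>+w. ennreal c * (ennreal (exp (r * ?g w)) + ennreal (exp (sqrt x0)) * ennreal (exp (4 * ?R w))) \<partial>M)"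
    proof (rule nn_integral_mono_AE)
      show "AE w in M. ennreal (r powr p) * ennreal (\<bar>X_hat W x0 n w - X_hat W x0 ?N w\<bar> powr p)
        \<le> ennreal c * (ennreal (exp (r * ?g w)) + ennreal (exp (sqrt x0)) * ennreal (exp (4 * ?R w)))"
        using W_0
      proof eventually_elim
        case (elim w)
        note b = X_hat_refinement[OF n l elim]
        let ?d = "\<bar>X_hat W x0 n w - X_hat W x0 ?N w\<bar>"
        have sx: "sqrt x0 \<ge> 0" using x0 by simp
        have "r * ?d \<le> r * (2 * ?g w * (sqrt x0 + 2 * ?R w))" using r b(3) by (intro mult_left_mono) auto
        also have "\<dots> = 2 * (r * ?g w) * (sqrt x0 + 2 * ?R w)" by simp
        finally have "(r * ?d) powr p \<le> (2 * (r * ?g w) * (sqrt x0 + 2 * ?R w)) powr p"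
          using r assms by (intro powr_mono2) auto
        also have "\<dots> \<le> c * (exp (r * ?g w) + exp (sqrt x0 + 2 * ?R w))"
          unfolding c_def using r b(1,2) sx assms by (intro powr_mult_le) auto
        also have "\<dots> \<le> c * (exp (r * ?g w) + exp (sqrt x0) * exp (4 * ?R w))"
          using b(2) pos(1) by (intro mult_left_mono add_left_mono) (simp_all flip: exp_add)
        finally have "r powr p * ?d powr p \<le> c * (exp (r * ?g w) + exp (sqrt x0) * exp (4 * ?R w))"
          using r by (simp add: powr_mult)
        then have "ennreal (r powr p * ?d powr p) \<le> ennreal (c * (exp (r * ?g w) + exp (sqrt x0) * exp (4 * ?R w)))"
          by (rule ennreal_leI)
        then show ?case using pos by (simp add: ennreal_mult')
      qed
    qed
    also have "\<dots> = ennreal c * ((\<integral>\<^sup>+w. ennreal (exp (r * ?g w)) \<partial>M) + ennreal (exp (sqrt x0)) * (\<integral>\<^sup>+w. ennreal (exp (4 * ?R w)) \<partial>M))"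
      using gm Rm by (simp add: nn_integral_cmult nn_integral_add)
    also have "\<dots> \<le> ennreal c * (ennreal A1 + ennreal (exp (sqrt x0)) * ennreal (8 * exp (35 / 2)))"
    proof (intro mult_left_mono add_mono)
      show "(\<integral>\<^sup>+w. ennreal (exp (r * ?g w)) \<partial>M) \<le> ennreal A1"
        unfolding A1_def r_def by (rule gw.nn_integral_exp_grid_gap[OF n ln refl refl])
      show "(\<integral>\<^sup>+w. ennreal (exp (4 * ?R w)) \<partial>M) \<le> ennreal (8 * exp (35 / 2))"
        using gw.nn_integral_exp_osc[OF N, of 0] n l by (simp add: real_sqrt_divide)
    qed auto
    also have "\<dots> = ennreal (c * (A1 + A2))"
      using pos by (simp add: A2_def ennreal_mult')
    finally have le: "(\<integral>\<^sup>+w. ennreal (r powr p) * ennreal (\<bar>X_hat W x0 n w - X_hat W x0 ?N w\<bar> powr p) \<partial>M) \<le> ennreal (c * (A1 + A2))" .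
    let ?I = "\<integral>\<^sup>+w. ennreal (\<bar>X_hat W x0 n w - X_hat W x0 ?N w\<bar> powr p) \<partial>M"
    have "?I = ennreal (real n powr (- p / 2)) * (ennreal (r powr p) * ?I)"
      unfolding mult.assoc[symmetric] rp using n by (simp flip: ennreal_mult' powr_add)
    also have "ennreal (r powr p) * ?I = (\<integral>\<^sup>+w. ennreal (r powr p) * ennreal (\<bar>X_hat W x0 n w - X_hat W x0 ?N w\<bar> powr p) \<partial>M)"
      by (rule nn_integral_cmult[symmetric]) measurable
    also have "ennreal (real n powr (- p / 2)) * \<dots> \<le> ennreal (real n powr (- p / 2)) * ennreal (c * (A1 + A2))"
      using le by (intro mult_left_mono) auto
    also have "\<dots> = ennreal (c * (A1 + A2) * real n powr (- p / 2))"
      using pos by (simp add: mult.commute flip: ennreal_mult')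
    finally show "?I \<le> ennreal (c * (A1 + A2) * real n powr (- p / 2))" .
  qed (use pos in simp)
qed

text \<open>X 1 is near \<open>X_hat W x0 N w\<close> only in probability, which does not control
  moments. The p-th power of the error is therefore cut at K: the exceptional event then contributes
  at most K times its probability. The resulting bound does not depend on K, and monotone
  convergence removes the cut.\<close>

lemma X_hat_moment:
  assumes "p > 0"
  obtains A where "A > 0"
    and "\<And>n::nat. n > 0 \<Longrightarrow> (\<integral>\<^sup>+w. ennreal (\<bar>X 1 w - X_hat W x0 n w\<bar> powr p) \<partial>M) \<le> ennreal (A * real n powr (- p / 2))"
proof -
  obtain A where A: "A > 0" "\<And>n l :: nat. n > 0 \<Longrightarrow> l \<ge> n\<^sup>2 \<Longrightarrow>
      (\<integral>\<^sup>+w. ennreal (\<bar>X_hat W x0 n w - X_hat W x0 (n * l) w\<bar> powr p) \<partial>M) \<le> ennreal (A * real n powr (- p / 2))"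
    using X_hat_refinement_moment[OF assms] by blast
  define B where "B = 2 powr p * (A + 1) + 1"
  have B: "B > 0" using A by (simp add: B_def add_pos_pos)
  show ?thesis
  proof (rule that[OF B])
    fix n :: nat assume n: "n > 0"
    define h where "h = real n powr (- p / 2)"
    \<comment> \<open>The distance allowed between X 1 and the fine approximation: its p-th power is
      exactly the target order \<open>h\<close>.\<close>
    define \<eta> where "\<eta> = real n powr (- 1 / 2)"
    have h: "h > 0" "\<eta> > 0" "\<eta> powr p = h" using n by (simp_all add: h_def \<eta>_def powr_powr)
    define f where "f w = \<bar>X 1 w - X_hat W x0 n w\<bar> powr p" for w
    have fm[measurable]: "f \<in> borel_measurable M" unfolding f_def[abs_def] by measurable
    have trunc: "(\<integral>\<^sup>+w. ennreal (min (f w) (real K)) \<partial>M) \<le> ennreal (B * h)" for K :: nat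
    proof -
      \<comment> \<open>Its second entry limits the exceptional contribution, K times a probability
        of at most \<open>\<kappa>\<close>, by \<open>h\<close>; \<open>Suc K\<close> avoids
        division by 0.\<close>
      define \<kappa> where "\<kappa> = min \<eta> (h / real (Suc K))"
      have \<kappa>: "\<kappa> > 0" "\<kappa> \<le> \<eta>" "\<kappa> \<le> h / real (Suc K)" using h by (simp_all add: \<kappa>_def)
      obtain N0 where N0: "\<And>N. N \<ge> N0 \<Longrightarrow> \<P>(w in M. \<kappa> < \<bar>X 1 w - X_hat W x0 N w\<bar>) \<le> \<kappa>"
        using X_hat_tendsto_in_prob[OF \<kappa>(1)] unfolding eventually_sequentially by blast
      define l where "l = max N0 (n\<^sup>2)"
      define N where "N = n * l"
      have l: "l \<ge> n\<^sup>2" by (simp add: l_def)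
      have "N0 \<le> l" by (simp add: l_def)
      also have "l \<le> N" using n by (simp add: N_def)
      finally have PN: "\<P>(w in M. \<kappa> < \<bar>X 1 w - X_hat W x0 N w\<bar>) \<le> \<kappa>" by (rule N0)
      let ?E = "{w\<in>space M. \<kappa> < \<bar>X 1 w - X_hat W x0 N w\<bar>}"
      let ?d = "\<lambda>w. \<bar>X_hat W x0 n w - X_hat W x0 N w\<bar> powr p"
      have "(\<integral>\<^sup>+w. ennreal (min (f w) (real K)) \<partial>M)
        \<le> (\<integral>\<^sup>+w. ennreal (2 powr p) * ennreal (?d w) + ennreal (2 powr p * h) + ennreal (real K) * indicator ?E w \<partial>M)"
      proof (rule nn_integral_mono)
        fix w assume wM: "w \<in> space M"
        show "ennreal (min (f w) (real K)) \<le> ennreal (2 powr p) * ennreal (?d w) + ennreal (2 powr p * h) + ennreal (real K) * indicator ?E w"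
        proof (cases "w \<in> ?E")
          case True
          have "ennreal (min (f w) (real K)) \<le> ennreal (real K) * indicator ?E w"
            using True by (simp add: ennreal_leI)
          then show ?thesis by (rule order_trans) simp
        next
          case False
          then have "\<bar>X 1 w - X_hat W x0 N w\<bar> \<le> \<eta>" using wM \<kappa>(2) by auto
          then have "\<bar>X 1 w - X_hat W x0 n w\<bar> \<le> \<bar>X_hat W x0 n w - X_hat W x0 N w\<bar> + \<eta>" by linarith
          then have "f w \<le> (\<bar>X_hat W x0 n w - X_hat W x0 N w\<bar> + \<eta>) powr p"
            unfolding f_def using assms by (intro powr_mono2) auto
          also have "\<dots> \<le> 2 powr p * (?d w + \<eta> powr p)"
            using h(2) assms by (intro powr_add_le) auto
          finally have "min (f w) (real K) \<le> 2 powr p * ?d w + 2 powr p * h"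
            using h(3) by (simp add: distrib_left)
          then have "ennreal (min (f w) (real K)) \<le> ennreal (2 powr p * ?d w + 2 powr p * h)" by (rule ennreal_leI)
          also have "\<dots> = ennreal (2 powr p) * ennreal (?d w) + ennreal (2 powr p * h)"
            using h(1) by (simp add: ennreal_mult')
          finally show ?thesis by (rule order_trans) simp
        qed
      qed
      also have "\<dots> = ennreal (2 powr p) * (\<integral>\<^sup>+w. ennreal (?d w) \<partial>M) + ennreal (2 powr p * h) + ennreal (real K) * emeasure M ?E"
        by (simp add: nn_integral_add nn_integral_cmult nn_integral_cmult_indicator emeasure_space_1)
      also have "\<dots> \<le> ennreal (2 powr p) * ennreal (A * h) + ennreal (2 powr p * h) + ennreal h"
      proof (intro add_mono mult_left_mono order_refl)
        show "(\<integral>\<^sup>+w. ennreal (?d w) \<partial>M) \<le> ennreal (A * h)"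
          unfolding N_def h_def by (rule A(2)[OF n l])
        have "real K * prob ?E \<le> real (Suc K) * (h / real (Suc K))"
          using PN \<kappa>(3) h(1) by (intro mult_mono) auto
        then have "real K * prob ?E \<le> h" by simp
        then show "ennreal (real K) * emeasure M ?E \<le> ennreal h"
          by (simp add: emeasure_eq_measure ennreal_leI flip: ennreal_mult')
      qed auto
      \<comment> \<open>B collects 2^p A from the two grids, 2^p from the distance
        \<open>\<eta>\<close> and 1 from the exceptional event.\<close>
      also have "\<dots> = ennreal (B * h)"
        using A(1) h(1) by (simp add: B_def algebra_simps flip: ennreal_mult' ennreal_plus)
      finally show ?thesis .
    qed
    have "(\<integral>\<^sup>+w. ennreal (f w) \<partial>M) = (\<integral>\<^sup>+w. (SUP K. ennreal (min (f w) (real K))) \<partial>M)"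
    proof (rule nn_integral_cong)
      fix w
      obtain K :: nat where "f w \<le> real K" using real_arch_simple by blast
      then have "ennreal (f w) \<le> (SUP K. ennreal (min (f w) (real K)))"
        by (intro SUP_upper2[of K]) auto
      moreover have "(SUP K. ennreal (min (f w) (real K))) \<le> ennreal (f w)"
        by (intro SUP_least ennreal_leI) simp
      ultimately show "ennreal (f w) = (SUP K. ennreal (min (f w) (real K)))" by (rule antisym)
    qed
    also have "\<dots> = (SUP K. \<integral>\<^sup>+w. ennreal (min (f w) (real K)) \<partial>M)"
      by (rule nn_integral_monotone_convergence_SUP) (auto simp: incseq_def le_fun_def intro!: ennreal_leI)
    also have "\<dots> \<le> ennreal (B * h)" by (intro SUP_least trunc)
    finally show "(\<integral>\<^sup>+w. ennreal (\<bar>X 1 w - X_hat W x0 n w\<bar> powr p) \<partial>M) \<le> ennreal (B * real n powr (- p / 2))"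
      by (simp add: f_def h_def)
  qed
qed

lemma Lp_error_X_hat:
  assumes "p \<ge> 1"
  shows "(\<lambda>n. Lp_error M p (X 1) (X_hat W x0 n)) \<preccurlyeq> (\<lambda>n. ennreal (real n powr (- 1 / 2)))"
proof -
  obtain A where A: "A > 0" "\<And>n::nat. n > 0 \<Longrightarrow>
    (\<integral>\<^sup>+w. ennreal (\<bar>X 1 w - X_hat W x0 n w\<bar> powr p) \<partial>M) \<le> ennreal (A * real n powr (- p / 2))"
    using X_hat_moment[of p] assms by auto
  show ?thesis
    unfolding preccurlyeq_def
  proof (intro exI[of _ "A powr (1 / p)"] conjI allI impI)
    show "A powr (1 / p) > 0" using A(1) by simp
    fix n :: nat assume n: "1 \<le> n"
    define m where "m = (\<integral>\<^sup>+w. ennreal (\<bar>X 1 w - X_hat W x0 n w\<bar> powr p) \<partial>M)"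
    have m: "m \<le> ennreal (A * real n powr (- p / 2))" unfolding m_def using A(2) n by simp
    then have fin: "m \<noteq> \<infinity>" by (auto simp: top_unique)
    have "enn2real m \<le> A * real n powr (- p / 2)"
      using m A(1) by (simp add: enn2real_leI)
    then have "enn2real m powr (1 / p) \<le> (A * real n powr (- p / 2)) powr (1 / p)"
      using assms by (intro powr_mono2) auto
    also have "\<dots> = A powr (1 / p) * real n powr (- 1 / 2)"
      using A(1) assms by (simp add: powr_mult powr_powr)
    finally have "ennreal (enn2real m powr (1 / p)) \<le> ennreal (A powr (1 / p) * real n powr (- 1 / 2))"
      by (rule ennreal_leI)
    then show "Lp_error M p (X 1) (X_hat W x0 n) \<le> ennreal (A powr (1 / p)) * ennreal (real n powr (- 1 / 2))"
      using fin unfolding Lp_error_def m_def[symmetric] Let_def by (simp add: ennreal_mult')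
  qed
qed

text \<open>\<open>X_hat\<close> also reads the path at time 0, which is not among the arguments of
  an equidistant method. The functional \<open>\<Phi>\<close> inserts the value 0 there and so
  agrees with \<open>X_hat\<close> almost surely.\<close>

lemma min_error_eq_le:
  assumes "n \<ge> 1"
  shows "min_error_eq M W p (X 1) n \<le> Lp_error M p (X 1) (X_hat W x0 n)"
proof -
  define \<Phi> where "\<Phi> z = ((z n + sqrt x0) + neg_part (min 0 (MIN k\<in>{1..n}. z k) + sqrt x0))\<^sup>2" for z :: "nat \<Rightarrow> real"
  have comp: "(\<lambda>z. z k) \<in> borel_measurable (PiM {1..n} (\<lambda>_. borel :: real measure))" if "k \<in> {1..n}" for k
    using that by (rule measurable_component_singleton)
  have \<Phi>: "\<Phi> \<in> borel_measurable (PiM {1..n} (\<lambda>_. borel))"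
    unfolding \<Phi>_def[abs_def] neg_part_def using assms
    by (intro borel_measurable_power borel_measurable_add borel_measurable_uminus borel_measurable_min borel_measurable_Min
        borel_measurable_const comp) auto
  have "AE w in M. \<Phi> (\<lambda>k\<in>{1..n}. W (real k / real n) w) = X_hat W x0 n w"
    using W_0
  proof eventually_elim
    case (elim w)
    have "{0..n} = insert 0 {1..n}" using assms by auto
    then have "(MIN k\<in>{0..n}. W (real k / real n) w) = min 0 (MIN k\<in>{1..n}. W (real k / real n) w)"
      using assms elim by (subst \<open>{0..n} = _\<close>, subst image_insert, subst Min_insert) auto
    moreover have "(\<lambda>k\<in>{1..n}. W (real k / real n) w) ` {1..n} = (\<lambda>k. W (real k / real n) w) ` {1..n}"
      by (intro image_cong) auto
    ultimately show ?case using assms by (simp add: \<Phi>_def X_hat_def)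
  qed
  then have "AE w in M. ennreal (\<bar>X 1 w - \<Phi> (\<lambda>k\<in>{1..n}. W (real k / real n) w)\<bar> powr p)
    = ennreal (\<bar>X 1 w - X_hat W x0 n w\<bar> powr p)"
    by eventually_elim simp
  then have "(\<integral>\<^sup>+w. ennreal (\<bar>X 1 w - \<Phi> (\<lambda>k\<in>{1..n}. W (real k / real n) w)\<bar> powr p) \<partial>M)
    = (\<integral>\<^sup>+w. ennreal (\<bar>X 1 w - X_hat W x0 n w\<bar> powr p) \<partial>M)"
    by (rule nn_integral_cong_AE)
  then have "Lp_error M p (X 1) (\<lambda>w. \<Phi> (\<lambda>k\<in>{1..n}. W (real k / real n) w)) = Lp_error M p (X 1) (X_hat W x0 n)"
    unfolding Lp_error_def by simp
  then show ?thesis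
    unfolding min_error_eq_def by (intro INF_lower2[OF \<Phi>]) simp
qed

end

theorem theorem2:
  fixes M :: "'a measure" and F :: "real \<Rightarrow> 'a measure"
    and W X :: "real \<Rightarrow> 'a \<Rightarrow> real" and x0 p :: real
  assumes "usual_filtered_prob_space M F"
    and "brownian_motion M F W"
    and "x0 \<ge> 0"
    and "strong_solution M F W (\<lambda>x. 1) (\<lambda>x. 2 * sqrt x) x0 X"
    and "AE \<omega> in M. \<forall>t\<ge>0. X t \<omega> \<ge> 0"
    and "1 \<le> p"
  shows "(\<lambda>n. Lp_error M p (X 1) (X_hat W x0 n)) \<preccurlyeq> (\<lambda>n. ennreal (real n powr (- 1 / 2))) \<and>
         min_error_eq M W p (X 1) \<preccurlyeq> (\<lambda>n. ennreal (real n powr (- 1 / 2)))"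
proof -
  interpret usual_filtered_prob_space M F by (rule assms)
  interpret sde M F W X x0 by unfold_locales (rule assms)+
  note le = Lp_error_X_hat[OF assms(6)]
  then have "min_error_eq M W p (X 1) \<preccurlyeq> (\<lambda>n. ennreal (real n powr (- 1 / 2)))"
    unfolding preccurlyeq_def using min_error_eq_le order_trans by blast
  with le show ?thesis ..
qed

end
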